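(* Let $n\ge2$. The restricted outer Weyl group of $\mathcal O_n$ is a proper subgroup of the outer Weyl group of $\mathcal O_n$.
   Context: $\mathcal O_n$ is the Cuntz algebra, the $C^*$-algebra generated by isometries $S_1,\dots,S_n$ with $\sum_{i=1}^n S_iS_i^*=1$. For a word $\mu=(\mu_1,\dots,\mu_k)$ in the letters $1,\dots,n$ put $S_\mu=S_{\mu_1}\cdots S_{\mu_k}$ ($=1$ for the empty word). $\mathcal F_n$ is the core UHF-subalgebra: the closed linear span of all $S_\mu S_\nu^*$ with $\mu,\nu$ words of equal length. $\mathcal S_n$ is the group of unitaries in $\mathcal O_n$ that are finite sums of elements of the form $S_\alpha S_\beta^*$ ($\alpha,\beta$ words), and $\mathcal P_n=\mathcal S_n\cap\mathcal F_n$. For a unitary $u\in\mathcal O_n$, $\lambda_u$ is the unital $*$-endomorphism of $\mathcal O_n$ with $\lambda_u(S_i)=uS_i$. For a set $A$ of unitaries, $\lambda(A)^{-1}=\{\lambda_u\in\operatorname{Aut}(\mathcal O_n):u\in A\}$. $\operatorname{Out}(\mathcal O_n)$ is the quotient of $\operatorname{Aut}(\mathcal O_n)$ by the inner automorphisms. The outer Weyl group of $\mathcal O_n$ is the image of the group $\lambda(\mathcal S_n)^{-1}$ in $\operatorname{Out}(\mathcal O_n)$; the restricted outer Weyl group is the image of the group $\lambda(\mathcal P_n)^{-1}$ in $\operatorname{Out}(\mathcal O_n)$. *)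

theory Defs
  imports "HOL-Analysis.Analysis" "HOL-Algebra.Bij" "HOL-Algebra.Coset"
begin

(* Unital C*-algebras as a type class. The superclass real_normed_algebra_1 contributes
   submultiplicativity of the norm, the unit and norm 1 = 1 (so the algebra is nonzero). *)
class cstar_algebra = real_normed_algebra_1 + banach +
  fixes scaleC :: "complex \<Rightarrow> 'a \<Rightarrow> 'a"  (infixr \<open>*\<^sub>C\<close> 75)
    and star :: "'a \<Rightarrow> 'a"
  assumes scaleC_add_right: "c *\<^sub>C (x + y) = c *\<^sub>C x + c *\<^sub>C y"
    and scaleC_add_left: "(c + d) *\<^sub>C x = c *\<^sub>C x + d *\<^sub>C x"
    and scaleC_scaleC: "c *\<^sub>C (d *\<^sub>C x) = (c * d) *\<^sub>C x"
    and scaleC_of_real: "complex_of_real r *\<^sub>C x = scaleR r x"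
    and mult_scaleC_left: "(c *\<^sub>C x) * y = c *\<^sub>C (x * y)"
    and mult_scaleC_right: "x * (c *\<^sub>C y) = c *\<^sub>C (x * y)"
    and norm_scaleC: "norm (c *\<^sub>C x) = cmod c * norm x"
    and star_add: "star (x + y) = star x + star y"
    and star_scaleC: "star (c *\<^sub>C x) = cnj c *\<^sub>C star x"
    and star_mult: "star (x * y) = star y * star x"
    and star_star: "star (star x) = x"
    and cstar_identity: "norm (star x * x) = (norm x)\<^sup>2"

definition isometry :: "'a::cstar_algebra \<Rightarrow> bool" where
  "isometry s \<longleftrightarrow> star s * s = 1"

definition unitary :: "'a::cstar_algebra \<Rightarrow> bool" where
  "unitary u \<longleftrightarrow> star u * u = 1 \<and> u * star u = 1"

definition closed_star_subalgebra :: "'a::cstar_algebra set \<Rightarrow> bool" where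
  "closed_star_subalgebra A \<longleftrightarrow> closed A \<and> 0 \<in> A \<and>
     (\<forall>x\<in>A. \<forall>y\<in>A. x + y \<in> A \<and> x * y \<in> A) \<and>
     (\<forall>c. \<forall>x\<in>A. c *\<^sub>C x \<in> A) \<and> (\<forall>x\<in>A. star x \<in> A)"

(* Unital *-endomorphisms of a *-subalgebra A; as usual for function groups in HOL-Algebra,
   maps are normalised to be undefined outside A so that equality is equality on A. *)
definition star_endos :: "'a::cstar_algebra set \<Rightarrow> ('a \<Rightarrow> 'a) set" where
  "star_endos A = {f \<in> extensional A. f ` A \<subseteq> A \<and> f 1 = 1 \<and>
     (\<forall>x\<in>A. \<forall>y\<in>A. f (x + y) = f x + f y \<and> f (x * y) = f x * f y) \<and>
     (\<forall>c. \<forall>x\<in>A. f (c *\<^sub>C x) = c *\<^sub>C f x) \<and> (\<forall>x\<in>A. f (star x) = star (f x))}"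

definition Aut :: "'a::cstar_algebra set \<Rightarrow> ('a \<Rightarrow> 'a) monoid" where
  "Aut A = BijGroup A \<lparr>carrier := star_endos A \<inter> Bij A\<rparr>"

definition Inn :: "'a::cstar_algebra set \<Rightarrow> ('a \<Rightarrow> 'a) set" where
  "Inn A = {\<lambda>x\<in>A. u * x * star u | u. u \<in> A \<and> unitary u}"

definition Out :: "'a::cstar_algebra set \<Rightarrow> ('a \<Rightarrow> 'a) set monoid" where
  "Out A = Aut A Mod Inn A"

definition out_class :: "'a::cstar_algebra set \<Rightarrow> ('a \<Rightarrow> 'a) \<Rightarrow> ('a \<Rightarrow> 'a) set" where
  "out_class A f = Inn A #>\<^bsub>Aut A\<^esub> f"

definition cuntz_isometries :: "nat \<Rightarrow> (nat \<Rightarrow> 'a::cstar_algebra) \<Rightarrow> bool" where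
  "cuntz_isometries n S \<longleftrightarrow> (\<forall>i\<in>{1..n}. isometry (S i)) \<and> (\<Sum>i=1..n. S i * star (S i)) = 1"

(* The C*-algebra generated by S 1, ..., S n inside the ambient algebra; if cuntz_isometries n S
   holds, this is a copy of the Cuntz algebra, and it contains the unit of the ambient algebra. *)
definition cuntz_algebra :: "nat \<Rightarrow> (nat \<Rightarrow> 'a::cstar_algebra) \<Rightarrow> 'a set" where
  "cuntz_algebra n S = closed_star_subalgebra hull (S ` {1..n})"

definition words :: "nat \<Rightarrow> nat list set" where
  "words n = lists {1..n}"

definition word_op :: "(nat \<Rightarrow> 'a::cstar_algebra) \<Rightarrow> nat list \<Rightarrow> 'a" where
  "word_op S \<mu> = prod_list (map S \<mu>)"

definition core_UHF :: "nat \<Rightarrow> (nat \<Rightarrow> 'a::cstar_algebra) \<Rightarrow> 'a set" where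
  "core_UHF n S = closure (module.span scaleC
     {word_op S \<mu> * star (word_op S \<nu>) | \<mu> \<nu>. \<mu> \<in> words n \<and> \<nu> \<in> words n \<and> length \<mu> = length \<nu>})"

definition S_unitaries :: "nat \<Rightarrow> (nat \<Rightarrow> 'a::cstar_algebra) \<Rightarrow> 'a set" where
  "S_unitaries n S = {u \<in> cuntz_algebra n S. unitary u \<and>
     (\<exists>ps \<in> lists (words n \<times> words n).
        u = (\<Sum>(\<alpha>, \<beta>) \<leftarrow> ps. word_op S \<alpha> * star (word_op S \<beta>)))}"

definition P_unitaries :: "nat \<Rightarrow> (nat \<Rightarrow> 'a::cstar_algebra) \<Rightarrow> 'a set" where
  "P_unitaries n S = S_unitaries n S \<inter> core_UHF n S"

(* is_lambda n S u f says that f is the endomorphism lambda_u. There is at most one such f,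
   because an endomorphism is determined by its values on the generators. *)
definition is_lambda :: "nat \<Rightarrow> (nat \<Rightarrow> 'a::cstar_algebra) \<Rightarrow> 'a \<Rightarrow> ('a \<Rightarrow> 'a) \<Rightarrow> bool" where
  "is_lambda n S u f \<longleftrightarrow> f \<in> star_endos (cuntz_algebra n S) \<and> (\<forall>i\<in>{1..n}. f (S i) = u * S i)"

(* The set lambda(U)^{-1}: those lambda_u with u in U that are automorphisms. *)
definition lambda_auts :: "nat \<Rightarrow> (nat \<Rightarrow> 'a::cstar_algebra) \<Rightarrow> 'a set \<Rightarrow> ('a \<Rightarrow> 'a) set" where
  "lambda_auts n S U = {f \<in> carrier (Aut (cuntz_algebra n S)). \<exists>u\<in>U. is_lambda n S u f}"

definition outer_Weyl_group :: "nat \<Rightarrow> (nat \<Rightarrow> 'a::cstar_algebra) \<Rightarrow> ('a \<Rightarrow> 'a) set set" where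
  "outer_Weyl_group n S = out_class (cuntz_algebra n S) ` lambda_auts n S (S_unitaries n S)"

definition restricted_outer_Weyl_group ::
    "nat \<Rightarrow> (nat \<Rightarrow> 'a::cstar_algebra) \<Rightarrow> ('a \<Rightarrow> 'a) set set" where
  "restricted_outer_Weyl_group n S =
     out_class (cuntz_algebra n S) ` lambda_auts n S (P_unitaries n S)"

end

theory Submission
  imports Defs
begin

text \<open>
  Let \<open>u\<close> be the unitary exchanging the cylinders \<open>11\<close> and \<open>121\<close>. Its endomorphism \<open>f\<close> fixes \<open>u\<close>, so it
  is an involution, and \<open>f (S 1)\<close> acts on \<open>S 1\<close> as right multiplication by \<open>S 2 * S 1\<close>. If \<open>f\<close> were inner
  equivalent to \<open>g\<close> with \<open>g (S 1)\<close> of degree \<open>1\<close> for the gauge grading, then \<open>G y = y B\<close> for an isometry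
  \<open>y\<close> and isometries \<open>G\<close>, \<open>B\<close> of degrees \<open>1\<close> and \<open>2\<close>; then \<open>1 = y\<^sup>* (G\<^sup>*)\<^sup>k y B\<^sup>k\<close> is a limit of elements
  without component of degree \<open>0\<close>, contradicting Cuntz's contractive projection onto degree \<open>0\<close>.

  That \<open>f\<close> exists is Cuntz's uniqueness theorem: the norm of a polynomial of degree at most \<open>d\<close> changes at
  most by a factor \<open>2 d + 1\<close> when the generators are replaced, and the C*-identity for high powers
  removes that factor.

  For the group property let \<open>f\<close> be an automorphism with \<open>f (S i) = u * S i\<close> and \<open>f v = u\<^sup>*\<close>. Different monomials
  have images without common summands, since otherwise some corner of the algebra would be
  finite-dimensional. Hence a polynomial close to \<open>v\<close> can be rounded to one with coefficients \<open>0\<close>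
  and \<open>1\<close> whose image is exactly \<open>u\<^sup>*\<close>, so \<open>v\<close> is itself a sum of words.
\<close>

section \<open>C*-identities\<close>

text \<open>Everything happens inside an arbitrary algebra satisfying the C*-axioms, with no Hilbert
  space, no order on selfadjoint elements and no circle action. So even the orthogonality of the
  ranges of the \<open>S i\<close> is extracted from norm estimates, and degree is attached to
  words, not to elements: because the projections \<open>S i * star (S i)\<close> sum to
  \<open>1\<close>, an element has many presentations by words, and each statement about its
  components must come from an inequality between norms. The words 11 and 121 both begin with 1, so
  \<open>u\<close> leaves \<open>S 2\<close> alone and turns \<open>S 1\<close> into
  \<open>S 1 * R\<close>, where \<open>R\<close> exchanges the cylinders 1 and 21; their lengths
  differ, which is what makes degree 1 meet degree 2. An inner automorphism need not respect
  degrees, so the mere imbalance of \<open>u\<close> says nothing about the class of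
  \<open>f\<close>. The intertwining relation survives conjugation, and its powers push the
  discrepancy of degrees beyond the spread of any polynomial approximating \<open>y\<close>.\<close>

interpretation cscale: vector_space "scaleC :: complex \<Rightarrow> 'a \<Rightarrow> 'a::cstar_algebra"
proof
  fix x :: 'a
  show "1 *\<^sub>C x = x"
    using scaleC_of_real[of 1 x] by simp
qed (simp_all add: scaleC_add_right scaleC_add_left scaleC_scaleC)

lemma star_0 [simp]: "star (0::'a::cstar_algebra) = 0"
  using star_add[of "0::'a" 0] by simp

lemma star_minus: "star (- x) = - star (x::'a::cstar_algebra)"
  using star_add[of x "- x"] by (simp add: eq_neg_iff_add_eq_0 add.commute)

lemma star_diff: "star (x - y) = star x - star (y::'a::cstar_algebra)"
  using star_add[of x "- y"] by (simp add: star_minus)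

lemma star_1 [simp]: "star (1::'a::cstar_algebra) = 1"
  by (metis mult.right_neutral star_mult star_star mult_1)

lemma star_scaleR: "star (r *\<^sub>R x) = r *\<^sub>R star (x::'a::cstar_algebra)"
  using star_scaleC[of "complex_of_real r" x] by (simp add: scaleC_of_real del: of_real_divide)

lemma star_sum: "star (sum f A) = (\<Sum>i\<in>A. star (f i :: 'a::cstar_algebra))"
  by (induction A rule: infinite_finite_induct) (simp_all add: star_add)

lemma star_power: "star (x ^ k) = star (x::'a::cstar_algebra) ^ k"
  by (induction k) (simp_all add: star_mult power_commutes)

lemma norm_star [simp]: "norm (star x) = norm (x::'a::cstar_algebra)"
proof -
  have *: "norm y \<le> norm (star y)" for y :: 'a
  proof (cases "y = 0")
    case False
    have "norm y * norm y \<le> norm (star y) * norm y"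
      using cstar_identity[of y] norm_mult_ineq[of "star y" y] by (simp add: power2_eq_square)
    then show ?thesis
      using False by simp
  qed simp
  show ?thesis
    using *[of x] *[of "star x"] by (simp add: star_star)
qed

lemma continuous_star: "(f \<longlongrightarrow> l) F \<Longrightarrow> ((\<lambda>x. star (f x)) \<longlongrightarrow> star (l::'a::cstar_algebra)) F"
  by (simp add: tendsto_iff dist_norm flip: star_diff)

lemma star_mult_self_eq_0: "star x * x = 0 \<longleftrightarrow> (x::'a::cstar_algebra) = 0"
  using cstar_identity[of x] by auto

lemma isometry_cancel: "isometry s \<Longrightarrow> star s * (s * x) = (x::'a::cstar_algebra)"
  by (simp add: isometry_def flip: mult.assoc)

lemma norm_isometry_mult: "isometry s \<Longrightarrow> norm (s * x) = norm (x::'a::cstar_algebra)"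
proof -
  assume "isometry s"
  then have "star (s * x) * (s * x) = star x * x"
    by (simp add: star_mult mult.assoc isometry_cancel)
  then show ?thesis
    by (metis cstar_identity norm_ge_zero power2_eq_imp_eq)
qed

lemma norm_isometry: "isometry s \<Longrightarrow> norm (s::'a::cstar_algebra) = 1"
  using norm_isometry_mult[of s 1] by simp

lemma norm_star_isometry_mult_le: "isometry s \<Longrightarrow> norm (star s * x) \<le> norm (x::'a::cstar_algebra)"
  using norm_mult_ineq[of "star s" x] by (simp add: norm_isometry)

lemma norm_mult_isometry_le: "isometry s \<Longrightarrow> norm (x * s) \<le> norm (x::'a::cstar_algebra)"
  using norm_mult_ineq[of x s] by (simp add: norm_isometry)

lemma norm_mult_star_isometry: "isometry s \<Longrightarrow> norm (x * star s) = norm (x::'a::cstar_algebra)"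
  by (metis norm_isometry_mult norm_star star_mult star_star)

lemma isometry_mult: "isometry s \<Longrightarrow> isometry t \<Longrightarrow> isometry (s * t :: 'a::cstar_algebra)"
  using isometry_cancel[of s t] by (simp add: isometry_def star_mult mult.assoc)

lemma isometry_1: "isometry (1::'a::cstar_algebra)"
  by (simp add: isometry_def)

lemma isometry_power: "isometry s \<Longrightarrow> isometry (s ^ k :: 'a::cstar_algebra)"
  by (induction k) (simp_all add: isometry_1 isometry_mult)

lemma unitary_isometry: "unitary u \<Longrightarrow> isometry u"
  by (simp add: unitary_def isometry_def)

lemma unitary_star: "unitary u \<Longrightarrow> unitary (star u)"
  by (simp add: unitary_def star_star)

lemma unitary_mult: "unitary u \<Longrightarrow> unitary v \<Longrightarrow> unitary (u * v)"
  using isometry_cancel[of u v] isometry_cancel[of "star v" "star u"]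
  by (simp add: isometry_def unitary_def star_mult star_star mult.assoc)

lemma unitary_1: "unitary 1"
  by (simp add: unitary_def)

lemma norm_selfadjoint_power:
  assumes "star (x::'a::cstar_algebra) = x"
  shows "norm (x ^ 2 ^ m) = norm x ^ 2 ^ m"
proof (induction m)
  case (Suc m)
  have "norm (x ^ 2 ^ Suc m) = norm (star (x ^ 2 ^ m) * x ^ 2 ^ m)"
    by (simp add: star_power assms flip: power_add mult_2)
  also have "\<dots> = (norm x ^ 2 ^ m)\<^sup>2"
    by (simp add: cstar_identity Suc)
  finally show ?case
    by (simp flip: power_mult add: mult.commute)
qed simp

text \<open>Powers wash out any factor that grows subexponentially with the degree.\<close>

lemma norm_le_by_powers:
  fixes a :: "'a::cstar_algebra" and b :: "'b::cstar_algebra"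
  assumes bound: "\<And>m. norm ((star b * b) ^ 2 ^ m) \<le> C * 2 ^ m * norm ((star a * a) ^ 2 ^ m)"
  shows "norm b \<le> norm a"
proof (rule ccontr)
  assume less: "\<not> norm b \<le> norm a"
  define x y where "x = norm a ^ 2" and "y = norm b ^ 2"
  have xy: "0 \<le> x" "x < y"
    using less by (auto simp: x_def y_def intro!: power_strict_mono)
  have star_aa: "star (star z * z) = star z * z" for z :: "'c::cstar_algebra"
    by (simp add: star_mult star_star)
  have *: "y ^ 2 ^ m \<le> C * 2 ^ m * x ^ 2 ^ m" for m
    using bound[of m] norm_selfadjoint_power[OF star_aa, of a m] norm_selfadjoint_power[OF star_aa, of b m]
    by (simp add: cstar_identity x_def y_def)
  have "x \<noteq> 0"
    using *[of 0] xy by auto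
  with xy have x: "x > 0" by simp
  define r where "r = y / x - 1"
  have r: "r > 0" using xy x by (simp add: r_def)
  have le: "(1 + r) ^ 2 ^ m \<le> C * 2 ^ m" for m
    using *[of m] x by (simp add: r_def power_divide divide_le_eq)
  \<comment> \<open>Bernoulli's inequality alone gives linear growth in \<open>2 ^ m\<close>.
    Squaring it, to reach the exponent \<open>2 ^ Suc m\<close>, gives quadratic growth, which beats
    the linear factor.\<close>
  have "r * r * 2 ^ m \<le> C * 2" for m
  proof -
    have "(1 + r) ^ 2 ^ Suc m \<le> C * 2 ^ Suc m" by (rule le)
    moreover have "(1 + r) ^ 2 ^ Suc m = ((1 + r) ^ 2 ^ m) ^ 2"
      by (simp flip: power_mult add: mult.commute)
    moreover have "r * 2 ^ m \<le> (1 + r) ^ 2 ^ m"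
      using Bernoulli_inequality[of r "2 ^ m"] r by (simp add: mult.commute)
    then have "(r * 2 ^ m) ^ 2 \<le> ((1 + r) ^ 2 ^ m) ^ 2"
      using r by (intro power_mono) auto
    ultimately have "(r * 2 ^ m) ^ 2 \<le> C * 2 ^ Suc m"
      by linarith
    also have "(r * 2 ^ m) ^ 2 = (r * r * 2 ^ m) * 2 ^ m"
      by (simp only: power2_eq_square mult_ac)
    also have "C * 2 ^ Suc m = (C * 2) * 2 ^ m"
      by simp
    finally show ?thesis
      by (rule mult_right_le_imp_le) simp
  qed
  moreover obtain m where "C * 2 / (r * r) < 2 ^ m"
    using real_arch_pow[of 2] by auto
  then have "C * 2 < r * r * 2 ^ m"
    using r by (simp add: field_simps)
  ultimately show False
    by (meson not_le)
qed

section \<open>Orthogonality of the ranges\<close>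

text \<open>Consecutive coefficients have the ratio \<open>(1/2 - k) / (k + 1)\<close>, of modulus
  at most 1. This crude bound already lets a geometric series dominate the binomial series of the
  square root.\<close>

lemma norm_gbinomial_half_le: "\<bar>(1/2 :: real) gchoose k\<bar> \<le> 1"
proof (induction k)
  case (Suc k)
  have "(1/2 :: real) gchoose Suc k = (1/2 gchoose k) * ((1/2 - real k) / real (Suc k))"
    by (simp add: gbinomial_prod_rev field_simps)
  moreover have "\<bar>(1/2 - real k) / real (Suc k)\<bar> \<le> 1"
    by (auto simp: field_simps abs_if)
  ultimately show ?case
    using mult_mono[OF Suc, of "\<bar>(1/2 - real k) / real (Suc k)\<bar>" 1] by (simp add: abs_mult)
qed simp

text \<open>The square root is given by the binomial series, hence lies in every closed subalgebra
  containing \<open>x\<close> and commutes with whatever commutes with \<open>x\<close>.\<close>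

lemma sqrt_one_minus:
  fixes x :: "'a::cstar_algebra"
  assumes "norm x < 1" "star x = x"
  obtains s where "star s = s" "s * s = 1 - x" "\<And>y. y * x = x * y \<Longrightarrow> y * s = s * y"
    "\<And>A. closed_star_subalgebra A \<Longrightarrow> 1 \<in> A \<Longrightarrow> x \<in> A \<Longrightarrow> s \<in> A"
proof -
  define c :: "nat \<Rightarrow> real" where "c k = (1/2 gchoose k) * (-1) ^ k" for k
  define t where "t k = c k *\<^sub>R x ^ k" for k
  have abs_c: "\<bar>c k\<bar> \<le> 1" for k
    using norm_gbinomial_half_le[of k] by (simp add: c_def abs_mult power_abs)
  have summ: "summable (\<lambda>k. norm (t k))"
  proof (rule summable_comparison_test)
    show "\<exists>N. \<forall>k\<ge>N. norm (norm (t k)) \<le> norm x ^ k"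
    proof (intro exI allI impI)
      fix k
      show "norm (norm (t k)) \<le> norm x ^ k"
        using mult_mono[OF abs_c[of k] norm_power_ineq[of x k]] by (simp add: t_def)
    qed
    show "summable (\<lambda>k. norm x ^ k)"
      using assms(1) by (intro summable_geometric) simp
  qed
  define s where "s = (\<Sum>k. t k)"
  have sums: "t sums s"
    unfolding s_def by (rule summable_sums[OF summable_norm_cancel[OF summ]])
  have star_t: "star (t k) = t k" for k
    by (simp add: t_def star_scaleR star_power assms(2))
  have 1: "star s = s"
    using continuous_star[OF sums[unfolded sums_def]] sums
    by (simp add: star_sum star_t sums_def LIMSEQ_unique)
  \<comment> \<open>Vandermonde's identity turns the Cauchy product of the series for exponent 1/2
    into the series for exponent 1, which stops after \<open>1 - x\<close>.\<close>
  have "(\<lambda>k. \<Sum>i\<le>k. t i * t (k - i)) sums (s * s)"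
    unfolding s_def by (rule Cauchy_product_sums[OF summ summ])
  moreover have "(\<Sum>i\<le>k. t i * t (k - i)) = ((1 gchoose k) * (-1) ^ k) *\<^sub>R x ^ k" for k
  proof -
    have "(\<Sum>i\<le>k. t i * t (k - i)) = (\<Sum>i\<le>k. ((1/2 gchoose i) * (1/2 gchoose (k - i)) * (-1) ^ k) *\<^sub>R x ^ k)"
    proof (rule sum.cong)
      fix i assume "i \<in> {..k}"
      then have "x ^ i * x ^ (k - i) = x ^ k" "(-1::real) ^ i * (-1) ^ (k - i) = (-1) ^ k"
        by (simp_all flip: power_add)
      then show "t i * t (k - i) = ((1/2 gchoose i) * (1/2 gchoose (k - i)) * (-1) ^ k) *\<^sub>R x ^ k"
        by (simp add: t_def c_def mult_ac)
    qed simp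
    also have "\<dots> = ((\<Sum>i\<le>k. (1/2 gchoose i) * (1/2 gchoose (k - i))) * (-1) ^ k) *\<^sub>R x ^ k"
      by (simp add: scaleR_sum_left sum_distrib_right)
    finally show ?thesis
      using gbinomial_Vandermonde[of "1/2::real" "1/2" k] by (simp add: atLeast0AtMost)
  qed
  moreover have "(\<lambda>k. ((1 gchoose k) * (-1) ^ k) *\<^sub>R x ^ k) sums (\<Sum>k\<in>{..1::nat}. ((1 gchoose k) * (-1) ^ k) *\<^sub>R x ^ k)"
  proof (rule sums_finite)
    fix k :: nat assume "k \<notin> {..1}"
    then show "((1 gchoose k) * (-1) ^ k) *\<^sub>R x ^ k = 0"
      using binomial_gbinomial[of 1 k, where ?'a = real] by (simp add: binomial_eq_0)
  qed simp
  ultimately have 2: "s * s = 1 - x"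
    by (simp add: sums_iff)
  have 3: "y * s = s * y" if "y * x = x * y" for y
  proof -
    have "y * t k = t k * y" for k
      using power_commuting_commutes[OF that[symmetric], of k] by (simp add: t_def)
    then show ?thesis
      using sums_mult[OF sums, of y] sums_mult2[OF sums, of y] by (simp add: sums_iff)
  qed
  have 4: "s \<in> A" if A: "closed_star_subalgebra A" "1 \<in> A" "x \<in> A" for A
  proof -
    have "x ^ k \<in> A" for k
      using A by (induction k) (auto simp: closed_star_subalgebra_def)
    then have "t k \<in> A" for k
      using A(1) unfolding closed_star_subalgebra_def t_def by (metis scaleC_of_real)
    then have "sum t {..<k} \<in> A" for k
      using A(1) by (induction k) (auto simp: closed_star_subalgebra_def)
    then show ?thesis
      using A(1) sums unfolding closed_star_subalgebra_def sums_def
      by (metis closed_sequentially)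
  qed
  show ?thesis
    using that 1 2 3 4 by blast
qed

text \<open>\<open>s\<close> is the real part of \<open>U = s + \<i> *\<^sub>C t\<close>, and
  commutation makes \<open>star U * U\<close> equal to \<open>s * s + t * t\<close>.\<close>

lemma imaginary_unitary_norm:
  fixes s t :: "'a::cstar_algebra"
  assumes "star s = s" "star t = t" "s * t = t * s"
  shows "norm s ^ 2 \<le> norm (s * s + t * t)"
proof -
  define U where "U = s + \<i> *\<^sub>C t"
  have star_U: "star U = s - \<i> *\<^sub>C t"
    by (simp add: U_def star_add star_scaleC assms)
  have "star U * U = s * s + t * t"
    unfolding star_U unfolding U_def
    by (simp add: algebra_simps mult_scaleC_left mult_scaleC_right scaleC_add_right scaleC_scaleC assms(3))
  then have "norm U ^ 2 = norm (s * s + t * t)"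
    by (metis cstar_identity)
  moreover have "U + star U = 2 *\<^sub>R s"
    unfolding star_U by (simp add: U_def scaleR_2)
  then have "2 * norm s \<le> norm U + norm U"
    using norm_triangle_ineq[of U "star U"] by simp
  then have "norm s ^ 2 \<le> norm U ^ 2"
    by (intro power_mono) auto
  ultimately show ?thesis
    by simp
qed

text \<open>For \<open>r < 1\<close> the elements \<open>1 - r x\<close> and \<open>1 - r y\<close>
  have selfadjoint square roots, which commute because \<open>y = 2 - x\<close>. Their squares add
  up to the small scalar \<open>2 * (1 - r)\<close>, so each is small; then \<open>r\<close> tends
  to 1.\<close>

lemma midpoint_one_extreme:
  fixes x y :: "'a::cstar_algebra"
  assumes "norm x \<le> 1" "norm y \<le> 1" "star x = x" "star y = y" "x + y = 2"
  shows "x = 1"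
proof -
  have y: "y = 2 - x"
    using assms(5) by (simp add: algebra_simps)
  have le: "norm (1 - r *\<^sub>R x) \<le> 2 * (1 - r)" if r: "0 < r" "r < 1" for r
  proof -
    have "r * norm x \<le> r" "r * norm y \<le> r"
      using r assms(1,2) by (intro mult_left_le; simp)+
    then have "norm (r *\<^sub>R x) < 1" "norm (r *\<^sub>R y) < 1"
      using r by (simp_all only: norm_scaleR)
    moreover have "star (r *\<^sub>R x) = r *\<^sub>R x" "star (r *\<^sub>R y) = r *\<^sub>R y"
      using assms(3,4) by (simp_all add: star_scaleR)
    ultimately obtain s t where s: "star s = s" "s * s = 1 - r *\<^sub>R x" 
        "\<And>z. z * (r *\<^sub>R x) = (r *\<^sub>R x) * z \<Longrightarrow> z * s = s * z"
      and t: "star t = t" "t * t = 1 - r *\<^sub>R y" 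
        "\<And>z. z * (r *\<^sub>R y) = (r *\<^sub>R y) * z \<Longrightarrow> z * t = t * z"
      using sqrt_one_minus[of "r *\<^sub>R x"] sqrt_one_minus[of "r *\<^sub>R y"] by metis
    have "x * s = s * x"
      by (rule s(3)) simp
    then have "s * t = t * s"
      by (intro t(3)) (simp add: y algebra_simps mult_2 mult_2_right)
    then have "norm s ^ 2 \<le> norm (s * s + t * t)"
      by (rule imaginary_unitary_norm[OF s(1) t(1)])
    also have "s * s + t * t = (2 * (1 - r)) *\<^sub>R 1"
      unfolding s(2) t(2) y by (simp add: algebra_simps scaleR_conv_of_real)
    finally have "norm s ^ 2 \<le> 2 * (1 - r)"
      using r by simp
    then show ?thesis
      using cstar_identity[of s] by (simp add: s)
  qed
  have "((\<lambda>r. 2 * (1 - r) - norm (1 - r *\<^sub>R x)) \<longlongrightarrow> 2 * (1 - 1) - norm (1 - 1 *\<^sub>R x)) (at_left 1)"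
    by (intro tendsto_intros)
  moreover have "\<forall>\<^sub>F r in at_left 1. 0 \<le> 2 * (1 - r) - norm (1 - r *\<^sub>R x)"
    using eventually_at_left_real[OF zero_less_one] by eventually_elim (use le in auto)
  ultimately have "0 \<le> 2 * (1 - 1) - norm (1 - 1 *\<^sub>R x)"
    by (rule tendsto_lowerbound) simp
  then show ?thesis
    by simp
qed

text \<open>The condition \<open>norm (1 - a) \<le> 1\<close> stands in for positivity of the selfadjoint \<open>a\<close>.\<close>

lemma sum_eq_0_imp_eq_0:
  fixes a :: "'i \<Rightarrow> 'a::cstar_algebra"
  assumes "finite I" "\<And>i. i \<in> I \<Longrightarrow> star (a i) = a i" "\<And>i. i \<in> I \<Longrightarrow> norm (1 - a i) \<le> 1"
    "sum a I = 0" "i \<in> I"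
  shows "a i = 0"
proof (cases "I = {i}")
  case False
  \<comment> \<open>Since the \<open>a j\<close> sum to zero, the hypothesis bounds
    \<open>M + a i\<close> as well as \<open>M - a i\<close> by \<open>M\<close>. Divided by
    \<open>M\<close>, these are contractions with midpoint \<open>1\<close>.\<close>
  define M where "M = real (card (I - {i}))"
  have M: "M \<ge> 1"
    using False assms(1,5) card_gt_0_iff[of "I - {i}"] by (auto simp: M_def simp del: card_Diff_insert card_Diff_singleton)
  have "M *\<^sub>R 1 + a i = (\<Sum>j\<in>I - {i}. 1 - a j)"
    using assms(1,4,5) by (simp add: sum_subtractf sum.remove[of I i] M_def scaleR_conv_of_real eq_neg_iff_add_eq_0 algebra_simps)
  also have "norm \<dots> \<le> (\<Sum>j\<in>I - {i}. 1)"
    by (rule sum_norm_le) (use assms in auto)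
  finally have 1: "norm (M *\<^sub>R 1 + a i) \<le> M"
    by (simp add: M_def)
  have "norm (M *\<^sub>R 1 - a i) \<le> norm ((M - 1) *\<^sub>R (1::'a)) + norm (1 - a i)"
    using norm_triangle_ineq[of "(M - 1) *\<^sub>R (1::'a)" "1 - a i"] by (simp add: algebra_simps)
  then have 2: "norm (M *\<^sub>R 1 - a i) \<le> M"
    using M assms(3,5) by fastforce
  define x y where "x = 1 + (1/M) *\<^sub>R a i" and "y = 1 - (1/M) *\<^sub>R a i"
  have "x = (1/M) *\<^sub>R (M *\<^sub>R 1 + a i)" "y = (1/M) *\<^sub>R (M *\<^sub>R 1 - a i)"
    using M by (simp_all add: x_def y_def algebra_simps)
  then have "norm x \<le> 1" "norm y \<le> 1"
    using 1 2 M by (simp_all add: divide_le_eq)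
  moreover have "star x = x" "star y = y"
    using assms(2,5) by (simp_all add: x_def y_def star_add star_diff star_scaleR)
  moreover have "x + y = 2"
    by (simp add: x_def y_def)
  ultimately have "x = 1"
    by (rule midpoint_one_extreme)
  then show ?thesis
    using M by (simp add: x_def)
qed (use assms in auto)

lemma norm_projection_le:
  assumes "star p = p" "p * p = (p::'a::cstar_algebra)"
  shows "norm p \<le> 1"
  using cstar_identity[of p] assms by (auto simp: power2_eq_square)

text \<open>\<open>1 - p q p\<close> splits into \<open>e = 1 - p\<close> and
  \<open>b = p (1 - q) p\<close> with \<open>e b = b e = 0\<close>, so each of its powers is
  \<open>e\<close> plus a power of \<open>b\<close> and has norm at most 2. High powers improve this
  bound to 1.\<close>

lemma norm_one_minus_compression_le:
  assumes p: "star p = p" "p * p = (p::'a::cstar_algebra)" and q: "star q = q" "q * q = q"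
  shows "norm (1 - p * q * p) \<le> 1"
proof -
  define e b where "e = 1 - p" and "b = p * (1 - q) * p"
  have e: "star e = e" "e * e = e"
    by (simp_all add: e_def star_diff p algebra_simps)
  have q': "star (1 - q) = 1 - q" "(1 - q) * (1 - q) = 1 - q"
    by (simp_all add: star_diff q algebra_simps)
  have eb: "e * b = 0" "b * e = 0"
    by (simp_all add: e_def b_def algebra_simps p) (simp_all flip: mult.assoc add: p)
  have x: "1 - p * q * p = e + b"
    by (simp add: e_def b_def algebra_simps p)
  have pow: "(e + b) ^ Suc k = e + b ^ Suc k" for k
  proof (induction k)
    case (Suc k)
    have "(e + b) ^ Suc (Suc k) = (e + b) * (e + b ^ Suc k)"
      by (simp only: power_Suc[of "e + b" "Suc k"] Suc)
    also have "\<dots> = e + b ^ Suc (Suc k)"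
      by (simp add: distrib_left distrib_right e eb flip: mult.assoc)
    finally show ?case .
  qed simp
  have "norm b \<le> norm p * norm (1 - q) * norm p"
    unfolding b_def by (meson norm_mult_ineq mult_right_mono norm_ge_zero order_trans)
  also have "\<dots> \<le> 1 * 1 * 1"
    by (intro mult_mono norm_projection_le p q') auto
  finally have b: "norm b \<le> 1" by simp
  have star_x: "star (e + b) = e + b"
    by (simp add: b_def star_add star_diff star_mult e p q mult.assoc)
  have "norm ((star (e + b) * (e + b)) ^ 2 ^ m) \<le> 2 * 2 ^ m * norm ((star 1 * (1::'a)) ^ 2 ^ m)" for m
  proof -
    have "(star (e + b) * (e + b)) ^ 2 ^ m = (e + b) ^ Suc (2 * 2 ^ m - 1)"
      unfolding star_x power2_eq_square[symmetric] power_mult[symmetric] by simp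
    also have "norm \<dots> \<le> norm e + norm b ^ Suc (2 * 2 ^ m - 1)"
      unfolding pow by (meson norm_triangle_ineq norm_power_ineq add_left_mono order_trans)
    also have "\<dots> \<le> 1 + 1"
      using b e by (intro add_mono norm_projection_le[of e] power_le_one) auto
    also have "\<dots> \<le> 2 * 2 ^ m" by simp
    finally show ?thesis by simp
  qed
  then show ?thesis
    unfolding x using norm_le_by_powers[where a = "1::'a"] by fastforce
qed

section \<open>Word isometries and the orthogonality of the generators\<close>

definition words_of :: "nat \<Rightarrow> nat \<Rightarrow> nat list set" where
  "words_of n k = {w \<in> words n. length w = k}"

lemma words_simps [simp]:
  "[] \<in> words n" "i # w \<in> words n \<longleftrightarrow> i \<in> {1..n} \<and> w \<in> words n"
  "v @ w \<in> words n \<longleftrightarrow> v \<in> words n \<and> w \<in> words n"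
  "replicate k i \<in> words n \<longleftrightarrow> k = 0 \<or> i \<in> {1..n}"
  by (auto simp: words_def)

lemma words_of_words: "w \<in> words_of n k \<Longrightarrow> w \<in> words n"
  and words_of_length: "w \<in> words_of n k \<Longrightarrow> length w = k"
  by (simp_all add: words_of_def)

lemma words_of_0 [simp]: "words_of n 0 = {[]}"
  by (auto simp: words_of_def)

lemma words_of_Suc: "words_of n (Suc k) = (\<lambda>(i, w). i # w) ` ({1..n} \<times> words_of n k)"
  by (force simp: words_of_def image_iff length_Suc_conv)

lemma sum_words_of_Suc: "(\<Sum>w\<in>words_of n (Suc k). f w) = (\<Sum>i=1..n. \<Sum>w\<in>words_of n k. f (i # w))"
proof -
  have "(\<Sum>w\<in>words_of n (Suc k). f w) = (\<Sum>(i, w)\<in>{1..n} \<times> words_of n k. f (i # w))"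
    unfolding words_of_Suc by (subst sum.reindex) (auto simp: inj_on_def case_prod_beta)
  then show ?thesis
    by (simp add: sum.cartesian_product)
qed

lemma word_op_simps [simp]:
  "word_op S [] = 1" "word_op S (i # w) = S i * word_op S w"
  by (simp_all add: word_op_def)

lemma word_op_append [simp]: "word_op S (v @ w) = word_op S v * word_op S w"
  by (simp add: word_op_def)

lemma cuntz_isometry: "cuntz_isometries n S \<Longrightarrow> i \<in> {1..n} \<Longrightarrow> isometry (S i)"
  by (simp add: cuntz_isometries_def)

lemma isometry_word_op: "cuntz_isometries n S \<Longrightarrow> w \<in> words n \<Longrightarrow> isometry (word_op S w)"
  by (induction w) (auto simp: isometry_1 cuntz_isometry intro!: isometry_mult)

lemma sum_cuntz: "cuntz_isometries n S \<Longrightarrow> (\<Sum>i=1..n. S i * star (S i)) = 1"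
  by (simp add: cuntz_isometries_def)

text \<open>Compressing the sum of all \<open>P k\<close> by \<open>P j\<close> shows that the
  \<open>P j * P k * P j\<close> with \<open>k \<noteq> j\<close> sum to zero. They satisfy the
  substitute for positivity, so each vanishes, and \<open>P j * P i * P j\<close> is
  \<open>star x * x\<close> for \<open>x = P i * P j\<close>.\<close>

lemma cuntz_orthogonal:
  assumes S: "cuntz_isometries n S" and "i \<in> {1..n}" "j \<in> {1..n}" "i \<noteq> j"
  shows "star (S i) * S j = 0"
proof -
  define P where "P k = S k * star (S k)" for k
  have iso: "star (S k) * S k = 1" if "k \<in> {1..n}" for k
    using cuntz_isometry[OF S that] by (simp add: isometry_def)
  have P: "star (P k) = P k" "P k * P k = P k" if "k \<in> {1..n}" for k
    using isometry_cancel[OF cuntz_isometry[OF S that]]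
    by (simp_all add: P_def star_mult star_star mult.assoc)
  have "(\<Sum>k=1..n. P j * P k * P j) = P j * (\<Sum>k=1..n. P k) * P j"
    by (simp add: sum_distrib_left sum_distrib_right)
  also have "\<dots> = P j * P j * P j"
    using sum_cuntz[OF S] P[OF assms(3)] by (simp add: P_def)
  finally have sum0: "(\<Sum>k\<in>{1..n} - {j}. P j * P k * P j) = 0"
    using assms(3) by (simp add: sum.remove[of _ j])
  have "P j * P i * P j = 0"
  proof (rule sum_eq_0_imp_eq_0[OF _ _ _ sum0])
    fix k assume "k \<in> {1..n} - {j}"
    then show "star (P j * P k * P j) = P j * P k * P j" "norm (1 - P j * P k * P j) \<le> 1"
      using P[of k] P[of j] assms(3)
      by (simp_all add: star_mult mult.assoc norm_one_minus_compression_le[unfolded mult.assoc])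
  qed (use assms in auto)
  then have "star (P i * P j) * (P i * P j) = 0"
    using P[OF assms(2)] P[OF assms(3)] by (metis star_mult mult.assoc)
  then have "P i * P j = 0"
    by (simp only: star_mult_self_eq_0)
  then have "star (S i) * (P i * P j) * S j = 0"
    by simp
  then show ?thesis
    using iso assms by (simp add: P_def mult.assoc) (simp add: iso assms flip: mult.assoc)
qed

section \<open>Words and monomials\<close>

lemma word_op_cancel: "cuntz_isometries n S \<Longrightarrow> w \<in> words n \<Longrightarrow> star (word_op S w) * (word_op S w * x) = x"
  by (rule isometry_cancel[OF isometry_word_op])

lemma word_op_star_cancel:
  "cuntz_isometries n S \<Longrightarrow> w \<in> words n \<Longrightarrow> star (word_op S w) * word_op S w = 1"
  using word_op_cancel[of n S w 1] by simp

lemma cuntz_star_mult: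
  "cuntz_isometries n S \<Longrightarrow> i \<in> {1..n} \<Longrightarrow> j \<in> {1..n} \<Longrightarrow>
     star (S i) * (S j * x) = (if i = j then x else 0)"
  using cuntz_orthogonal[of n S i j] isometry_cancel[OF cuntz_isometry[of n S i], of x]
  by (auto simp flip: mult.assoc)

lemma word_op_incomparable:
  assumes S: "cuntz_isometries n S" and "v \<in> words n" "w \<in> words n"
    "\<And>r. w \<noteq> v @ r" "\<And>r. v \<noteq> w @ r"
  shows "star (word_op S v) * word_op S w = 0"
  using assms(2-)
proof (induction v arbitrary: w)
  case (Cons i v)
  obtain j w' where w: "w = j # w'"
    using Cons.prems(4)[of "i # v"] by (cases w) auto
  have "star (word_op S (i # v)) * word_op S w = star (word_op S v) * (star (S i) * (S j * word_op S w'))"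
    by (simp add: w star_mult mult.assoc)
  also have "\<dots> = 0"
    using Cons w S by (auto simp: cuntz_star_mult)
  finally show ?case .
qed (metis append_Nil)

lemma word_op_prefix_or_orthogonal:
  assumes S: "cuntz_isometries n S" and "v \<in> words n" "w \<in> words n" "length v \<le> length w"
  shows "(\<exists>r. w = v @ r) \<or> star (word_op S v) * word_op S w = 0 \<and> star (word_op S w) * word_op S v = 0"
proof (cases "\<exists>r. w = v @ r")
  case False
  then have "w \<noteq> v @ r" "v \<noteq> w @ r" for r
    using assms(4) by (metis append_Nil2 length_append le_add_same_cancel1 le_zero_eq length_0_conv add_le_cancel_left add.right_neutral)+
  then show ?thesis
    using word_op_incomparable[OF S assms(2,3)] word_op_incomparable[OF S assms(3,2)] by simp
qed simp

lemma word_op_same_length: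
  assumes "cuntz_isometries n S" "v \<in> words_of n k" "w \<in> words_of n k"
  shows "star (word_op S v) * word_op S w = (if v = w then 1 else 0)"
proof (cases "v = w")
  case False
  have "length v = length w"
    using assms(2,3) by (simp add: words_of_length)
  with False have "w \<noteq> v @ r" "v \<noteq> w @ r" for r
    by auto
  then show ?thesis
    using False word_op_incomparable[OF assms(1) words_of_words words_of_words, OF assms(2,3)]
    by simp
qed (use word_op_star_cancel[OF assms(1) words_of_words[OF assms(2)]] in simp)

lemma sum_word_op:
  assumes S: "cuntz_isometries n S"
  shows "(\<Sum>w\<in>words_of n k. word_op S w * star (word_op S w)) = 1"
proof (induction k)
  case (Suc k)
  have "(\<Sum>w\<in>words_of n (Suc k). word_op S w * star (word_op S w))
    = (\<Sum>i=1..n. S i * (\<Sum>w\<in>words_of n k. word_op S w * star (word_op S w)) * star (S i))"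
    by (simp add: sum_words_of_Suc star_mult sum_distrib_left sum_distrib_right mult.assoc)
  then show ?case
    using S by (simp add: Suc cuntz_isometries_def)
qed simp

text \<open>The word \<open>1\<dots>12\<close> has no period up to \<open>k\<close>, so conjugating by it kills all short nonempty words.\<close>

definition sep :: "nat \<Rightarrow> nat list" where
  "sep k = replicate k 1 @ [2]"

lemma sep_words: "n \<ge> 2 \<Longrightarrow> sep k \<in> words n"
  by (simp add: sep_def)

text \<open>Compare the letters at position \<open>k\<close>: on the right it is the final 2 of
  \<open>sep k\<close>; on the left the nonempty \<open>r\<close> of length at most \<open>k\<close>
  shifts a letter 1 there.\<close>

lemma sep_not_prefix:
  assumes "r \<noteq> []" "length r \<le> k"
  shows "r @ sep k \<noteq> sep k @ t"
proof
  assume eq: "r @ sep k = sep k @ t"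
  have "(r @ sep k) ! k = 1"
    using assms length_greater_0_conv[of r] by (simp add: nth_append sep_def del: length_greater_0_conv)
  moreover have "(sep k @ t) ! k = 2"
    by (simp add: nth_append sep_def)
  ultimately show False
    using eq by simp
qed

lemma sep_annihilates:
  assumes "cuntz_isometries n S" "n \<ge> 2" "r \<in> words n" "r \<noteq> []" "length r \<le> k"
  shows "star (word_op S (sep k)) * (word_op S r * word_op S (sep k)) = 0"
proof -
  have "sep k \<noteq> (r @ sep k) @ t" for t
  proof
    assume "sep k = (r @ sep k) @ t"
    then have "length (sep k) = length r + length (sep k) + length t"
      by (metis length_append)
    then show False
      using assms(4) by simp
  qed
  then show ?thesis
    using word_op_incomparable[of n S "sep k" "r @ sep k"] assms sep_not_prefix sep_words by simp
qed

lemma sep_annihilates_star: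
  assumes "cuntz_isometries n S" "n \<ge> 2" "r \<in> words n" "r \<noteq> []" "length r \<le> k"
  shows "star (word_op S (sep k)) * (star (word_op S r) * word_op S (sep k)) = 0"
  using arg_cong[OF sep_annihilates[OF assms], of star] by (simp add: star_mult star_star mult.assoc)

definition word_mono :: "(nat \<Rightarrow> 'a::cstar_algebra) \<Rightarrow> nat list \<times> nat list \<Rightarrow> 'a" where
  "word_mono S p = word_op S (fst p) * star (word_op S (snd p))"

definition deg :: "nat list \<times> nat list \<Rightarrow> int" where
  "deg p = int (length (fst p)) - int (length (snd p))"

definition monomials :: "nat \<Rightarrow> int set \<Rightarrow> (nat list \<times> nat list) set" where
  "monomials n D = {p \<in> words n \<times> words n. deg p \<in> D}"

lemma star_word_mono: "star (word_mono S p) = word_mono S (prod.swap p)"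
  by (simp add: word_mono_def star_mult star_star)

lemma word_mono_Nil [simp]: "word_mono S (v, []) = word_op S v"
  by (simp add: word_mono_def)

text \<open>Only the adjacent words \<open>snd p\<close> and \<open>fst q\<close> matter. The case
  is decided by words before any family is chosen, hence the quantifier over \<open>S\<close> inside
  each case: two families can be multiplied in parallel.\<close>

lemma word_mono_mult_cases:
  assumes "p \<in> words n \<times> words n" "q \<in> words n \<times> words n"
  obtains (left) r where "r \<in> words n" "fst q = snd p @ r"
      "\<And>S :: nat \<Rightarrow> 'a::cstar_algebra. cuntz_isometries n S \<Longrightarrow>
        word_mono S p * word_mono S q = word_mono S (fst p @ r, snd q)"
  | (right) r where "r \<in> words n" "r \<noteq> []" "snd p = fst q @ r"
      "\<And>S :: nat \<Rightarrow> 'a::cstar_algebra. cuntz_isometries n S \<Longrightarrow>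
        word_mono S p * word_mono S q = word_mono S (fst p, snd q @ r)"
  | (zero) "\<And>r. fst q \<noteq> snd p @ r" "\<And>r. snd p \<noteq> fst q @ r"
      "\<And>S :: nat \<Rightarrow> 'a::cstar_algebra. cuntz_isometries n S \<Longrightarrow> word_mono S p * word_mono S q = 0"
proof -
  have eq: "word_mono S p * word_mono S q
      = word_op S (fst p) * (star (word_op S (snd p)) * word_op S (fst q)) * star (word_op S (snd q))"
    for S :: "nat \<Rightarrow> 'a"
    by (simp add: word_mono_def mult.assoc)
  consider r where "fst q = snd p @ r" | r where "r \<noteq> []" "snd p = fst q @ r"
    | "\<And>r. fst q \<noteq> snd p @ r" "\<And>r. snd p \<noteq> fst q @ r"
    by (metis append_Nil2)
  then show ?thesis
  proof cases
    case (1 r)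
    have "word_mono S p * word_mono S q = word_mono S (fst p @ r, snd q)" if "cuntz_isometries n S" for S :: "nat \<Rightarrow> 'a"
      using that assms word_op_cancel[OF that, of "snd p"] unfolding eq 1 
      by (auto simp: word_mono_def mult.assoc mem_Times_iff)
    moreover have "r \<in> words n"
      using 1 assms by (metis mem_Times_iff words_simps(3))
    ultimately show ?thesis
      using left 1 by blast
  next
    case (2 r)
    have "word_mono S p * word_mono S q = word_mono S (fst p, snd q @ r)" if "cuntz_isometries n S" for S :: "nat \<Rightarrow> 'a"
      using that assms word_op_star_cancel[OF that, of "fst q"] unfolding eq 2
      by (auto simp: word_mono_def star_mult mult.assoc mem_Times_iff)
    moreover have "r \<in> words n"
      using 2 assms by (metis mem_Times_iff words_simps(3))
    ultimately show ?thesis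
      using right 2 by blast
  next
    case 3
    have "word_mono S p * word_mono S q = 0" if "cuntz_isometries n S" for S :: "nat \<Rightarrow> 'a"
      using that assms word_op_incomparable[OF that, of "snd p" "fst q"] 3 unfolding eq
      by (auto simp: mem_Times_iff)
    then show ?thesis
      using zero 3 by blast
  qed
qed

text \<open>One formal sum of monomials evaluated at two families at once. It is a relation because
  presentations by words are not unique: that \<open>a\<close> determines \<open>b\<close> only
  follows from the norm estimates. \<open>C = UNIV\<close> gives linear combinations,
  \<open>C = {1}\<close> the coefficient-free sums that define the unitaries in question.\<close>

inductive word_poly_pair :: "(nat \<Rightarrow> 'a::cstar_algebra) \<Rightarrow> (nat \<Rightarrow> 'a) \<Rightarrow> complex set \<Rightarrow>
    (nat list \<times> nat list) set \<Rightarrow> 'a \<Rightarrow> 'a \<Rightarrow> bool"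
  for S T C I where
    zero: "word_poly_pair S T C I 0 0"
  | mono: "c \<in> C \<Longrightarrow> p \<in> I \<Longrightarrow> word_poly_pair S T C I (c *\<^sub>C word_mono S p) (c *\<^sub>C word_mono T p)"
  | add: "word_poly_pair S T C I a b \<Longrightarrow> word_poly_pair S T C I a' b' \<Longrightarrow> word_poly_pair S T C I (a + a') (b + b')"

abbreviation word_poly :: "(nat \<Rightarrow> 'a::cstar_algebra) \<Rightarrow> complex set \<Rightarrow> (nat list \<times> nat list) set \<Rightarrow> 'a \<Rightarrow> bool" where
  "word_poly S C I a \<equiv> word_poly_pair S S C I a a"

lemma word_poly_induct [consumes 1, case_names zero mono add]:
  assumes "word_poly_pair S T C I a b" "P 0"
    "\<And>c p. c \<in> C \<Longrightarrow> p \<in> I \<Longrightarrow> P (c *\<^sub>C word_mono S p)"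
    "\<And>a a'. word_poly S C I a \<Longrightarrow> word_poly S C I a' \<Longrightarrow> P a \<Longrightarrow> P a' \<Longrightarrow> P (a + a')"
  shows "P a"
proof -
  have "word_poly S C I a \<and> P a"
    using assms(1) by induction (use assms(2-) in \<open>auto intro: word_poly_pair.intros\<close>)
  then show ?thesis ..
qed

lemma word_poly_pair_left: "word_poly_pair S T C I a b \<Longrightarrow> word_poly S C I a"
  by (induction rule: word_poly_pair.induct) (auto intro: word_poly_pair.intros)

lemma word_poly_pair_sym: "word_poly_pair S T C I a b \<Longrightarrow> word_poly_pair T S C I b a"
  by (induction rule: word_poly_pair.induct) (auto intro: word_poly_pair.intros)

lemma word_poly_pair_total: "word_poly S C I a \<Longrightarrow> \<exists>b. word_poly_pair S T C I a b"
  by (induction rule: word_poly_induct) (blast intro: word_poly_pair.intros)+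

lemma word_poly_pair_subset: "word_poly_pair S T C I a b \<Longrightarrow> C \<subseteq> C' \<Longrightarrow> I \<subseteq> I' \<Longrightarrow> word_poly_pair S T C' I' a b"
  by (induction rule: word_poly_pair.induct) (auto intro: word_poly_pair.intros)

lemma word_poly_pair_mono1: "1 \<in> C \<Longrightarrow> p \<in> I \<Longrightarrow> word_poly_pair S T C I (word_mono S p) (word_mono T p)"
  using word_poly_pair.mono[of 1 C p I S T] by simp

lemma word_poly_pair_scale: "word_poly_pair S T UNIV I a b \<Longrightarrow> word_poly_pair S T UNIV I (c *\<^sub>C a) (c *\<^sub>C b)"
  by (induction rule: word_poly_pair.induct) (auto intro: word_poly_pair.intros simp: scaleC_add_right scaleC_scaleC)

lemma word_poly_pair_minus: "word_poly_pair S T UNIV I a b \<Longrightarrow> word_poly_pair S T UNIV I (- a) (- b)"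
  using word_poly_pair_scale[of S T I a b "-1"] by simp

lemma word_poly_pair_diff:
  "word_poly_pair S T UNIV I a b \<Longrightarrow> word_poly_pair S T UNIV I a' b' \<Longrightarrow> word_poly_pair S T UNIV I (a - a') (b - b')"
  using word_poly_pair.add[OF _ word_poly_pair_minus] by fastforce

lemma word_poly_pair_sum:
  "(\<And>x. x \<in> X \<Longrightarrow> word_poly_pair S T C I (a x) (b x)) \<Longrightarrow> word_poly_pair S T C I (sum a X) (sum b X)"
  by (induction X rule: infinite_finite_induct) (auto intro: word_poly_pair.intros)

lemma word_poly_pair_mult:
  assumes ab: "word_poly_pair S T C I a b" and ab': "word_poly_pair S T C J a' b'"
    and C: "\<And>c d. c \<in> C \<Longrightarrow> d \<in> C \<Longrightarrow> c * d \<in> C"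
    and prod: "\<And>p q. p \<in> I \<Longrightarrow> q \<in> J \<Longrightarrow>
      (word_mono S p * word_mono S q = 0 \<and> word_mono T p * word_mono T q = 0) \<or>
      (\<exists>r\<in>K. word_mono S p * word_mono S q = word_mono S r \<and> word_mono T p * word_mono T q = word_mono T r)"
  shows "word_poly_pair S T C K (a * a') (b * b')"
  using ab
proof induction
  case (mono c p)
  show ?case
    using ab'
  proof induction
    case (mono d q)
    show ?case
      using prod[OF \<open>p \<in> I\<close> \<open>q \<in> J\<close>] C[OF \<open>d \<in> C\<close> \<open>c \<in> C\<close>]
      by (auto simp: mult_scaleC_left mult_scaleC_right scaleC_scaleC intro: word_poly_pair.intros)
  qed (auto simp: distrib_left intro: word_poly_pair.intros)
qed (auto simp: distrib_right intro: word_poly_pair.intros)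

lemma word_poly_pair_star:
  assumes "word_poly_pair S T C I a b" "cnj ` C \<subseteq> C" "prod.swap ` I \<subseteq> J"
  shows "word_poly_pair S T C J (star a) (star b)"
  using assms(1)
proof induction
  case (mono c p)
  then have "cnj c \<in> C" "prod.swap p \<in> J"
    using assms(2,3) by auto
  then show ?case
    by (simp add: star_scaleC star_word_mono word_poly_pair.mono)
qed (auto simp: star_add intro: word_poly_pair.intros)

lemma word_poly_pair_mult_monomials:
  assumes S: "cuntz_isometries n S" and T: "cuntz_isometries n T"
    and "word_poly_pair S T C (monomials n D) a b" "word_poly_pair S T C (monomials n D') a' b'"
    and "C = UNIV \<or> C = {1}" "\<And>d d'. d \<in> D \<Longrightarrow> d' \<in> D' \<Longrightarrow> d + d' \<in> E"
  shows "word_poly_pair S T C (monomials n E) (a * a') (b * b')"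
proof (rule word_poly_pair_mult[OF assms(3,4)])
  fix p q assume pq: "p \<in> monomials n D" "q \<in> monomials n D'"
  then have pq': "p \<in> words n \<times> words n" "q \<in> words n \<times> words n" "deg p + deg q \<in> E"
    using assms(6) by (auto simp: monomials_def)
  from pq'(1,2) show "(word_mono S p * word_mono S q = 0 \<and> word_mono T p * word_mono T q = 0) \<or>
      (\<exists>r\<in>monomials n E. word_mono S p * word_mono S q = word_mono S r \<and> word_mono T p * word_mono T q = word_mono T r)"
  proof (cases rule: word_mono_mult_cases[where ?'a = 'a])
    case (left r)
    then have "deg (fst p @ r, snd q) = deg p + deg q"
      by (simp add: deg_def)
    then have "(fst p @ r, snd q) \<in> monomials n E"
      using pq' left(1) by (auto simp: monomials_def)
    then show ?thesis
      using left(3) S T by blast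
  next
    case (right r)
    then have "deg (fst p, snd q @ r) = deg p + deg q"
      by (simp add: deg_def)
    then have "(fst p, snd q @ r) \<in> monomials n E"
      using pq' right(1) by (auto simp: monomials_def)
    then show ?thesis
      using right(4) S T by blast
  next
    case zero
    then show ?thesis
      using S T by blast
  qed
qed (use assms(5) in auto)

lemma word_poly_pair_star_monomials:
  assumes "word_poly_pair S T C (monomials n D) a b" "C = UNIV \<or> C = {1}"
  shows "word_poly_pair S T C (monomials n (uminus ` D)) (star a) (star b)"
proof -
  have "prod.swap ` monomials n D \<subseteq> monomials n (uminus ` D)"
    by (auto simp: monomials_def deg_def image_iff) (metis minus_diff_eq)
  then show ?thesis
    using word_poly_pair_star[OF assms(1)] assms(2) by (auto simp: subset_iff)
qed

lemma word_poly_pair_power_monomials: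
  assumes S: "cuntz_isometries n S" and T: "cuntz_isometries n T"
    and "word_poly_pair S T UNIV (monomials n {d}) a b"
  shows "word_poly_pair S T UNIV (monomials n {int k * d}) (a ^ k) (b ^ k)"
proof (induction k)
  case 0
  show ?case
    using word_poly_pair_mono1[of UNIV "([], [])" "monomials n {0}" S T] by (simp add: monomials_def deg_def)
next
  case (Suc k)
  show ?case
    using word_poly_pair_mult_monomials[OF S T assms(3) Suc] by (auto simp: algebra_simps)
qed

section \<open>The balanced part of a polynomial\<close>

definition square :: "nat \<Rightarrow> nat \<Rightarrow> (nat list \<times> nat list) set" where
  "square n k = words_of n k \<times> words_of n k"

text \<open>Inserting a resolution of \<open>1\<close> between the two factors lengthens both words
  by \<open>k\<close> and keeps the degree.\<close>

lemma word_mono_refine: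
  assumes "cuntz_isometries n S"
  shows "word_mono S p = (\<Sum>d\<in>words_of n k. word_mono S (fst p @ d, snd p @ d))"
proof -
  have "word_mono S p = word_op S (fst p) * (\<Sum>d\<in>words_of n k. word_op S d * star (word_op S d)) * star (word_op S (snd p))"
    by (simp add: sum_word_op[OF assms] word_mono_def)
  then show ?thesis
    by (simp add: word_mono_def star_mult sum_distrib_left sum_distrib_right mult.assoc)
qed

text \<open>All large levels are reached, not just one, so that finitely many polynomials can share
  a level.\<close>

lemma word_poly_pair_level:
  assumes S: "cuntz_isometries n S" and T: "cuntz_isometries n T"
    and ab: "word_poly_pair S T C (monomials n D) a b"
  shows "\<exists>k0. \<forall>k\<ge>k0. word_poly_pair S T C (monomials n D \<inter> words n \<times> words_of n k) a b"
  using ab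
proof induction
  case (mono c p)
  have "word_poly_pair S T C (monomials n D \<inter> words n \<times> words_of n k) (c *\<^sub>C word_mono S p) (c *\<^sub>C word_mono T p)"
    if k: "k \<ge> length (snd p)" for k
  proof -
    let ?q = "\<lambda>d. (fst p @ d, snd p @ d)"
    have q: "?q d \<in> monomials n D \<inter> words n \<times> words_of n k" if "d \<in> words_of n (k - length (snd p))" for d
      using that k mono(2) by (auto simp: monomials_def words_of_def deg_def)
    have "word_poly_pair S T C (monomials n D \<inter> words n \<times> words_of n k)
       (\<Sum>d\<in>words_of n (k - length (snd p)). c *\<^sub>C word_mono S (?q d))
       (\<Sum>d\<in>words_of n (k - length (snd p)). c *\<^sub>C word_mono T (?q d))"
      by (intro word_poly_pair_sum word_poly_pair.mono mono(1) q)
    then show ?thesis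
      by (simp add: word_mono_refine[OF S, of p "k - length (snd p)"] word_mono_refine[OF T, of p "k - length (snd p)"]
          flip: cscale.scale_sum_right)
  qed
  then show ?case
    by blast
next
  case (add a b a' b')
  then obtain k k' where
    "\<forall>m\<ge>k. word_poly_pair S T C (monomials n D \<inter> words n \<times> words_of n m) a b"
    "\<forall>m\<ge>k'. word_poly_pair S T C (monomials n D \<inter> words n \<times> words_of n m) a' b'"
    by blast
  then show ?case
    by (intro exI[of _ "max k k'"]) (auto intro: word_poly_pair.add)
qed (auto intro: word_poly_pair.zero)

lemma monomials_0_level: "monomials n {0} \<inter> words n \<times> words_of n k = square n k"
  by (auto simp: monomials_def square_def deg_def words_of_def)

lemma word_poly_pair_bounded:
  "word_poly_pair S T C I a b \<Longrightarrow> \<exists>L. word_poly_pair S T C (I \<inter> {p. length (fst p) \<le> L \<and> length (snd p) \<le> L}) a b"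
proof (induction rule: word_poly_pair.induct)
  case (mono c p)
  then show ?case
    by (intro exI[of _ "max (length (fst p)) (length (snd p))"] word_poly_pair.mono) auto
next
  case (add a b a' b')
  then obtain L L' where
    "word_poly_pair S T C (I \<inter> {p. length (fst p) \<le> L \<and> length (snd p) \<le> L}) a b"
    "word_poly_pair S T C (I \<inter> {p. length (fst p) \<le> L' \<and> length (snd p) \<le> L'}) a' b'"
    by blast
  then show ?case
    by (intro exI[of _ "max L L'"] word_poly_pair.add) (erule word_poly_pair_subset; auto)+
qed (auto intro: word_poly_pair.zero)

text \<open>At level \<open>k\<close>, a word isometry of length \<open>k\<close> on the right
  cancels every adjoint factor or kills the monomial, so a combination of words without adjoints
  remains.\<close>

lemma word_poly_pair_mult_word:
  assumes S: "cuntz_isometries n S" and T: "cuntz_isometries n T"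
    and ab: "word_poly_pair S T C (words n \<times> words_of n k) a b" and w: "w \<in> words_of n k"
  shows "word_poly_pair S T C (words n \<times> {[]}) (a * word_op S w) (b * word_op T w)"
  using ab
proof induction
  case (mono c p)
  then have "snd p \<in> words_of n k" "(fst p, []) \<in> words n \<times> {[]}"
    by auto
  then show ?case
    using word_poly_pair.mono[OF mono(1), of "(fst p, [])" "words n \<times> {[]}" S T] w
    by (auto simp: word_mono_def mult_scaleC_left mult.assoc word_op_same_length[OF S] word_op_same_length[OF T]
        intro: word_poly_pair.zero)
qed (auto simp: distrib_right intro: word_poly_pair.intros)

text \<open>Balanced polynomials of level \<open>k\<close> are matrices over the words of length
  \<open>k\<close>. Compression reads off an entry, which is the same scalar for both
  families.\<close>

lemma square_compression_scalar:
  assumes S: "cuntz_isometries n S" and T: "cuntz_isometries n T"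
    and ab: "word_poly_pair S T C (square n k) a b"
    and v: "v \<in> words_of n k" and w: "w \<in> words_of n k"
  shows "\<exists>c. star (word_op S v) * a * word_op S w = c *\<^sub>C 1 \<and> star (word_op T v) * b * word_op T w = c *\<^sub>C 1"
  using ab
proof induction
  case zero
  then show ?case
    by (intro exI[of _ 0]) simp
next
  case (mono c p)
  then have p: "fst p \<in> words_of n k" "snd p \<in> words_of n k"
    by (auto simp: square_def)
  have "star (word_op U v) * (c *\<^sub>C word_mono U p) * word_op U w
      = c *\<^sub>C ((star (word_op U v) * word_op U (fst p)) * (star (word_op U (snd p)) * word_op U w))"
    for U :: "nat \<Rightarrow> 'a"
    by (simp add: word_mono_def mult_scaleC_left mult_scaleC_right mult.assoc)
  then show ?case
    using p v w
    by (intro exI[of _ "if v = fst p \<and> snd p = w then c else 0"])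
      (simp add: word_op_same_length[OF S] word_op_same_length[OF T])
next
  case (add a b a' b')
  then obtain c c' where
    "star (word_op S v) * a * word_op S w = c *\<^sub>C 1" "star (word_op T v) * b * word_op T w = c *\<^sub>C 1"
    "star (word_op S v) * a' * word_op S w = c' *\<^sub>C 1" "star (word_op T v) * b' * word_op T w = c' *\<^sub>C 1"
    by blast
  then show ?case
    by (intro exI[of _ "c + c'"]) (simp add: distrib_left distrib_right scaleC_add_left)
qed

lemma matrix_expansion:
  assumes S: "cuntz_isometries n S"
  shows "a = (\<Sum>v\<in>words_of n k. \<Sum>w\<in>words_of n k.
      word_op S v * (star (word_op S v) * a * word_op S w) * star (word_op S w))"
proof -
  have "a = (\<Sum>v\<in>words_of n k. word_op S v * star (word_op S v)) * a * (\<Sum>w\<in>words_of n k. word_op S w * star (word_op S w))"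
    by (simp add: sum_word_op[OF S])
  then show ?thesis
    by (simp add: sum_distrib_left sum_distrib_right mult.assoc) (subst (asm) sum.swap, simp)
qed

text \<open>Conjugation by the isometry \<open>Z\<close> below fixes the matrix units of size \<open>k\<close> and kills all
  unbalanced monomials in words of length at most \<open>k\<close> (Cuntz).\<close>

lemma norm_balanced_le:
  assumes n: "n \<ge> 2" and S: "cuntz_isometries n S"
    and a0: "word_poly S UNIV (monomials n {0}) a0" and a1: "word_poly S UNIV (monomials n (- {0})) a1"
  shows "norm a0 \<le> norm (a0 + a1)"
proof -
  obtain k0 where k0: "\<forall>k\<ge>k0. word_poly S UNIV (square n k) a0"
    using word_poly_pair_level[OF S S a0] unfolding monomials_0_level by blast
  obtain L where L: "word_poly S UNIV (monomials n (- {0}) \<inter> {p. length (fst p) \<le> L \<and> length (snd p) \<le> L}) a1"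
    using word_poly_pair_bounded[OF a1] by blast
  \<comment> \<open>A level for \<open>a0\<close> that also bounds all words in \<open>a1\<close>: a
    word of length \<open>k\<close> then extends the words of a monomial of \<open>a1\<close> or is
    orthogonal to them.\<close>
  define k where "k = max k0 L"
  let ?g = "word_op S (sep k)"
  define Z where "Z = (\<Sum>d\<in>words_of n k. word_op S d * ?g * star (word_op S d))"
  have ZZ: "star Z * x * Z = (\<Sum>v\<in>words_of n k. \<Sum>w\<in>words_of n k.
      word_op S v * (star ?g * (star (word_op S v) * x * word_op S w) * ?g) * star (word_op S w))" for x
    unfolding Z_def star_sum
    by (simp add: sum_distrib_left sum_distrib_right star_mult star_star mult.assoc) (subst sum.swap, simp)
  have g: "star ?g * ?g = 1"
    by (rule word_op_star_cancel[OF S sep_words[OF n]])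
  have fixed: "star Z * x * Z = x" if "word_poly S UNIV (square n k) x" for x
  proof -
    have "star ?g * (star (word_op S v) * x * word_op S w) * ?g = star (word_op S v) * x * word_op S w"
      if "v \<in> words_of n k" "w \<in> words_of n k" for v w
      using square_compression_scalar[OF S S \<open>word_poly S UNIV (square n k) x\<close> that] g
      by (auto simp: mult_scaleC_left mult_scaleC_right)
    then show ?thesis
      unfolding ZZ by (subst (2) matrix_expansion[OF S, of x k]) (auto intro!: sum.cong)
  qed
  have kill: "star Z * a1 * Z = 0"
    using L
  proof (induction rule: word_poly_induct)
    case (mono c p)
    have zero: "star ?g * (star (word_op S v) * word_mono S p * word_op S w) * ?g = 0"
      if vw: "v \<in> words_of n k" "w \<in> words_of n k" for v w
    proof -
      have p: "fst p \<in> words n" "snd p \<in> words n" "length (fst p) \<noteq> length (snd p)"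
        "length (fst p) \<le> k" "length (snd p) \<le> k"
        using mono(2) by (auto simp: monomials_def deg_def k_def)
      have v: "v \<in> words n" "length v = k" and w: "w \<in> words n" "length w = k"
        using vw by (auto simp: words_of_def)
      consider "star (word_op S v) * word_op S (fst p) = 0" | "star (word_op S (snd p)) * word_op S w = 0"
        | r t where "v = fst p @ r" "w = snd p @ t"
      proof -
        have "(\<exists>r. v = fst p @ r) \<or> star (word_op S v) * word_op S (fst p) = 0"
          using word_op_prefix_or_orthogonal[OF S p(1) v(1)] p v by auto
        moreover have "(\<exists>t. w = snd p @ t) \<or> star (word_op S (snd p)) * word_op S w = 0"
          using word_op_prefix_or_orthogonal[OF S p(2) w(1)] p w by auto
        ultimately show ?thesis
          using that by blast
      qed
      then show ?thesis
      proof cases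
        case (3 r t)
        \<comment> \<open>The monomial is unbalanced, so the remainders \<open>r\<close> and
          \<open>t\<close> have different lengths. If they are comparable, a nonempty word or its
          adjoint is left between the copies of \<open>?g\<close>, and these annihilate it.\<close>
        then have rt: "r \<in> words n" "t \<in> words n" "length r \<noteq> length t" "length r \<le> k" "length t \<le> k"
          using p v w by auto
        have eq: "star (word_op S v) * word_mono S p * word_op S w = star (word_op S r) * word_op S t"
          using p by (simp add: 3 word_mono_def star_mult mult.assoc word_op_cancel[OF S])
        consider s where "t = r @ s" | s where "r = t @ s" | "\<And>s. t \<noteq> r @ s" "\<And>s. r \<noteq> t @ s"
          by blast
        then show ?thesis
        proof cases
          case (1 s)
          then have "star ?g * (word_op S s * ?g) = 0"
            using rt by (intro sep_annihilates[OF S n]) auto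
          then show ?thesis
            using rt unfolding eq 1 by (simp add: word_op_cancel[OF S] mult.assoc)
        next
          case (2 s)
          then have "star ?g * (star (word_op S s) * ?g) = 0"
            using rt by (intro sep_annihilates_star[OF S n]) auto
          then show ?thesis
            using rt unfolding eq 2 by (simp add: word_op_star_cancel[OF S] star_mult mult.assoc)
        next
          case 3
          then show ?thesis
            unfolding eq using word_op_incomparable[OF S rt(1,2)] by simp
        qed
      next
        case 2
        then show ?thesis
          by (simp add: word_mono_def mult.assoc)
      next
        case 1
        then have "star (word_op S v) * (word_op S (fst p) * y) = 0" for y
          by (simp flip: mult.assoc)
        then show ?thesis
          by (simp add: word_mono_def mult.assoc)
      qed
    qed
    have "star Z * word_mono S p * Z = 0"
      unfolding ZZ by (simp add: zero)
    then show ?case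
      by (simp add: mult_scaleC_left mult_scaleC_right)
  qed (simp_all add: distrib_left distrib_right)
  \<comment> \<open>The unit lies in the matrix algebra fixed by the conjugation, so
    \<open>Z\<close> is an isometry.\<close>
  have one: "word_poly S UNIV (square n k) 1"
  proof -
    have "word_poly S UNIV (square n k) (\<Sum>d\<in>words_of n k. word_mono S (d, d))"
      by (intro word_poly_pair_sum word_poly_pair_mono1) (auto simp: square_def)
    then show ?thesis
      by (simp add: word_mono_def sum_word_op[OF S])
  qed
  have Z: "isometry Z"
    using fixed[OF one] by (simp add: isometry_def)
  have "a0 = star Z * (a0 + a1) * Z"
    using fixed[of a0] k0 kill by (simp add: distrib_left distrib_right k_def)
  then have "norm a0 \<le> norm (star Z * (a0 + a1))"
    using norm_mult_isometry_le[OF Z] by metis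
  also have "\<dots> \<le> norm (a0 + a1)"
    by (rule norm_star_isometry_mult_le[OF Z])
  finally show ?thesis .
qed

lemma square_mult:
  assumes S: "cuntz_isometries n S" and T: "cuntz_isometries n T"
    and "word_poly_pair S T UNIV (square n k) a b" "word_poly_pair S T UNIV (square n k) a' b'"
  shows "word_poly_pair S T UNIV (square n k) (a * a') (b * b')"
proof (rule word_poly_pair_mult[OF assms(3,4)])
  fix p q assume pq: "p \<in> square n k" "q \<in> square n k"
  have "word_mono U p * word_mono U q = (if snd p = fst q then word_mono U (fst p, snd q) else 0)"
    if U: "cuntz_isometries n U" for U :: "nat \<Rightarrow> 'a"
  proof -
    have "word_mono U p * word_mono U q
        = word_op U (fst p) * ((star (word_op U (snd p)) * word_op U (fst q)) * star (word_op U (snd q)))"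
      by (simp add: word_mono_def mult.assoc)
    then show ?thesis
      using pq word_op_same_length[OF U, of "snd p" k "fst q"] by (auto simp: square_def word_mono_def)
  qed
  moreover have "(fst p, snd q) \<in> square n k"
    using pq by (auto simp: square_def)
  ultimately show "(word_mono S p * word_mono S q = 0 \<and> word_mono T p * word_mono T q = 0) \<or>
      (\<exists>r\<in>square n k. word_mono S p * word_mono S q = word_mono S r \<and> word_mono T p * word_mono T q = word_mono T r)"
    using S T by (cases "snd p = fst q") auto
qed simp

lemma square_power:
  assumes "cuntz_isometries n S" "cuntz_isometries n T" "word_poly_pair S T UNIV (square n k) a b"
  shows "word_poly_pair S T UNIV (square n k) (a ^ Suc m) (b ^ Suc m)"
  by (induction m) (use assms square_mult[OF assms] in simp_all)

text \<open>Comparing entry by entry costs the factor \<open>N\<close>, the number of matrix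
  entries. The powers of \<open>star a * a\<close> stay in the same matrix algebra, so
  \<open>N\<close> stays the same and disappears.\<close>

lemma norm_le_square:
  assumes S: "cuntz_isometries n S" and T: "cuntz_isometries n T"
    and ab: "word_poly_pair S T UNIV (square n k) a b"
  shows "norm b \<le> norm a"
proof -
  define N where "N = real (card (words_of n k)) ^ 2"
  have bound: "norm y \<le> N * norm x" if xy: "word_poly_pair S T UNIV (square n k) x y" for x y
  proof -
    have entry: "norm (word_op T v * (star (word_op T v) * y * word_op T w) * star (word_op T w)) \<le> norm x"
      if vw: "v \<in> words_of n k" "w \<in> words_of n k" for v w
    proof -
      obtain c where c: "star (word_op S v) * x * word_op S w = c *\<^sub>C 1" "star (word_op T v) * y * word_op T w = c *\<^sub>C 1"
        using square_compression_scalar[OF S T xy vw] by blast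
      have iso: "isometry (word_op U v)" "isometry (word_op U w)" if "cuntz_isometries n U" for U :: "nat \<Rightarrow> 'a"
        using that vw by (auto intro: isometry_word_op words_of_words)
      have "norm (word_op T v * (star (word_op T v) * y * word_op T w) * star (word_op T w)) = norm (c *\<^sub>C (1::'a))"
        by (simp add: c norm_mult_star_isometry norm_isometry_mult iso[OF T])
      also have "\<dots> \<le> norm x"
        unfolding c(1)[symmetric] mult.assoc
        using norm_star_isometry_mult_le[OF iso(1)[OF S]] norm_mult_isometry_le[OF iso(2)[OF S]] order_trans by blast
      finally show ?thesis .
    qed
    have "norm y \<le> (\<Sum>v\<in>words_of n k. \<Sum>w\<in>words_of n k. norm x)"
      by (subst matrix_expansion[OF T, of y k]) (intro order_trans[OF norm_sum] sum_mono entry)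
    then show ?thesis
      by (simp add: N_def power2_eq_square)
  qed
  have "word_poly_pair S T UNIV (square n k) (star a * a) (star b * b)"
    by (intro square_mult[OF S T] ab word_poly_pair_star[OF ab]) (auto simp: square_def)
  then have pow: "word_poly_pair S T UNIV (square n k) ((star a * a) ^ 2 ^ m) ((star b * b) ^ 2 ^ m)" for m
    using square_power[OF S T, of k _ _ "2 ^ m - 1"] by fastforce
  have "norm ((star b * b) ^ 2 ^ m) \<le> N * 2 ^ m * norm ((star a * a) ^ 2 ^ m)" for m
  proof -
    have "N \<le> N * 2 ^ m"
      using mult_left_mono[of 1 "2 ^ m" N] by (simp add: N_def)
    then have "N * norm ((star a * a) ^ 2 ^ m) \<le> N * 2 ^ m * norm ((star a * a) ^ 2 ^ m)"
      by (rule mult_right_mono) simp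
    then show ?thesis
      using bound[OF pow[of m]] by linarith
  qed
  then show ?thesis
    by (rule norm_le_by_powers)
qed

lemma norm_le_balanced:
  assumes S: "cuntz_isometries n S" and T: "cuntz_isometries n T"
    and ab: "word_poly_pair S T UNIV (monomials n {0}) a b"
  shows "norm b \<le> norm a"
  using word_poly_pair_level[OF assms] norm_le_square[OF S T] unfolding monomials_0_level by blast

lemma word_poly_pair_homogeneous_parts:
  assumes "word_poly_pair S T UNIV (monomials n D) a b" "finite D"
  shows "\<exists>A B. (\<forall>j\<in>D. word_poly_pair S T UNIV (monomials n {j}) (A j) (B j)) \<and> a = sum A D \<and> b = sum B D"
  using assms(1)
proof induction
  case zero
  show ?case
    by (intro exI[of _ "\<lambda>_. 0"]) (simp add: word_poly_pair.zero)
next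
  case (mono c p)
  then have p: "deg p \<in> D" "p \<in> monomials n {deg p}"
    by (auto simp: monomials_def)
  show ?case
    by (rule exI[of _ "\<lambda>j. if j = deg p then c *\<^sub>C word_mono S p else 0"],
        rule exI[of _ "\<lambda>j. if j = deg p then c *\<^sub>C word_mono T p else 0"])
      (use p assms(2) in \<open>auto intro: word_poly_pair.intros\<close>)
next
  case (add a b a' b')
  then obtain A B A' B' where
    "\<forall>j\<in>D. word_poly_pair S T UNIV (monomials n {j}) (A j) (B j)" "a = sum A D" "b = sum B D"
    "\<forall>j\<in>D. word_poly_pair S T UNIV (monomials n {j}) (A' j) (B' j)" "a' = sum A' D" "b' = sum B' D"
    by blast
  then show ?case
    by (intro exI[of _ "\<lambda>j. A j + A' j"] exI[of _ "\<lambda>j. B j + B' j"])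
      (simp add: word_poly_pair.add sum.distrib)
qed

section \<open>Uniqueness of the norm\<close>

text \<open>Multiplying by a power of \<open>S 1\<close> or its adjoint moves the degree \<open>j\<close> part to degree \<open>0\<close>.\<close>

lemma norm_homogeneous_part_le:
  assumes n: "n \<ge> 2" and S: "cuntz_isometries n S" and T: "cuntz_isometries n T"
    and D: "finite D" "j \<in> D"
    and AB: "\<And>i. i \<in> D \<Longrightarrow> word_poly_pair S T UNIV (monomials n {i}) (A i) (B i)"
  shows "norm (B j) \<le> norm (sum A D)"
proof -
  have S1: "isometry (S 1)" and T1: "isometry (T 1)"
    using n cuntz_isometry[OF S, of 1] cuntz_isometry[OF T, of 1] by auto
  have gen: "word_poly_pair S T UNIV (monomials n {1}) (S 1) (T 1)"
    using word_poly_pair_mono1[of UNIV "([1], [])" "monomials n {1}" S T] n by (simp add: monomials_def deg_def)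
  have A: "word_poly S UNIV (monomials n {i}) (A i)" if "i \<in> D" for i
    using AB[OF that] by (rule word_poly_pair_left)
  have rest: "word_poly S UNIV (monomials n (- {j})) (sum A (D - {j}))"
    by (intro word_poly_pair_sum word_poly_pair_subset[OF A]) (auto simp: monomials_def)
  have split: "sum A D = A j + sum A (D - {j})"
    using D by (simp add: sum.remove)
  show ?thesis
  \<comment> \<open>The factor is placed so that no norm is lost: an isometry on the left and an
    adjoint isometry on the right both preserve norms.\<close>
  proof (cases "j \<ge> 0")
    case True
    define x y where "x = S 1 ^ nat j" and "y = T 1 ^ nat j"
    have x: "isometry x" and y: "isometry y"
      unfolding x_def y_def by (intro isometry_power S1 T1)+
    have "word_poly_pair S T UNIV (monomials n {j}) x y"
      using word_poly_pair_power_monomials[OF S T gen, of "nat j"] True by (simp add: x_def y_def)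
    from word_poly_pair_star_monomials[OF this] have xy: "word_poly_pair S T UNIV (monomials n {- j}) (star x) (star y)"
      by simp
    have 0: "word_poly_pair S T UNIV (monomials n {0}) (A j * star x) (B j * star y)"
      by (rule word_poly_pair_mult_monomials[OF S T AB[OF D(2)] xy]) auto
    have 1: "word_poly S UNIV (monomials n (- {0})) (sum A (D - {j}) * star x)"
      by (rule word_poly_pair_mult_monomials[OF S S rest word_poly_pair_left[OF xy]]) auto
    have "norm (B j) = norm (B j * star y)"
      by (simp add: norm_mult_star_isometry y)
    also have "\<dots> \<le> norm (A j * star x)"
      by (rule norm_le_balanced[OF S T 0])
    also have "\<dots> \<le> norm (A j * star x + sum A (D - {j}) * star x)"
      by (rule norm_balanced_le[OF n S word_poly_pair_left[OF 0] 1])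
    also have "\<dots> = norm (sum A D)"
      by (simp add: split norm_mult_star_isometry x flip: distrib_right)
    finally show ?thesis .
  next
    case False
    define x y where "x = S 1 ^ nat (- j)" and "y = T 1 ^ nat (- j)"
    have x: "isometry x" and y: "isometry y"
      unfolding x_def y_def by (intro isometry_power S1 T1)+
    have xy: "word_poly_pair S T UNIV (monomials n {- j}) x y"
      using word_poly_pair_power_monomials[OF S T gen, of "nat (- j)"] False by (simp add: x_def y_def)
    have 0: "word_poly_pair S T UNIV (monomials n {0}) (x * A j) (y * B j)"
      by (rule word_poly_pair_mult_monomials[OF S T xy AB[OF D(2)]]) auto
    have 1: "word_poly S UNIV (monomials n (- {0})) (x * sum A (D - {j}))"
      by (rule word_poly_pair_mult_monomials[OF S S word_poly_pair_left[OF xy] rest]) auto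
    have "norm (B j) = norm (y * B j)"
      by (simp add: norm_isometry_mult y)
    also have "\<dots> \<le> norm (x * A j)"
      by (rule norm_le_balanced[OF S T 0])
    also have "\<dots> \<le> norm (x * A j + x * sum A (D - {j}))"
      by (rule norm_balanced_le[OF n S word_poly_pair_left[OF 0] 1])
    also have "\<dots> = norm (sum A D)"
      by (simp add: split norm_isometry_mult x flip: distrib_left)
    finally show ?thesis .
  qed
qed

definition degs :: "nat \<Rightarrow> int set" where
  "degs d = {- int d..int d}"

lemma word_poly_pair_degs:
  assumes "word_poly_pair S T C (monomials n UNIV) a b"
  shows "\<exists>d. word_poly_pair S T C (monomials n (degs d)) a b"
proof -
  obtain L where "word_poly_pair S T C (monomials n UNIV \<inter> {p. length (fst p) \<le> L \<and> length (snd p) \<le> L}) a b"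
    using word_poly_pair_bounded[OF assms] by blast
  then have "word_poly_pair S T C (monomials n (degs L)) a b"
    by (rule word_poly_pair_subset) (auto simp: monomials_def degs_def deg_def)
  then show ?thesis ..
qed

lemma norm_le_degs:
  assumes n: "n \<ge> 2" and S: "cuntz_isometries n S" and T: "cuntz_isometries n T"
    and ab: "word_poly_pair S T UNIV (monomials n (degs d)) a b"
  shows "norm b \<le> (2 * real d + 1) * norm a"
proof -
  have fin: "finite (degs d)" and card: "real (card (degs d)) = 2 * real d + 1"
    by (auto simp: degs_def)
  obtain A B where AB: "\<And>j. j \<in> degs d \<Longrightarrow> word_poly_pair S T UNIV (monomials n {j}) (A j) (B j)"
    and ab: "a = sum A (degs d)" "b = sum B (degs d)"
    using word_poly_pair_homogeneous_parts[OF ab fin] by blast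
  have "norm b \<le> (\<Sum>j\<in>degs d. norm a)"
    unfolding ab by (intro order_trans[OF norm_sum] sum_mono norm_homogeneous_part_le[OF n S T fin _ AB])
  then show ?thesis
    by (simp add: card)
qed

lemma word_poly_pair_degs_power:
  assumes S: "cuntz_isometries n S" and T: "cuntz_isometries n T"
    and ab: "word_poly_pair S T UNIV (monomials n (degs d)) a b"
  shows "word_poly_pair S T UNIV (monomials n (degs (m * d))) (a ^ m) (b ^ m)"
proof (induction m)
  case 0
  show ?case
    using word_poly_pair_mono1[of UNIV "([], [])" "monomials n (degs 0)" S T] by (simp add: monomials_def deg_def degs_def)
next
  case (Suc m)
  show ?case
    unfolding power_Suc by (rule word_poly_pair_mult_monomials[OF S T ab Suc]) (auto simp: degs_def)
qed

theorem norm_le_word_poly_pair: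
  assumes n: "n \<ge> 2" and S: "cuntz_isometries n S" and T: "cuntz_isometries n T"
    and ab: "word_poly_pair S T UNIV (monomials n UNIV) a b"
  shows "norm b \<le> norm a"
proof -
  obtain d where d: "word_poly_pair S T UNIV (monomials n (degs d)) a b"
    using word_poly_pair_degs[OF ab] by blast
  have uminus_degs: "uminus ` degs d = degs d"
    by (auto simp: degs_def)
  have "word_poly_pair S T UNIV (monomials n (degs (2 * d))) (star a * a) (star b * b)"
    by (rule word_poly_pair_mult_monomials[OF S T word_poly_pair_star_monomials[OF d] d]) (auto simp: uminus_degs degs_def)
  \<comment> \<open>The power \<open>2 ^ m\<close> of \<open>star a * a\<close> has degree at most
    \<open>2 ^ m * (2 * d)\<close>, so the factor grows only linearly in the exponent.\<close>
  from norm_le_degs[OF n S T word_poly_pair_degs_power[OF S T this]]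
  have *: "norm ((star b * b) ^ 2 ^ m) \<le> (2 * real (2 ^ m * (2 * d)) + 1) * norm ((star a * a) ^ 2 ^ m)" for m
    by blast
  have "norm ((star b * b) ^ 2 ^ m) \<le> (4 * real d + 1) * 2 ^ m * norm ((star a * a) ^ 2 ^ m)" for m
  proof -
    have "2 * real (2 ^ m * (2 * d)) + 1 \<le> (4 * real d + 1) * 2 ^ m"
      by (simp add: algebra_simps)
    then show ?thesis
      using *[of m] mult_right_mono[of _ _ "norm ((star a * a) ^ 2 ^ m)"] norm_ge_zero order_trans by blast
  qed
  then show ?thesis
    by (rule norm_le_by_powers)
qed

lemma norm_eq_word_poly_pair:
  assumes "n \<ge> 2" "cuntz_isometries n S" "cuntz_isometries n T" "word_poly_pair S T UNIV (monomials n UNIV) a b"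
  shows "norm b = norm a"
  using norm_le_word_poly_pair[OF assms] norm_le_word_poly_pair[OF assms(1,3,2) word_poly_pair_sym[OF assms(4)]] by simp

section \<open>Coefficients of sums of words\<close>

text \<open>Words of different lengths need not have orthogonal ranges, but they do after right
  multiplication by the isometry of \<open>sep k\<close>: comparable words differ by a nonempty word
  of length at most \<open>k\<close>.\<close>

lemma sep_orthonormal:
  assumes n: "n \<ge> 2" and S: "cuntz_isometries n S" and vw: "v \<in> words n" "w \<in> words n"
    and len: "length v \<le> k" "length w \<le> k"
  shows "star (word_op S v * word_op S (sep k)) * (word_op S w * word_op S (sep k)) = (if v = w then 1 else 0)"
proof -
  let ?g = "word_op S (sep k)"
  have eq: "star (word_op S v * ?g) * (word_op S w * ?g) = star ?g * (star (word_op S v) * word_op S w * ?g)"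
    by (simp add: star_mult mult.assoc)
  have g: "star ?g * ?g = 1"
    by (rule word_op_star_cancel[OF S sep_words[OF n]])
  consider "v = w" | r where "w = v @ r" "r \<noteq> []" | r where "v = w @ r" "r \<noteq> []"
    | "v \<noteq> w" "\<And>r. w \<noteq> v @ r" "\<And>r. v \<noteq> w @ r"
    by (metis append_Nil2)
  then show ?thesis
  proof cases
    case 1
    then show ?thesis
      unfolding eq using vw by (simp add: word_op_star_cancel[OF S] g)
  next
    case (2 r)
    then have "star ?g * (word_op S r * ?g) = 0"
      using vw len by (intro sep_annihilates[OF S n]) auto
    then show ?thesis
      unfolding eq using 2 vw by (simp add: word_op_cancel[OF S] mult.assoc)
  next
    case (3 r)
    then have "star ?g * (star (word_op S r) * ?g) = 0"
      using vw len by (intro sep_annihilates_star[OF S n]) auto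
    then show ?thesis
      unfolding eq using 3 vw by (simp add: word_op_star_cancel[OF S] star_mult mult.assoc)
  next
    case 4
    then show ?thesis
      unfolding eq using word_op_incomparable[OF S vw] by simp
  qed
qed

text \<open>After multiplication by a separating isometry the words are orthonormal, and compression
  isolates the coefficient of \<open>v\<close>. The sum is indexed by \<open>J\<close> because
  different indices may carry the same word; their coefficients add up.\<close>

lemma coefficient_le_norm:
  assumes n: "n \<ge> 2" and S: "cuntz_isometries n S" and J: "finite J" "\<And>j. j \<in> J \<Longrightarrow> w j \<in> words n"
    and v: "v \<in> words n"
  shows "cmod (\<Sum>j | j \<in> J \<and> w j = v. c j) \<le> norm (\<Sum>j\<in>J. c j *\<^sub>C word_op S (w j))"
proof -
  define k where "k = Max (insert (length v) ((\<lambda>j. length (w j)) ` J))"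
  have k: "length v \<le> k" "\<And>j. j \<in> J \<Longrightarrow> length (w j) \<le> k"
    using J by (auto simp: k_def)
  let ?g = "word_op S (sep k)"
  have iso: "isometry (word_op S v * ?g)" "isometry ?g"
    by (intro isometry_mult isometry_word_op[OF S] v sep_words n)+
  have "star (word_op S v * ?g) * (\<Sum>j\<in>J. c j *\<^sub>C word_op S (w j)) * ?g
      = (\<Sum>j\<in>J. c j *\<^sub>C (star (word_op S v * ?g) * (word_op S (w j) * ?g)))"
    by (simp add: sum_distrib_left sum_distrib_right mult_scaleC_left mult_scaleC_right mult.assoc)
  also have "\<dots> = (\<Sum>j\<in>J. (if w j = v then c j else 0) *\<^sub>C 1)"
    using J v k by (intro sum.cong) (auto simp: sep_orthonormal[OF n S])
  also have "\<dots> = (\<Sum>j | j \<in> J \<and> w j = v. c j) *\<^sub>C 1"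
    using J(1) by (simp add: sum.inter_filter flip: cscale.scale_sum_left)
  finally have "cmod (\<Sum>j | j \<in> J \<and> w j = v. c j)
      = norm (star (word_op S v * ?g) * ((\<Sum>j\<in>J. c j *\<^sub>C word_op S (w j)) * ?g))"
    by (simp add: norm_scaleC mult.assoc)
  also have "\<dots> \<le> norm ((\<Sum>j\<in>J. c j *\<^sub>C word_op S (w j)) * ?g)"
    by (rule norm_star_isometry_mult_le[OF iso(1)])
  also have "\<dots> \<le> norm (\<Sum>j\<in>J. c j *\<^sub>C word_op S (w j))"
    by (rule norm_mult_isometry_le[OF iso(2)])
  finally show ?thesis .
qed

lemma positive_poly_sum_list:
  "word_poly S {1} I a \<longleftrightarrow> (\<exists>ps. set ps \<subseteq> I \<and> a = sum_list (map (word_mono S) ps))"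
proof
  assume "word_poly S {1} I a"
  then show "\<exists>ps. set ps \<subseteq> I \<and> a = sum_list (map (word_mono S) ps)"
  proof (induction rule: word_poly_induct)
    case zero
    show ?case by (intro exI[of _ "[]"]) simp
  next
    case (mono c p)
    then show ?case by (intro exI[of _ "[p]"]) simp
  next
    case (add a a')
    then obtain ps qs where "set ps \<subseteq> I" "a = sum_list (map (word_mono S) ps)"
      "set qs \<subseteq> I" "a' = sum_list (map (word_mono S) qs)"
      by blast
    then show ?case by (intro exI[of _ "ps @ qs"]) simp
  qed
next
  assume "\<exists>ps. set ps \<subseteq> I \<and> a = sum_list (map (word_mono S) ps)"
  then obtain ps where "set ps \<subseteq> I" "a = sum_list (map (word_mono S) ps)" by blast
  moreover have "set ps \<subseteq> I \<Longrightarrow> word_poly S {1} I (sum_list (map (word_mono S) ps))"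
    by (induction ps) (auto intro: word_poly_pair.zero word_poly_pair.add word_poly_pair_mono1)
  ultimately show "word_poly S {1} I a" by simp
qed

text \<open>If \<open>a\<close> is a sum of \<open>N\<close> words, counted with repetition, then
  orthonormality makes \<open>norm (a * ?g) ^ 2\<close> the number of pairs of equal words. The
  diagonal alone contributes \<open>N\<close>, hence \<open>N \<le> 1\<close>.\<close>

lemma positive_word_sum_contraction:
  assumes n: "n \<ge> 2" and S: "cuntz_isometries n S" and a: "word_poly S {1} (words n \<times> {[]}) a" and le: "norm a \<le> 1"
  obtains "a = 0" | w where "w \<in> words n" "a = word_op S w"
proof -
  obtain ps where ps: "set ps \<subseteq> words n \<times> {[]}" "a = sum_list (map (word_mono S) ps)"
    using a unfolding positive_poly_sum_list by blast
  define w where "w i = fst (ps ! i)" for i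
  define N where "N = length ps"
  have w: "w i \<in> words n" "word_mono S (ps ! i) = word_op S (w i)" if "i < N" for i
    using subsetD[OF ps(1) nth_mem, of i] that by (auto simp: w_def N_def word_mono_def)
  have a: "a = (\<Sum>i<N. word_op S (w i))"
    by (simp add: ps sum_list_sum_nth atLeast0LessThan N_def w(2)[unfolded N_def])
  define k where "k = Max (insert 0 ((\<lambda>j. length (w j)) ` {..<N}))"
  have k: "length (w j) \<le> k" if "j < N" for j
    using that by (auto simp: k_def)
  let ?g = "word_op S (sep k)"
  have g: "isometry ?g"
    by (intro isometry_word_op[OF S] sep_words n)
  have "star (a * ?g) * (a * ?g) = (\<Sum>i<N. \<Sum>j<N. star (word_op S (w i) * ?g) * (word_op S (w j) * ?g))"
    by (simp add: a star_sum sum_distrib_left sum_distrib_right star_mult mult.assoc) (subst sum.swap, simp)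
  also have "\<dots> = (\<Sum>i<N. \<Sum>j<N. if w i = w j then 1 else 0)"
    by (intro sum.cong refl sep_orthonormal[OF n S]) (use w k in auto)
  also have "\<dots> = of_nat (\<Sum>i<N. \<Sum>j<N. if w i = w j then 1 else 0)"
    by (simp add: of_nat_sum) (intro sum.cong refl; simp)
  finally have "norm (a * ?g) ^ 2 = real (\<Sum>i<N. \<Sum>j<N. if w i = w j then 1 else 0)"
    by (metis cstar_identity norm_of_nat)
  moreover have "norm (a * ?g) ^ 2 \<le> 1"
    using norm_mult_isometry_le[OF g, of a] le by (simp add: power_le_one)
  moreover have "N \<le> (\<Sum>i<N. \<Sum>j<N. if w i = w j then 1 else 0)"
  proof -
    have "(1::nat) \<le> (\<Sum>j<N. if w i = w j then 1 else 0)" if "i < N" for i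
      using member_le_sum[of i "{..<N}" "\<lambda>j. if w i = w j then 1 else 0 :: nat"] that by simp
    then have "(\<Sum>i<N. 1) \<le> (\<Sum>i<N. \<Sum>j<N. if w i = w j then 1 else 0 :: nat)"
      by (intro sum_mono) auto
    then show ?thesis by simp
  qed
  ultimately have "N \<le> 1"
    by linarith
  then consider "N = 0" | "N = 1"
    by linarith
  then show ?thesis
  proof cases
    case 1
    then show ?thesis using that(1) a by simp
  next
    case 2
    then show ?thesis using that(2)[of "w 0"] a w(1)[of 0] by simp
  qed
qed

section \<open>Endomorphisms of the Cuntz algebra\<close>

lemma closed_star_subalgebra_cuntz_algebra: "closed_star_subalgebra (cuntz_algebra n S)"
  unfolding cuntz_algebra_def
  by (rule hull_in) (auto simp: closed_star_subalgebra_def intro!: closed_Inter)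

lemma
  assumes "closed_star_subalgebra A"
  shows star_subalgebra_0: "0 \<in> A"
    and star_subalgebra_add: "x \<in> A \<Longrightarrow> y \<in> A \<Longrightarrow> x + y \<in> A"
    and star_subalgebra_mult: "x \<in> A \<Longrightarrow> y \<in> A \<Longrightarrow> x * y \<in> A"
    and star_subalgebra_scaleC: "x \<in> A \<Longrightarrow> c *\<^sub>C x \<in> A"
    and star_subalgebra_star: "x \<in> A \<Longrightarrow> star x \<in> A"
    and star_subalgebra_closed: "closed A"
  using assms by (auto simp: closed_star_subalgebra_def)

lemma star_subalgebra_diff:
  assumes "closed_star_subalgebra A" "x \<in> A" "y \<in> A"
  shows "x - y \<in> A"
  using star_subalgebra_add[OF assms(1,2) star_subalgebra_scaleC[OF assms(1,3), of "-1"]] by simp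

lemmas cuntz_algebra_closure =
  star_subalgebra_0[OF closed_star_subalgebra_cuntz_algebra]
  star_subalgebra_add[OF closed_star_subalgebra_cuntz_algebra]
  star_subalgebra_mult[OF closed_star_subalgebra_cuntz_algebra]
  star_subalgebra_scaleC[OF closed_star_subalgebra_cuntz_algebra]
  star_subalgebra_star[OF closed_star_subalgebra_cuntz_algebra]
  star_subalgebra_diff[OF closed_star_subalgebra_cuntz_algebra]

lemma star_subalgebra_sum:
  assumes "closed_star_subalgebra A"
  shows "(\<And>i. i \<in> I \<Longrightarrow> f i \<in> A) \<Longrightarrow> sum f I \<in> A"
  by (induction I rule: infinite_finite_induct)
    (auto intro: star_subalgebra_0[OF assms] star_subalgebra_add[OF assms])

lemma generator_in_cuntz_algebra: "i \<in> {1..n} \<Longrightarrow> S i \<in> cuntz_algebra n S"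
  unfolding cuntz_algebra_def by (rule hull_inc) auto

lemma one_in_star_subalgebra:
  assumes "closed_star_subalgebra A" "cuntz_isometries n S" "\<And>i. i \<in> {1..n} \<Longrightarrow> S i \<in> A"
  shows "1 \<in> A"
proof -
  have "(\<Sum>i=1..n. S i * star (S i)) \<in> A"
    by (intro star_subalgebra_sum[OF assms(1)] star_subalgebra_mult[OF assms(1)] star_subalgebra_star[OF assms(1)] assms(3))
  then show ?thesis
    by (simp only: sum_cuntz[OF assms(2)])
qed

lemma word_op_in_star_subalgebra:
  assumes "closed_star_subalgebra A" "cuntz_isometries n S" "\<And>i. i \<in> {1..n} \<Longrightarrow> S i \<in> A" "w \<in> words n"
  shows "word_op S w \<in> A"
  using assms(4)
proof (induction w)
  case Nil
  show ?case
    using one_in_star_subalgebra[OF assms(1-3)] by simp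
next
  case (Cons i w)
  then show ?case
    using star_subalgebra_mult[OF assms(1) assms(3)] by simp
qed

lemma word_poly_in_star_subalgebra:
  assumes A: "closed_star_subalgebra A" "cuntz_isometries n S" "\<And>i. i \<in> {1..n} \<Longrightarrow> S i \<in> A"
    and "word_poly S C I a" "I \<subseteq> words n \<times> words n"
  shows "a \<in> A"
  using assms(4)
proof (induction rule: word_poly_induct)
  case (mono c p)
  then have "fst p \<in> words n" "snd p \<in> words n"
    using assms(5) by auto
  then show ?case
    unfolding word_mono_def
    by (intro star_subalgebra_scaleC star_subalgebra_mult star_subalgebra_star word_op_in_star_subalgebra[OF A] A(1))
qed (auto intro: star_subalgebra_0[OF A(1)] star_subalgebra_add[OF A(1)])

lemma monomials_UNIV: "monomials n UNIV = words n \<times> words n"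
  by (simp add: monomials_def)

lemma monomials_subset: "monomials n D \<subseteq> words n \<times> words n"
  by (auto simp: monomials_def)

lemma word_poly_in_cuntz_algebra:
  assumes "cuntz_isometries n S" "word_poly S C (monomials n D) a"
  shows "a \<in> cuntz_algebra n S"
  by (rule word_poly_in_star_subalgebra[OF closed_star_subalgebra_cuntz_algebra assms(1) generator_in_cuntz_algebra assms(2) monomials_subset])

lemma one_in_cuntz_algebra: "cuntz_isometries n S \<Longrightarrow> 1 \<in> cuntz_algebra n S"
  by (rule one_in_star_subalgebra[OF closed_star_subalgebra_cuntz_algebra _ generator_in_cuntz_algebra])

text \<open>The closure of the graph of the homomorphism sending each \<open>S i\<close> to
  \<open>T i\<close>.\<close>

definition lim_pair :: "nat \<Rightarrow> (nat \<Rightarrow> 'a::cstar_algebra) \<Rightarrow> (nat \<Rightarrow> 'a) \<Rightarrow> 'a \<Rightarrow> 'a \<Rightarrow> bool" where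
  "lim_pair n S T x y \<longleftrightarrow> (\<exists>a b. (\<forall>k. word_poly_pair S T UNIV (monomials n UNIV) (a k) (b k)) \<and> a \<longlonglongrightarrow> x \<and> b \<longlonglongrightarrow> y)"

lemma lim_pairI:
  assumes "\<And>k. word_poly_pair S T UNIV (monomials n UNIV) (a k) (b k)" "a \<longlonglongrightarrow> x" "b \<longlonglongrightarrow> y"
  shows "lim_pair n S T x y"
  unfolding lim_pair_def using assms by (intro exI[of _ a] exI[of _ b]) simp

lemma lim_pairE:
  assumes "lim_pair n S T x y"
  obtains a b where "\<And>k. word_poly_pair S T UNIV (monomials n UNIV) (a k) (b k)" "a \<longlonglongrightarrow> x" "b \<longlonglongrightarrow> y"
proof -
  from assms obtain a b where "\<forall>k. word_poly_pair S T UNIV (monomials n UNIV) (a k) (b k)" "a \<longlonglongrightarrow> x" "b \<longlonglongrightarrow> y"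
    unfolding lim_pair_def by (elim exE conjE)
  then show ?thesis
    by (intro that[of a b]) simp_all
qed

lemma lim_pair_poly: "word_poly_pair S T UNIV (monomials n UNIV) a b \<Longrightarrow> lim_pair n S T a b"
  by (rule lim_pairI) auto

lemma lim_pair_add:
  assumes "lim_pair n S T x y" "lim_pair n S T x' y'"
  shows "lim_pair n S T (x + x') (y + y')"
  using assms(1)
proof (rule lim_pairE)
  fix a b assume ab: "\<And>k. word_poly_pair S T UNIV (monomials n UNIV) (a k) (b k)" "a \<longlonglongrightarrow> x" "b \<longlonglongrightarrow> y"
  show ?thesis
    using assms(2)
  proof (rule lim_pairE)
    fix a' b' assume ab': "\<And>k. word_poly_pair S T UNIV (monomials n UNIV) (a' k) (b' k)" "a' \<longlonglongrightarrow> x'" "b' \<longlonglongrightarrow> y'"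
    show ?thesis
      by (rule lim_pairI[OF word_poly_pair.add[OF ab(1) ab'(1)]]) (rule tendsto_add ab ab')+
  qed
qed

lemma tendsto_scaleC: "(f \<longlongrightarrow> l) F \<Longrightarrow> ((\<lambda>x. c *\<^sub>C f x) \<longlongrightarrow> c *\<^sub>C (l::'a::cstar_algebra)) F"
proof -
  assume "(f \<longlongrightarrow> l) F"
  then have "((\<lambda>x. (c *\<^sub>C 1) * f x) \<longlongrightarrow> (c *\<^sub>C 1) * l) F"
    by (intro tendsto_intros)
  then show ?thesis
    by (simp add: mult_scaleC_left)
qed

lemma lim_pair_scaleC: "lim_pair n S T x y \<Longrightarrow> lim_pair n S T (c *\<^sub>C x) (c *\<^sub>C y)"
  by (erule lim_pairE) (rule lim_pairI[OF word_poly_pair_scale tendsto_scaleC tendsto_scaleC])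

lemma lim_pair_star:
  assumes "lim_pair n S T x y"
  shows "lim_pair n S T (star x) (star y)"
  using assms
proof (rule lim_pairE)
  fix a b assume ab: "\<And>k. word_poly_pair S T UNIV (monomials n UNIV) (a k) (b k)" "a \<longlonglongrightarrow> x" "b \<longlonglongrightarrow> y"
  have "word_poly_pair S T UNIV (monomials n UNIV) (star (a k)) (star (b k))" for k
    by (rule word_poly_pair_star[OF ab(1)]) (auto simp: monomials_UNIV)
  then show ?thesis
    by (rule lim_pairI) (rule continuous_star ab)+
qed

lemma lim_pair_mult:
  assumes S: "cuntz_isometries n S" and T: "cuntz_isometries n T"
    and xy: "lim_pair n S T x y" "lim_pair n S T x' y'"
  shows "lim_pair n S T (x * x') (y * y')"
  using xy(1)
proof (rule lim_pairE)
  fix a b assume ab: "\<And>k. word_poly_pair S T UNIV (monomials n UNIV) (a k) (b k)" "a \<longlonglongrightarrow> x" "b \<longlonglongrightarrow> y"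
  show ?thesis
    using xy(2)
  proof (rule lim_pairE)
    fix a' b' assume ab': "\<And>k. word_poly_pair S T UNIV (monomials n UNIV) (a' k) (b' k)" "a' \<longlonglongrightarrow> x'" "b' \<longlonglongrightarrow> y'"
    have "word_poly_pair S T UNIV (monomials n UNIV) (a k * a' k) (b k * b' k)" for k
      by (rule word_poly_pair_mult_monomials[OF S T ab(1) ab'(1)]) auto
    then show ?thesis
      by (rule lim_pairI) (rule tendsto_mult ab ab')+
  qed
qed

lemma lim_pair_norm:
  assumes n: "n \<ge> 2" and S: "cuntz_isometries n S" and T: "cuntz_isometries n T" and xy: "lim_pair n S T x y"
  shows "norm y = norm x"
proof -
  obtain a b where ab: "\<And>k. word_poly_pair S T UNIV (monomials n UNIV) (a k) (b k)" "a \<longlonglongrightarrow> x" "b \<longlonglongrightarrow> y"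
    using xy unfolding lim_pair_def by blast
  have "(\<lambda>k. norm (b k)) \<longlonglongrightarrow> norm x"
    using tendsto_norm[OF ab(2)] norm_eq_word_poly_pair[OF n S T ab(1)] by simp
  then show ?thesis
    using tendsto_norm[OF ab(3)] LIMSEQ_unique by blast
qed

lemma lim_pair_unique:
  assumes "n \<ge> 2" "cuntz_isometries n S" "cuntz_isometries n T" "lim_pair n S T x y" "lim_pair n S T x y'"
  shows "y = y'"
proof -
  have "lim_pair n S T (x + (-1) *\<^sub>C x) (y + (-1) *\<^sub>C y')"
    by (intro lim_pair_add lim_pair_scaleC assms)
  then show ?thesis
    using lim_pair_norm[OF assms(1-3)] by fastforce
qed

lemma closed_star_subalgebra_lim_pair:
  fixes S :: "nat \<Rightarrow> 'a::cstar_algebra"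
  assumes S: "cuntz_isometries n S"
  shows "closed_star_subalgebra (closure {a. word_poly S UNIV (monomials n UNIV) a})" (is "closed_star_subalgebra (closure ?P)")
  unfolding closed_star_subalgebra_def
proof (intro conjI ballI allI)
  have iff: "x \<in> closure ?P \<longleftrightarrow> (\<exists>a. (\<forall>k. a k \<in> ?P) \<and> a \<longlonglongrightarrow> x)" for x
    by (rule closure_sequential)
  show "0 \<in> closure ?P"
    using closure_subset[of ?P] by (auto intro: word_poly_pair.zero)
  fix x assume x: "x \<in> closure ?P"
  then obtain a where a: "\<And>k. word_poly S UNIV (monomials n UNIV) (a k)" "a \<longlonglongrightarrow> x"
    unfolding iff by auto
  have "lim_pair n S S x x"
    by (rule lim_pairI[OF a a(2)])
  have closI: "z \<in> closure ?P" if z: "lim_pair n S S z z" for z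
    using z
  proof (rule lim_pairE)
    fix a b assume "\<And>k. word_poly_pair S S UNIV (monomials n UNIV) (a k) (b k)" "a \<longlonglongrightarrow> z"
    then show ?thesis
      unfolding iff by (intro exI[of _ a]) (auto intro: word_poly_pair_left)
  qed
  show "star x \<in> closure ?P"
    by (intro closI lim_pair_star) fact
  show "c *\<^sub>C x \<in> closure ?P" for c
    by (intro closI lim_pair_scaleC) fact
  fix y assume "y \<in> closure ?P"
  then obtain b where b: "\<And>k. word_poly S UNIV (monomials n UNIV) (b k)" "b \<longlonglongrightarrow> y"
    unfolding iff by auto
  have "lim_pair n S S y y"
    by (rule lim_pairI[OF b b(2)])
  show "x + y \<in> closure ?P"
    by (intro closI lim_pair_add) fact+
  show "x * y \<in> closure ?P"
    by (intro closI lim_pair_mult S) fact+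
qed simp

lemma generator_poly:
  assumes "i \<in> {1..n}" "1 \<in> C"
  shows "word_poly_pair S T C (monomials n {1}) (S i) (T i)"
  using word_poly_pair_mono1[of C "([i], [])" "monomials n {1}" S T] assms by (simp add: monomials_def deg_def)

lemma cuntz_algebra_eq_closure:
  assumes S: "cuntz_isometries n S"
  shows "cuntz_algebra n S = closure {a. word_poly S UNIV (monomials n UNIV) a}"
proof
  have "word_poly S UNIV (monomials n UNIV) (S i)" if "i \<in> {1..n}" for i
    by (rule word_poly_pair_subset[OF generator_poly[OF that UNIV_I]]) (auto simp: monomials_def)
  then have "S ` {1..n} \<subseteq> {a. word_poly S UNIV (monomials n UNIV) a}"
    by blast
  also have "\<dots> \<subseteq> closure \<dots>"
    by (rule closure_subset)
  finally show "cuntz_algebra n S \<subseteq> closure {a. word_poly S UNIV (monomials n UNIV) a}"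
    unfolding cuntz_algebra_def by (intro hull_minimal closed_star_subalgebra_lim_pair[OF S])
  show "closure {a. word_poly S UNIV (monomials n UNIV) a} \<subseteq> cuntz_algebra n S"
    using word_poly_in_cuntz_algebra[OF S]
    by (intro closure_minimal star_subalgebra_closed[OF closed_star_subalgebra_cuntz_algebra]) auto
qed

lemma cuntz_algebra_approx:
  assumes "cuntz_isometries n S" "x \<in> cuntz_algebra n S" "e > 0"
  obtains a where "word_poly S UNIV (monomials n UNIV) a" "norm (a - x) < e"
  using assms unfolding cuntz_algebra_eq_closure[OF assms(1)] closure_approachable dist_norm by blast

lemma lim_pair_total:
  assumes n: "n \<ge> 2" and S: "cuntz_isometries n S" and T: "cuntz_isometries n T" and x: "x \<in> cuntz_algebra n S"
  shows "\<exists>y. lim_pair n S T x y"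
proof -
  obtain a where a: "\<And>k. word_poly S UNIV (monomials n UNIV) (a k)" "a \<longlonglongrightarrow> x"
    using x unfolding cuntz_algebra_eq_closure[OF S] closure_sequential by auto
  obtain b where ab: "\<And>k. word_poly_pair S T UNIV (monomials n UNIV) (a k) (b k)"
    using word_poly_pair_total[OF a(1), of T] by metis
  have "norm (b j - b k) = norm (a j - a k)" for j k
    by (rule norm_eq_word_poly_pair[OF n S T word_poly_pair_diff[OF ab ab]])
  moreover have "Cauchy a"
    using a(2) LIMSEQ_imp_Cauchy by blast
  ultimately have "Cauchy b"
    by (simp add: Cauchy_def dist_norm)
  then obtain y where "b \<longlonglongrightarrow> y"
    using Cauchy_convergent convergent_def by blast
  then show ?thesis
    using lim_pairI[OF ab a(2)] by blast
qed

lemma lim_pair_in: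
  assumes T: "cuntz_isometries n T" "\<And>i. i \<in> {1..n} \<Longrightarrow> T i \<in> A" and A: "closed_star_subalgebra A"
    and "lim_pair n S T x y"
  shows "y \<in> A"
proof -
  obtain a b where ab: "\<And>k. word_poly_pair S T UNIV (monomials n UNIV) (a k) (b k)" "b \<longlonglongrightarrow> y"
    using assms(4) unfolding lim_pair_def by blast
  have "b k \<in> A" for k
    using word_poly_in_star_subalgebra[OF A T word_poly_pair_left[OF word_poly_pair_sym[OF ab(1)]]] by (simp add: monomials_UNIV)
  then show ?thesis
    using ab(2) star_subalgebra_closed[OF A] closed_sequentially by blast
qed

text \<open>The norm estimate makes the closed graph single-valued, and together with completeness
  it makes it total. The algebraic rules pass to limits of pairs. The second conclusion evaluates
  \<open>f\<close> on explicit polynomials.\<close>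

theorem cuntz_extension:
  assumes n: "n \<ge> 2" and S: "cuntz_isometries n S" and T: "cuntz_isometries n T"
    and TS: "\<And>i. i \<in> {1..n} \<Longrightarrow> T i \<in> cuntz_algebra n S"
  obtains f where "f \<in> star_endos (cuntz_algebra n S)"
    "\<And>a b. word_poly_pair S T UNIV (monomials n UNIV) a b \<Longrightarrow> f a = b"
proof -
  let ?O = "cuntz_algebra n S"
  define f where "f = (\<lambda>x\<in>?O. THE y. lim_pair n S T x y)"
  have feq: "f x = y" if "x \<in> ?O" "lim_pair n S T x y" for x y
    using that lim_pair_unique[OF n S T] unfolding f_def by auto
  have f: "lim_pair n S T x (f x)" if "x \<in> ?O" for x
    using lim_pair_total[OF n S T that] feq[OF that] by auto
  have poly: "f a = b" if "word_poly_pair S T UNIV (monomials n UNIV) a b" for a b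
    using feq[OF _ lim_pair_poly[OF that]] word_poly_in_cuntz_algebra[OF S word_poly_pair_left[OF that]] by simp
  have "word_poly_pair S T UNIV (monomials n UNIV) 1 1"
    using word_poly_pair_mono1[of UNIV "([], [])" "monomials n UNIV" S T] by (simp add: monomials_UNIV)
  then have one: "f 1 = 1"
    by (rule poly)
  have "f \<in> star_endos ?O"
    unfolding star_endos_def
  proof (intro CollectI conjI ballI allI)
    show "f \<in> extensional ?O"
      by (simp add: f_def)
    show "f ` ?O \<subseteq> ?O"
      using lim_pair_in[OF T TS closed_star_subalgebra_cuntz_algebra f] by auto
    fix x assume x: "x \<in> ?O"
    show "f (star x) = star (f x)"
      by (intro feq lim_pair_star f x cuntz_algebra_closure)
    show "f (c *\<^sub>C x) = c *\<^sub>C f x" for c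
      by (intro feq lim_pair_scaleC f x cuntz_algebra_closure)
    fix y assume y: "y \<in> ?O"
    show "f (x + y) = f x + f y"
      by (intro feq lim_pair_add f x y cuntz_algebra_closure)
    show "f (x * y) = f x * f y"
      by (intro feq lim_pair_mult f x y S T cuntz_algebra_closure)
  qed (rule one)
  then show ?thesis
    using that poly by blast
qed

lemma
  assumes "f \<in> star_endos A"
  shows star_endo_in: "x \<in> A \<Longrightarrow> f x \<in> A"
    and star_endo_1: "f 1 = 1"
    and star_endo_add: "x \<in> A \<Longrightarrow> y \<in> A \<Longrightarrow> f (x + y) = f x + f y"
    and star_endo_mult: "x \<in> A \<Longrightarrow> y \<in> A \<Longrightarrow> f (x * y) = f x * f y"
    and star_endo_scaleC: "x \<in> A \<Longrightarrow> f (c *\<^sub>C x) = c *\<^sub>C f x"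
    and star_endo_star: "x \<in> A \<Longrightarrow> f (star x) = star (f x)"
    and star_endo_extensional: "f \<in> extensional A"
  using assms by (auto simp: star_endos_def)

lemma star_endo_diff:
  assumes f: "f \<in> star_endos A" and A: "closed_star_subalgebra A" and "x \<in> A" "y \<in> A"
  shows "f (x - y) = f x - f y"
  using star_endo_add[OF f assms(3) star_subalgebra_scaleC[OF A assms(4), of "-1"]]
    star_endo_scaleC[OF f assms(4), of "-1"] by simp

lemma star_endo_0:
  assumes f: "f \<in> star_endos A" and A: "closed_star_subalgebra A"
  shows "f 0 = 0"
  using star_endo_scaleC[OF f star_subalgebra_0[OF A], of 0] by simp

text \<open>A selfadjoint \<open>a\<close> of norm less than \<open>1\<close> is the real part of the unitary \<open>a + \<i> * sqrt (1 - a * a)\<close>,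
  and a unital homomorphism maps unitaries to unitaries.\<close>

lemma star_endo_norm_le:
  assumes f: "f \<in> star_endos A" and A: "closed_star_subalgebra A" "1 \<in> A" and x: "x \<in> A"
  shows "norm (f x) \<le> norm x"
proof -
  have selfadjoint_small: "norm (f a) \<le> 1" if a: "a \<in> A" "star a = a" "norm a < 1" for a
  proof -
    have aa: "star (a * a) = a * a" "a * a \<in> A"
      using a star_subalgebra_mult[OF A(1)] by (simp_all add: star_mult)
    have "norm (a * a) \<le> norm a * norm a"
      by (rule norm_mult_ineq)
    also have "\<dots> \<le> norm a * 1"
      using a(3) by (intro mult_left_mono) auto
    finally have norm_aa: "norm (a * a) < 1"
      using a(3) by simp
    from sqrt_one_minus[OF norm_aa aa(1)] obtain s where s: "star s = s" "s * s = 1 - a * a"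
      and comm: "\<And>y. y * (a * a) = a * a * y \<Longrightarrow> y * s = s * y"
      and s_in: "\<And>B. closed_star_subalgebra B \<Longrightarrow> 1 \<in> B \<Longrightarrow> a * a \<in> B \<Longrightarrow> s \<in> B"
      by blast
    have s: "star s = s" "s * s = 1 - a * a" "a * s = s * a" "s \<in> A"
      using s comm[of a] s_in[OF A aa(2)] by (simp_all add: mult.assoc)
    have "norm (f a) ^ 2 \<le> norm (f a * f a + f s * f s)"
      using a s by (intro imaginary_unitary_norm) (simp_all flip: star_endo_star[OF f] star_endo_mult[OF f])
    also have "f a * f a + f s * f s = f (a * a + s * s)"
      using star_endo_add[OF f aa(2) star_subalgebra_mult[OF A(1) s(4) s(4)]]
        star_endo_mult[OF f a(1) a(1)] star_endo_mult[OF f s(4) s(4)] by simp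
    also have "\<dots> = 1"
      using s by (simp add: star_endo_1[OF f])
    finally show ?thesis
      using power2_le_imp_le[of "norm (f a)" 1] by simp
  qed
  have selfadjoint: "norm (f a) \<le> norm a" if a: "a \<in> A" "star a = a" for a
  proof (rule field_le_epsilon)
    fix e :: real assume e: "e > 0"
    define r where "r = norm a + e"
    have r: "r > 0" "norm a < r"
      using e by (auto simp: r_def add_nonneg_pos)
    define b where "b = complex_of_real (1 / r) *\<^sub>C a"
    have "b \<in> A" "star b = b"
      unfolding b_def using a by (simp_all add: star_subalgebra_scaleC[OF A(1)] star_scaleC)
    moreover have "norm b < 1"
      using r by (simp add: b_def norm_scaleC norm_divide)
    ultimately have "norm (f b) \<le> 1"
      by (rule selfadjoint_small)
    then show "norm (f a) \<le> norm a + e"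
      using r by (simp add: b_def star_endo_scaleC[OF f a(1)] norm_scaleC norm_divide r_def[symmetric] divide_le_eq)
  qed
  have "norm (f x) ^ 2 = norm (f (star x * x))"
    using x by (simp add: star_endo_mult[OF f] star_endo_star[OF f] star_subalgebra_star[OF A(1)] cstar_identity)
  also have "\<dots> \<le> norm (star x * x)"
    using x by (intro selfadjoint) (simp_all add: star_mult star_star star_subalgebra_star[OF A(1)] star_subalgebra_mult[OF A(1)])
  also have "\<dots> = norm x ^ 2"
    by (rule cstar_identity)
  finally show ?thesis
    by (rule power2_le_imp_le) simp
qed

section \<open>Polynomial endomorphisms\<close>

lemma unitary_mult_cuntz:
  assumes "cuntz_isometries n S" "unitary u"
  shows "cuntz_isometries n (\<lambda>i. u * S i)"
proof -
  have "(\<Sum>i=1..n. u * S i * star (u * S i)) = u * (\<Sum>i=1..n. S i * star (S i)) * star u"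
    by (simp add: star_mult sum_distrib_left sum_distrib_right mult.assoc)
  then show ?thesis
    using assms by (simp add: cuntz_isometries_def isometry_mult unitary_isometry) (simp add: unitary_def)
qed

lemma star_endo_word_op:
  assumes f: "f \<in> star_endos (cuntz_algebra n S)" and S: "cuntz_isometries n S"
    and T: "\<And>i. i \<in> {1..n} \<Longrightarrow> f (S i) = T i" and w: "w \<in> words n"
  shows "f (word_op S w) = word_op T w"
  using w
proof (induction w)
  case Nil
  show ?case
    by (simp add: star_endo_1[OF f])
next
  case (Cons i w)
  have "word_op S w \<in> cuntz_algebra n S"
    using Cons by (intro word_op_in_star_subalgebra[OF closed_star_subalgebra_cuntz_algebra S generator_in_cuntz_algebra]) auto
  then show ?case
    using Cons T by (simp add: star_endo_mult[OF f] generator_in_cuntz_algebra)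
qed

lemma word_op_in_cuntz_algebra: "cuntz_isometries n S \<Longrightarrow> w \<in> words n \<Longrightarrow> word_op S w \<in> cuntz_algebra n S"
  by (rule word_op_in_star_subalgebra[OF closed_star_subalgebra_cuntz_algebra _ generator_in_cuntz_algebra])

lemma word_mono_in_cuntz_algebra:
  "cuntz_isometries n S \<Longrightarrow> p \<in> words n \<times> words n \<Longrightarrow> word_mono S p \<in> cuntz_algebra n S"
  by (auto simp: word_mono_def intro!: cuntz_algebra_closure word_op_in_cuntz_algebra)

lemma star_endo_word_mono:
  assumes f: "f \<in> star_endos (cuntz_algebra n S)" and S: "cuntz_isometries n S"
    and T: "\<And>i. i \<in> {1..n} \<Longrightarrow> f (S i) = T i" and p: "p \<in> words n \<times> words n"
  shows "f (word_mono S p) = word_mono T p"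
proof -
  have "word_op S (fst p) \<in> cuntz_algebra n S" "word_op S (snd p) \<in> cuntz_algebra n S"
    using p by (auto intro: word_op_in_cuntz_algebra[OF S])
  then show ?thesis
    using star_endo_word_op[OF f S T, of "fst p"] star_endo_word_op[OF f S T, of "snd p"] p
    by (auto simp: word_mono_def star_endo_mult[OF f] star_endo_star[OF f] cuntz_algebra_closure)
qed

lemma star_endo_word_poly:
  assumes f: "f \<in> star_endos (cuntz_algebra n S)" and S: "cuntz_isometries n S"
    and T: "\<And>i. i \<in> {1..n} \<Longrightarrow> f (S i) = T i" and a: "word_poly S C (monomials n D) a"
  shows "word_poly_pair S T C (monomials n D) a (f a)"
  using a
proof (induction rule: word_poly_induct)
  case zero
  then show ?case
    using star_endo_0[OF f closed_star_subalgebra_cuntz_algebra] by (simp add: word_poly_pair.zero)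
next
  case (mono c p)
  then have p: "p \<in> words n \<times> words n"
    using monomials_subset by blast
  have "f (word_mono S p) = word_mono T p"
    by (rule star_endo_word_mono[OF f S _ p]) (rule T)
  then have "f (c *\<^sub>C word_mono S p) = c *\<^sub>C word_mono T p"
    by (simp add: star_endo_scaleC[OF f] word_mono_in_cuntz_algebra[OF S p])
  then show ?case
    using mono by (simp add: word_poly_pair.mono)
next
  case (add a a')
  then show ?case
    using word_poly_pair.add word_poly_in_cuntz_algebra[OF S] by (fastforce simp: star_endo_add[OF f])
qed

text \<open>The set \<open>E\<close> is \<open>UNIV\<close> or \<open>{0}\<close>, for \<open>u\<close> in \<open>\<S>\<^sub>n\<close> or \<open>\<P>\<^sub>n\<close> respectively.\<close>

lemma twisted_word_op_poly:
  assumes S: "cuntz_isometries n S" and u: "word_poly S {1} (monomials n E) u" and E: "E = UNIV \<or> E = {0}"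
    and w: "w \<in> words n"
  shows "word_poly S {1} (monomials n {j. j - int (length w) \<in> E}) (word_op (\<lambda>i. u * S i) w)"
  using w
proof (induction w)
  case Nil
  show ?case
    using word_poly_pair_mono1[of "{1}" "([], [])" "monomials n {j. j \<in> E}" S S] E
    by (auto simp: monomials_def deg_def)
next
  case (Cons i w)
  then have i: "i \<in> {1..n}" by auto
  have "word_poly S {1} (monomials n {j. j - 1 \<in> E}) (u * S i)"
    by (rule word_poly_pair_mult_monomials[OF S S u generator_poly[OF i]]) (use E in auto)
  then have "word_poly S {1} (monomials n {j. j - int (length (i # w)) \<in> E}) ((u * S i) * word_op (\<lambda>i. u * S i) w)"
    by (rule word_poly_pair_mult_monomials[OF S S _ Cons.IH]) (use E Cons.prems in auto)
  then show ?case
    by simp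
qed

lemma twisted_word_mono_poly:
  assumes S: "cuntz_isometries n S" and u: "word_poly S {1} (monomials n E) u" and E: "E = UNIV \<or> E = {0}"
    and p: "p \<in> words n \<times> words n"
  shows "word_poly S {1} (monomials n {j. j - deg p \<in> E}) (word_mono (\<lambda>i. u * S i) p)"
proof -
  have "fst p \<in> words n" "snd p \<in> words n"
    using p by auto
  note * = this[THEN twisted_word_op_poly[OF S u E]]
  show ?thesis
    unfolding word_mono_def
    by (rule word_poly_pair_mult_monomials[OF S S *(1) word_poly_pair_star_monomials[OF *(2)]])
      (use E in \<open>auto simp: deg_def\<close>)
qed

text \<open>For \<open>E = {0}\<close> the set of degrees on the right is \<open>D\<close> itself:
  the endomorphism of a balanced \<open>u\<close> preserves degrees. For \<open>E = UNIV\<close> and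
  nonempty \<open>D\<close> it is no restriction.\<close>

lemma lambda_word_poly:
  assumes S: "cuntz_isometries n S" and u: "word_poly S {1} (monomials n E) u" and E: "E = UNIV \<or> E = {0}"
    and f: "f \<in> star_endos (cuntz_algebra n S)" "\<And>i. i \<in> {1..n} \<Longrightarrow> f (S i) = u * S i"
    and C: "C = UNIV \<or> C = {1}" and a: "word_poly S C (monomials n D) a"
  shows "word_poly S C (monomials n {j. \<exists>d\<in>D. j - d \<in> E}) (f a)"
  using a
proof (induction rule: word_poly_induct)
  case zero
  then show ?case
    using star_endo_0[OF f(1) closed_star_subalgebra_cuntz_algebra] by (simp add: word_poly_pair.zero)
next
  case (mono c p)
  then have p: "p \<in> words n \<times> words n" "deg p \<in> D"
    by (auto simp: monomials_def)
  have "f (word_mono S p) = word_mono (\<lambda>i. u * S i) p"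
    by (rule star_endo_word_mono[OF f(1) S _ p(1)]) (rule f(2))
  then have eq: "f (c *\<^sub>C word_mono S p) = c *\<^sub>C word_mono (\<lambda>i. u * S i) p"
    by (simp add: star_endo_scaleC[OF f(1)] word_mono_in_cuntz_algebra[OF S p(1)])
  have "word_poly S C (monomials n {j. \<exists>d\<in>D. j - d \<in> E}) (word_mono (\<lambda>i. u * S i) p)"
    by (rule word_poly_pair_subset[OF twisted_word_mono_poly[OF S u E p(1)]]) (use C p in \<open>auto simp: monomials_def\<close>)
  then show ?case
    unfolding eq using C mono by (auto intro: word_poly_pair_scale)
next
  case (add a a')
  then show ?case
    using word_poly_pair.add word_poly_in_cuntz_algebra[OF S] by (fastforce simp: star_endo_add[OF f(1)])
qed

lemma word_poly_sum:
  assumes "word_poly S UNIV I a"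
  shows "\<exists>J c. finite J \<and> J \<subseteq> I \<and> a = (\<Sum>p\<in>J. c p *\<^sub>C word_mono S p)"
  using assms
proof (induction rule: word_poly_induct)
  case zero
  show ?case by (intro exI[of _ "{}"]) simp
next
  case (mono c p)
  then show ?case by (intro exI[of _ "{p}"] exI[of _ "\<lambda>_. c"]) simp
next
  case (add a a')
  then obtain J c J' c' where J: "finite J" "J \<subseteq> I" "a = (\<Sum>p\<in>J. c p *\<^sub>C word_mono S p)"
    "finite J'" "J' \<subseteq> I" "a' = (\<Sum>p\<in>J'. c' p *\<^sub>C word_mono S p)"
    by blast
  have "a = (\<Sum>p\<in>J \<union> J'. (if p \<in> J then c p else 0) *\<^sub>C word_mono S p)"
    unfolding J(3) using J by (intro sum.mono_neutral_cong_left) auto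
  moreover have "a' = (\<Sum>p\<in>J \<union> J'. (if p \<in> J' then c' p else 0) *\<^sub>C word_mono S p)"
    unfolding J(6) using J by (intro sum.mono_neutral_cong_left) auto
  ultimately show ?case
    using J by (intro exI[of _ "J \<union> J'"] exI[of _ "\<lambda>p. (if p \<in> J then c p else 0) + (if p \<in> J' then c' p else 0)"])
      (simp only: scaleC_add_left sum.distrib finite_Un Un_subset_iff simp_thms)
qed

text \<open>The word \<open>w\<close> is longer than all words of \<open>a\<close>, so its
  coefficient in \<open>a - word_op S w\<close> is \<open>-1\<close>.\<close>

lemma long_word_far:
  assumes n: "n \<ge> 2" and S: "cuntz_isometries n S"
    and a: "word_poly S UNIV (words n \<times> {[]} \<inter> {p. length (fst p) \<le> L}) a"
    and w: "w \<in> words n" "length w > L"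
  shows "1 \<le> norm (a - word_op S w)"
proof -
  obtain J c where J: "finite J" "J \<subseteq> words n \<times> {[]} \<inter> {p. length (fst p) \<le> L}"
    "a = (\<Sum>p\<in>J. c p *\<^sub>C word_mono S p)"
    using word_poly_sum[OF a] by blast
  define c' where "c' p = (if p \<in> J then c p else - 1)" for p
  have notin: "(w, []) \<notin> J"
    using J(2) w by auto
  have "a - word_op S w = (\<Sum>p\<in>insert (w, []) J. c' p *\<^sub>C word_op S (fst p))"
  proof -
    have "(\<Sum>p\<in>J. c' p *\<^sub>C word_op S (fst p)) = a"
      unfolding J(3) using J(2) by (intro sum.cong) (auto simp: c'_def)
    then show ?thesis
      using J(1) notin by (simp add: c'_def)
  qed
  moreover have "{p. p \<in> insert (w, []) J \<and> fst p = w} = {(w, [])}"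
    using J(2) w by auto
  moreover have "cmod (\<Sum>p | p \<in> insert (w, []) J \<and> fst p = w. c' p)
      \<le> norm (\<Sum>p\<in>insert (w, []) J. c' p *\<^sub>C word_op S (fst p))"
    by (rule coefficient_le_norm[OF n S _ _ w(1)]) (use J(1,2) w in auto)
  ultimately show ?thesis
    using notin by (simp add: c'_def)
qed

text \<open>Phrased with a filter so that finite families of polynomials obtain a common
  bound.\<close>

lemma eventually_bounded_word_poly:
  assumes "word_poly S C I a"
  shows "\<forall>\<^sub>F L in sequentially. word_poly S C (I \<inter> {p. length (fst p) \<le> L}) a"
proof -
  obtain L where L: "word_poly S C (I \<inter> {p. length (fst p) \<le> L \<and> length (snd p) \<le> L}) a"
    using word_poly_pair_bounded[OF assms] by blast
  have "word_poly S C (I \<inter> {p. length (fst p) \<le> M}) a" if "M \<ge> L" for M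
    by (rule word_poly_pair_subset[OF L]) (use that in auto)
  then show ?thesis
    by (auto simp: eventually_sequentially)
qed

lemma eventually_level_word_poly:
  assumes "cuntz_isometries n S" "word_poly S C (monomials n UNIV) a"
  shows "\<forall>\<^sub>F k in sequentially. word_poly S C (words n \<times> words_of n k) a"
proof -
  have "words n \<times> words n \<inter> words n \<times> words_of n k = words n \<times> words_of n k" for k
    by (auto simp: words_of_def)
  then show ?thesis
    using word_poly_pair_level[OF assms(1,1,2)] by (simp add: eventually_sequentially monomials_UNIV)
qed


lemma suffix_orbit:
  assumes T: "cuntz_isometries n T" and w: "w \<in> words n" "w \<noteq> []" and r: "word_op T w * r = r"
    and v: "v \<in> words n"
  defines "Z \<equiv> insert 0 ((\<lambda>j. word_op T (drop j w) * r) ` {..<length w})"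
  shows "star (word_op T v) * r \<in> Z"
proof -
  have step: "star (T i) * z \<in> Z" if i: "i \<in> {1..n}" and z: "z \<in> Z" for i z
  proof (cases "z = 0")
    case False
    then obtain j where j: "j < length w" "z = word_op T (drop j w) * r"
      using z by (auto simp: Z_def)
    have wj: "w ! j \<in> {1..n}"
      using w(1) j(1) nth_mem unfolding words_def by blast
    have "star (T i) * z = (if i = w ! j then word_op T (drop (Suc j) w) * r else 0)"
      using cuntz_star_mult[OF T i wj] by (simp add: j Cons_nth_drop_Suc[symmetric] mult.assoc)
    moreover have "word_op T (drop (Suc j) w) * r \<in> Z"
    proof (cases "Suc j < length w")
      case False
      then have "word_op T (drop (Suc j) w) * r = word_op T (drop 0 w) * r"
        using r by simp
      then show ?thesis
        using w(2) unfolding Z_def by blast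
    qed (auto simp: Z_def)
    ultimately show ?thesis
      by (simp add: Z_def)
  qed (simp add: Z_def)
  have "star (word_op T v) * z \<in> Z" if "z \<in> Z" for z
    using v that
  proof (induction v arbitrary: z)
    case (Cons i v)
    then have "star (word_op T v) * (star (T i) * z) \<in> Z"
      by (intro Cons.IH step) auto
    then show ?case
      by (simp add: star_mult mult.assoc)
  qed simp
  moreover have "r = word_op T (drop 0 w) * r"
    using r by simp
  then have "r \<in> Z"
    using w(2) unfolding Z_def by blast
  ultimately show ?thesis
    by blast
qed

text \<open>If \<open>T\<^sub>v T\<^sub>w T\<^sub>v\<^sup>*\<close> fixed \<open>s = S\<^sub>x\<close>, then \<open>r = T\<^sub>v\<^sup>* s\<close> would satisfy \<open>T\<^sub>w r = r\<close>,
  so that the vectors \<open>T\<^sub>y\<^sup>* r\<close> run through a finite set and the corner of \<open>s s\<^sup>*\<close> is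
  finite-dimensional. Compare with long words in that corner.\<close>

lemma no_fixed_word:
  assumes n: "n \<ge> 2" and S: "cuntz_isometries n S"
    and u: "word_poly S {1} (monomials n UNIV) u" "unitary u"
    and f: "f \<in> star_endos (cuntz_algebra n S)" "\<And>i. i \<in> {1..n} \<Longrightarrow> f (S i) = u * S i"
    and surj: "cuntz_algebra n S \<subseteq> f ` cuntz_algebra n S"
    and v: "v \<in> words n" and w: "w \<in> words n" "w \<noteq> []" and x: "x \<in> words n"
  defines "T \<equiv> \<lambda>i. u * S i"
  shows "word_op T v * (word_op T w * (star (word_op T v) * word_op S x)) \<noteq> word_op S x"
proof
  assume fixed: "word_op T v * (word_op T w * (star (word_op T v) * word_op S x)) = word_op S x"
  let ?O = "cuntz_algebra n S"
  note O = closed_star_subalgebra_cuntz_algebra[of n S]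
  have f2: "f (S i) = T i" if "i \<in> {1..n}" for i
    using f(2)[OF that] by (simp add: T_def)
  have T: "cuntz_isometries n T"
    unfolding T_def by (rule unitary_mult_cuntz[OF S u(2)])
  define s where "s = word_op S x"
  define r where "r = star (word_op T v) * s"
  have s: "isometry s" "s \<in> ?O"
    unfolding s_def using isometry_word_op[OF S x] word_op_in_cuntz_algebra[OF S x] by auto
  have Tv: "isometry (word_op T v)"
    by (rule isometry_word_op[OF T v])
  have rs: "word_op T v * (word_op T w * r) = s"
    using fixed by (simp add: r_def s_def)
  have wr: "word_op T w * r = r"
    using arg_cong[OF rs, of "\<lambda>y. star (word_op T v) * y"] by (simp add: isometry_cancel[OF Tv] r_def)
  have vr: "word_op T v * r = s"
    using rs by (simp add: wr)
  have r_norm: "norm r = 1"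
    using norm_isometry_mult[OF Tv, of r] s by (simp add: vr norm_isometry)
  have poly_T: "word_poly S UNIV (monomials n UNIV) (word_op T y)" if "y \<in> words n" for y
    by (rule word_poly_pair_subset[OF twisted_word_op_poly[OF S u(1) _ that, folded T_def]]) (auto simp: monomials_def)
  define Z where "Z = insert 0 ((\<lambda>j. word_op T (drop j w) * r) ` {..<length w})"
  have Z_fin: "finite Z"
    by (simp add: Z_def)
  have orbit: "star (word_op T y) * r \<in> Z" if "y \<in> words n" for y
    unfolding Z_def by (rule suffix_orbit[OF T w wr that])
  have poly_star: "word_poly S UNIV (monomials n UNIV) (star a)" if "word_poly S UNIV (monomials n UNIV) a" for a
    using word_poly_pair_star_monomials[OF that] by simp
  have poly_mult: "word_poly S UNIV (monomials n UNIV) (a * b)"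
    if "word_poly S UNIV (monomials n UNIV) a" "word_poly S UNIV (monomials n UNIV) b" for a b
    by (rule word_poly_pair_mult_monomials[OF S S that]) auto
  have poly_s: "word_poly S UNIV (monomials n UNIV) s"
    using word_poly_pair_mono1[of UNIV "(x, [])" "monomials n UNIV" S S] x by (simp add: s_def monomials_UNIV)
  have poly_r: "word_poly S UNIV (monomials n UNIV) r"
    unfolding r_def by (intro poly_mult poly_star poly_T v poly_s)
  have Z_poly: "word_poly S UNIV (monomials n UNIV) z" if "z \<in> Z" for z
  proof -
    have "drop j w \<in> words n" for j
      using w(1) by (metis append_take_drop_id words_simps(3))
    then show ?thesis
      using that by (auto simp: Z_def intro!: word_poly_pair.zero poly_mult poly_T poly_r)
  qed
  \<comment> \<open>Only finitely many products \<open>star z * z'\<close> occur, so one level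
    \<open>k\<close> and one length bound \<open>L\<close> serve for the compressions of all
    polynomials in the \<open>T i\<close>.\<close>
  have "\<forall>\<^sub>F k in sequentially. \<forall>z\<in>Z. \<forall>z'\<in>Z. word_poly S UNIV (words n \<times> words_of n k) (star z * z')"
    by (intro eventually_ball_finite Z_fin ballI eventually_level_word_poly[OF S] poly_mult poly_star Z_poly)
  then obtain k where k: "\<And>z z'. z \<in> Z \<Longrightarrow> z' \<in> Z \<Longrightarrow> word_poly S UNIV (words n \<times> words_of n k) (star z * z')"
    by (auto simp: eventually_sequentially)
  define d where "d = replicate k (1::nat)"
  have d: "d \<in> words_of n k"
    using n by (auto simp: d_def words_of_def)
  have "\<forall>\<^sub>F L in sequentially. \<forall>z\<in>Z. \<forall>z'\<in>Z. word_poly S UNIV (words n \<times> {[]} \<inter> {p. length (fst p) \<le> L}) (star z * z' * word_op S d)"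
    by (intro eventually_ball_finite Z_fin ballI eventually_bounded_word_poly word_poly_pair_mult_word[OF S S _ d] k)
  then obtain L where L: "\<And>z z'. z \<in> Z \<Longrightarrow> z' \<in> Z \<Longrightarrow>
      word_poly S UNIV (words n \<times> {[]} \<inter> {p. length (fst p) \<le> L}) (star z * z' * word_op S d)"
    by (auto simp: eventually_sequentially)
  have compress: "word_poly S UNIV (words n \<times> {[]} \<inter> {p. length (fst p) \<le> L}) (star r * q' * r * word_op S d)"
    if "word_poly_pair S T UNIV (monomials n UNIV) q q'" for q q'
    using that
  proof (induction rule: word_poly_pair.induct)
    case zero
    show ?case
      by (simp add: word_poly_pair.zero)
  next
    case (mono c p)
    then have "fst p \<in> words n" "snd p \<in> words n"
      by (auto simp: monomials_def)
    from word_poly_pair_scale[OF L[OF this[THEN orbit]], of c]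
    show ?case
      by (simp add: word_mono_def mult_scaleC_left mult_scaleC_right star_mult star_star mult.assoc)
  next
    case (add a b a' b')
    then show ?case
      by (simp add: distrib_left distrib_right word_poly_pair.add)
  qed
  \<comment> \<open>One letter beyond the bound \<open>L\<close>: after multiplication by
    \<open>word_op S d\<close>, every compressed polynomial has distance at least 1 from
    \<open>y\<close>.\<close>
  define y where "y = word_op S (replicate (Suc L) 1)"
  have y_words: "replicate (Suc L) 1 \<in> words n"
    using n by simp
  have y: "y \<in> ?O"
    unfolding y_def by (rule word_op_in_cuntz_algebra[OF S y_words])
  have "s * y * star s \<in> f ` ?O"
    by (rule subsetD[OF surj]) (intro cuntz_algebra_closure s y)
  then obtain b where b: "b \<in> ?O" "f b = s * y * star s"
    by auto
  \<comment> \<open>Conjugation by \<open>word_op S v\<close> is chosen so that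
    \<open>word_op T v * r = s\<close> turns the compression of \<open>f c\<close> by
    \<open>r\<close> into that of \<open>f b\<close> by \<open>s\<close>, which is
    \<open>y\<close>.\<close>
  define c where "c = star (word_op S v) * b * word_op S v"
  have Sv: "word_op S v \<in> ?O"
    by (rule word_op_in_cuntz_algebra[OF S v])
  have c: "c \<in> ?O"
    unfolding c_def by (intro cuntz_algebra_closure Sv b)
  have "f c = star (word_op T v) * f b * word_op T v"
    using Sv b star_endo_word_op[OF f(1) S f2 v]
    by (simp add: c_def star_endo_mult[OF f(1)] star_endo_star[OF f(1)] cuntz_algebra_closure)
  then have "star r * f c * r = star (word_op T v * r) * f b * (word_op T v * r)"
    by (simp add: star_mult mult.assoc)
  also have "\<dots> = y"
    using isometry_cancel[OF s(1)] s(1) by (simp add: vr b mult.assoc isometry_def)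
  finally have fc: "star r * f c * r = y" .
  obtain q where q: "word_poly S UNIV (monomials n UNIV) q" "norm (q - c) < 1"
    using cuntz_algebra_approx[OF S c, of 1] by auto
  have q_in: "q \<in> ?O"
    by (rule word_poly_in_cuntz_algebra[OF S q(1)])
  have "1 \<le> norm (star r * f q * r * word_op S d - word_op S (replicate (Suc L) 1 @ d))"
    using y_words d by (intro long_word_far[OF n S compress[OF star_endo_word_poly[OF f(1) S f2 q(1)]]]) (auto simp: words_of_words)
  also have "star r * f q * r * word_op S d - word_op S (replicate (Suc L) 1 @ d)
      = (star r * f q * r - y) * word_op S d"
    by (simp only: word_op_append y_def left_diff_distrib)
  also have "\<dots> = star r * f (q - c) * r * word_op S d"
    unfolding fc[symmetric] by (simp add: star_endo_diff[OF f(1) O q_in c] left_diff_distrib right_diff_distrib)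
  also have "norm \<dots> \<le> norm (star r * f (q - c) * r)"
    by (rule norm_mult_isometry_le[OF isometry_word_op[OF S words_of_words[OF d]]])
  also have "\<dots> \<le> norm (star r) * norm (f (q - c)) * norm r"
    by (meson norm_mult_ineq mult_right_mono norm_ge_zero order_trans)
  also have "\<dots> \<le> norm (q - c)"
    using star_endo_norm_le[OF f(1) O one_in_cuntz_algebra[OF S]] q_in c by (simp add: r_norm cuntz_algebra_closure)
  finally show False
    using q(2) by simp
qed

section \<open>Inverses of polynomial automorphisms\<close>

lemma isometry_range_fixes:
  assumes t: "isometry t" and q: "isometry q" and s: "isometry s" and e: "isometry (t * star q * s)"
  shows "q * (star q * s) = (s::'a::cstar_algebra)"
proof -
  define h where "h = s - q * (star q * s)"
  have ss: "star s * s = 1"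
    using s by (simp add: isometry_def)
  have "star s * (q * (star q * s)) = star (t * star q * s) * (t * star q * s)"
    using isometry_cancel[OF t] by (simp add: star_mult star_star mult.assoc)
  then have "star s * (q * (star q * s)) = 1"
    using e by (simp add: isometry_def)
  then have "star h * h = 0"
    by (simp add: h_def star_diff star_mult star_star left_diff_distrib right_diff_distrib mult.assoc isometry_cancel[OF q] ss)
  then show ?thesis
    by (simp add: star_mult_self_eq_0 h_def)
qed

context
  fixes n :: nat and S :: "nat \<Rightarrow> 'a::cstar_algebra" and u f T
  assumes n: "n \<ge> 2" and S: "cuntz_isometries n S"
    and u: "word_poly S {1} (monomials n UNIV) u" "unitary u"
    and f: "f \<in> star_endos (cuntz_algebra n S)" "\<And>i. i \<in> {1..n} \<Longrightarrow> f (S i) = u * S i"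
    and surj: "cuntz_algebra n S \<subseteq> f ` cuntz_algebra n S"
  defines "T \<equiv> \<lambda>i. u * S i"
begin

lemma twisted_cuntz: "cuntz_isometries n T"
  unfolding T_def by (rule unitary_mult_cuntz[OF S u(2)])

text \<open>Both equations put the range of \<open>word_op S x\<close> inside the ranges of the
  second words; these have the same length \<open>k\<close>, so they coincide. Cancelling them
  leaves \<open>word_op T a * r = word_op T a' * r\<close>, so \<open>a\<close> and
  \<open>a'\<close> are comparable, and a nonempty difference would be a word fixing
  \<open>r\<close>.\<close>

lemma images_disjoint:
  assumes p: "p \<in> words n \<times> words_of n k" and q: "q \<in> words n \<times> words_of n k" and x: "x \<in> words n" and y: "y \<in> words n"
    and py: "word_mono T p * word_op S x = word_op S y" and qy: "word_mono T q * word_op S x = word_op S y"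
  shows "p = q"
proof (rule ccontr)
  assume pq: "p \<noteq> q"
  obtain a b where p_eq: "p = (a, b)" by (cases p)
  obtain a' b' where q_eq: "q = (a', b')" by (cases q)
  have words: "a \<in> words n" "b \<in> words_of n k" "a' \<in> words n" "b' \<in> words_of n k"
    using p q by (auto simp: p_eq q_eq)
  note bw = words_of_words[OF words(2)] words_of_words[OF words(4)]
  let ?s = "word_op S x"
  note iso = isometry_word_op[OF twisted_cuntz]
  have s: "isometry ?s" and sy: "isometry (word_op S y)"
    using isometry_word_op[OF S] x y by auto
  have s0: "?s \<noteq> 0"
    using norm_isometry[OF s] by auto
  have py: "word_op T a * star (word_op T b) * ?s = word_op S y" and qy: "word_op T a' * star (word_op T b') * ?s = word_op S y"
    using py qy by (simp_all add: word_mono_def p_eq q_eq)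
  have fix_p: "word_op T b * (star (word_op T b) * ?s) = ?s"
    by (rule isometry_range_fixes[OF iso[OF words(1)] iso[OF bw(1)] s]) (unfold py, rule sy)
  have fix_q: "word_op T b' * (star (word_op T b') * ?s) = ?s"
    by (rule isometry_range_fixes[OF iso[OF words(3)] iso[OF bw(2)] s]) (unfold qy, rule sy)
  show False
  proof (cases "b = b'")
    case False
    have "star (word_op T b) * (word_op T b' * z) = 0" for z
      using word_op_same_length[OF twisted_cuntz words(2,4)] False by (simp flip: mult.assoc)
    then have "star (word_op T b) * ?s = 0"
      by (metis fix_q)
    then show False
      using fix_p s0 by simp
  next
    case True
    define r where "r = star (word_op T b) * ?s"
    have ar: "word_op T a * r = word_op T a' * r"
      using py qy True by (simp add: r_def mult.assoc)
    have br: "word_op T b * r = ?s"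
      using fix_p by (simp add: r_def)
    have not_fixed: "word_op T w * r \<noteq> r" if "w \<in> words n" "w \<noteq> []" for w
      using no_fixed_word[OF n S u f surj bw(1) that x] br by (auto simp: r_def T_def)
    consider w where "a' = a @ w" "w \<noteq> []" | w where "a = a' @ w" "w \<noteq> []" | "\<And>w. a' \<noteq> a @ w" "\<And>w. a \<noteq> a' @ w"
      using pq True by (metis append_Nil2 p_eq q_eq)
    then show False
    proof cases
      case (1 w)
      have "word_op T w * r = r"
        using arg_cong[OF ar, of "\<lambda>z. star (word_op T a) * z"] word_op_cancel[OF twisted_cuntz words(1)]
        by (simp add: 1 mult.assoc)
      then show False
        using not_fixed[of w] 1 words(3) by simp
    next
      case (2 w)
      have "word_op T w * r = r"
        using arg_cong[OF ar, of "\<lambda>z. star (word_op T a') * z"] word_op_cancel[OF twisted_cuntz words(3)]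
        by (simp add: 2 mult.assoc)
      then show False
        using not_fixed[of w] 2 words(1) by simp
    next
      case 3
      have "star (word_op T a) * (word_op T a' * z) = 0" for z
        using word_op_incomparable[OF twisted_cuntz words(1,3) 3] by (simp flip: mult.assoc)
      then have "r = 0"
        by (metis ar word_op_cancel[OF twisted_cuntz words(1)])
      then show False
        using br s0 by simp
    qed
  qed
qed

text \<open>Round the coefficients of a polynomial close to \<open>v\<close> to \<open>0\<close> or \<open>1\<close>: the images of its
  monomials are disjoint sums of words, and so is \<open>star u\<close>.\<close>

lemma preimage_positive:
  assumes inj: "inj_on f (cuntz_algebra n S)" and v: "v \<in> cuntz_algebra n S" "f v = star u"
  shows "word_poly S {1} (monomials n UNIV) v"
proof -
  let ?O = "cuntz_algebra n S"
  note O = closed_star_subalgebra_cuntz_algebra[of n S]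
  have f2: "f (S i) = T i" if "i \<in> {1..n}" for i
    using f(2)[OF that] by (simp add: T_def)
  \<comment> \<open>The distance 1/2 is the threshold for rounding: no coefficient is closer than
    1/2 to both \<open>0\<close> and \<open>1\<close>.\<close>
  obtain x where x: "word_poly S UNIV (monomials n UNIV) x" "norm (x - v) < 1/2"
    using cuntz_algebra_approx[OF S v(1), of "1/2"] by auto
  obtain k where k: "word_poly S UNIV (words n \<times> words_of n k) x"
    using eventually_level_word_poly[OF S x(1)] by (auto simp: eventually_sequentially)
  obtain J c where J: "finite J" "J \<subseteq> words n \<times> words_of n k" and xJ: "x = (\<Sum>p\<in>J. c p *\<^sub>C word_mono S p)"
    using word_poly_sum[OF k] by blast
  have JW: "p \<in> words n \<times> words n" if "p \<in> J" for p
    using that J(2) by (auto simp: words_of_words)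
  have f_sum: "f (\<Sum>p\<in>I. d p *\<^sub>C word_mono S p) = (\<Sum>p\<in>I. d p *\<^sub>C word_mono T p)" if I: "I \<subseteq> J" for I d
  proof -
    have "finite I" using I J(1) finite_subset by blast
    then show ?thesis using I
    proof induction
      case empty
      show ?case by (simp add: star_endo_0[OF f(1) O])
    next
      case (insert p I)
      then have p: "p \<in> words n \<times> words n" using JW by auto
      have "(\<Sum>p\<in>I. d p *\<^sub>C word_mono S p) \<in> ?O"
        using insert JW by (intro star_subalgebra_sum[OF O] cuntz_algebra_closure word_mono_in_cuntz_algebra[OF S]) auto
      moreover have "f (word_mono S p) = word_mono T p"
        by (rule star_endo_word_mono[OF f(1) S _ p]) (rule f2)
      ultimately show ?case
        using insert word_mono_in_cuntz_algebra[OF S p]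
        by (simp add: star_endo_add[OF f(1)] star_endo_scaleC[OF f(1)] cuntz_algebra_closure)
    qed
  qed
  have x_in: "x \<in> ?O"
    by (rule word_poly_in_cuntz_algebra[OF S x(1)])
  have "norm (f x - star u) = norm (f (x - v))"
    by (simp add: star_endo_diff[OF f(1) O x_in v(1)] v(2))
  also have "\<dots> < 1/2"
    using star_endo_norm_le[OF f(1) O one_in_cuntz_algebra[OF S], of "x - v"] x(2) x_in v(1)
    by (simp add: cuntz_algebra_closure)
  finally have close: "norm ((\<Sum>p\<in>J. c p *\<^sub>C word_mono T p) - star u) < 1/2"
    unfolding xJ f_sum[OF order_refl] .
  have pos_T: "word_poly S {1} (monomials n UNIV) (word_mono T p)" if "p \<in> J" for p
    using twisted_word_mono_poly[OF S u(1) _ JW[OF that]] by (simp add: T_def)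
  have pos_u: "word_poly S {1} (monomials n UNIV) (star u)"
    using word_poly_pair_star_monomials[OF u(1)] by simp
  have "\<forall>\<^sub>F K in sequentially. (\<forall>p\<in>J. word_poly S {1} (words n \<times> words_of n K) (word_mono T p)) \<and>
      word_poly S {1} (words n \<times> words_of n K) (star u)"
    by (intro eventually_conj eventually_ball_finite J ballI eventually_level_word_poly[OF S] pos_T pos_u)
  then obtain K where K: "\<And>p. p \<in> J \<Longrightarrow> word_poly S {1} (words n \<times> words_of n K) (word_mono T p)"
    "word_poly S {1} (words n \<times> words_of n K) (star u)"
    by (auto simp: eventually_sequentially)
  \<comment> \<open>The monomials whose coefficient rounds to \<open>1\<close>. They are tested on
    words \<open>t\<close> of length \<open>K\<close>, where each \<open>word_mono T p\<close>
    becomes zero or a single word.\<close>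
  define Y where "Y = {p \<in> J. cmod (c p - 1) < 1/2}"
  have Y: "(\<Sum>p\<in>Y. word_mono T p) * word_op S t = star u * word_op S t" if t: "t \<in> words_of n K" for t
  proof -
    have tw: "t \<in> words n"
      by (rule words_of_words[OF t])
    have t_iso: "isometry (word_op S t)"
      by (rule isometry_word_op[OF S tw])
    have ut: "isometry (star u * word_op S t)"
      by (intro isometry_mult unitary_isometry unitary_star u(2) t_iso)
    obtain g where g: "g \<in> words n" "star u * word_op S t = word_op S g"
    proof (rule positive_word_sum_contraction[OF n S word_poly_pair_mult_word[OF S S K(2) t]])
      show "norm (star u * word_op S t) \<le> 1"
        using norm_isometry[OF ut] by simp
      show thesis if "star u * word_op S t = 0"
        using norm_isometry[OF ut] that by simp
    qed
    have dichotomy: "word_mono T p * word_op S t = 0 \<or> (\<exists>w\<in>words n. word_mono T p * word_op S t = word_op S w)"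
      if p: "p \<in> J" for p
    proof -
      have iso: "isometry (word_op T (fst p))" "isometry (word_op T (snd p))"
        using JW[OF p] by (auto intro: isometry_word_op[OF twisted_cuntz])
      have "norm (word_mono T p * word_op S t) \<le> 1"
        using norm_star_isometry_mult_le[OF iso(2), of "word_op S t"]
        by (simp add: word_mono_def mult.assoc norm_isometry_mult[OF iso(1)] norm_isometry[OF t_iso])
      then show ?thesis
        using positive_word_sum_contraction[OF n S word_poly_pair_mult_word[OF S S K(1)[OF p] t]] by blast
    qed
    define P where "P = {p \<in> J. word_mono T p * word_op S t \<noteq> 0}"
    have "\<forall>p\<in>P. \<exists>w. w \<in> words n \<and> word_mono T p * word_op S t = word_op S w"
      using dichotomy by (auto simp: P_def)
    then obtain w where w: "\<And>p. p \<in> P \<Longrightarrow> w p \<in> words n" "\<And>p. p \<in> P \<Longrightarrow> word_mono T p * word_op S t = word_op S (w p)"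
      by metis
    have P: "finite P" "P \<subseteq> J"
      using J(1) by (auto simp: P_def)
    have inj_w: "p = q" if "p \<in> P" "q \<in> P" "w p = w q" for p q
    proof (rule images_disjoint[OF _ _ tw w(1)[OF that(1)] w(2)[OF that(1)]])
      show "p \<in> words n \<times> words_of n k" "q \<in> words n \<times> words_of n k"
        using that(1,2) P(2) J(2) by blast+
      show "word_mono T q * word_op S t = word_op S (w p)"
        unfolding that(3) by (rule w(2)[OF that(2)])
    qed
    \<comment> \<open>\<open>None\<close> stands for \<open>star u\<close>, with word
      \<open>g\<close> and coefficient \<open>-1\<close>, and \<open>Some p\<close> for a monomial.
      The difference from \<open>star u\<close> thus becomes one indexed sum of words.\<close>
    define w' where "w' = case_option g w"
    define c' where "c' = case_option (- 1) c"
    have sum_P: "(\<Sum>p\<in>J. c p *\<^sub>C word_mono T p) * word_op S t = (\<Sum>p\<in>P. c p *\<^sub>C word_op S (w p))"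
    proof -
      have "(\<Sum>p\<in>J. c p *\<^sub>C word_mono T p) * word_op S t = (\<Sum>p\<in>J. c p *\<^sub>C (word_mono T p * word_op S t))"
        by (simp add: sum_distrib_right mult_scaleC_left)
      also have "\<dots> = (\<Sum>p\<in>P. c p *\<^sub>C (word_mono T p * word_op S t))"
        using J(1) by (intro sum.mono_neutral_right) (auto simp: P_def)
      finally show ?thesis
        using w(2) by simp
    qed
    have "((\<Sum>p\<in>J. c p *\<^sub>C word_mono T p) - star u) * word_op S t
        = (\<Sum>j\<in>insert None (Some ` P). c' j *\<^sub>C word_op S (w' j))"
      using P(1) g(2) by (simp add: left_diff_distrib sum_P sum.reindex w'_def c'_def)
    then have small: "norm (\<Sum>j\<in>insert None (Some ` P). c' j *\<^sub>C word_op S (w' j)) < 1/2"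
      using norm_mult_isometry_le[OF t_iso] close by (metis le_less_trans)
    have coeff: "cmod (\<Sum>j | j \<in> insert None (Some ` P) \<and> w' j = y. c' j) < 1/2" if "y \<in> words n" for y
      by (rule le_less_trans[OF coefficient_le_norm[OF n S _ _ that] small]) (use P w g in \<open>auto simp: w'_def\<close>)
    have other: "cmod (c p) < 1/2" if p: "p \<in> P" "w p \<noteq> g" for p
    proof -
      have "{j. j \<in> insert None (Some ` P) \<and> w' j = w p} = {Some p}"
        using p by (auto simp: w'_def dest: inj_w[OF _ p(1)] split: option.splits)
      then show ?thesis
        using coeff[OF w(1)[OF p(1)]] by (simp add: c'_def)
    qed
    \<comment> \<open>Otherwise the coefficient of \<open>g\<close> would be the \<open>-1\<close>
      of \<open>star u\<close> alone, contradicting the bound 1/2.\<close>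
    have "\<exists>p\<in>P. w p = g"
    proof (rule ccontr)
      assume "\<not> (\<exists>p\<in>P. w p = g)"
      then have "{j. j \<in> insert None (Some ` P) \<and> w' j = g} = {None}"
        by (auto simp: w'_def)
      then show False
        using coeff[OF g(1)] by (simp add: c'_def)
    qed
    then obtain p0 where p0: "p0 \<in> P" "w p0 = g"
      by blast
    have "{j. j \<in> insert None (Some ` P) \<and> w' j = g} = insert None (Some ` {p \<in> P. w p = g})"
      by (auto simp: w'_def)
    moreover have "{p \<in> P. w p = g} = {p0}"
      using p0 inj_w by blast
    ultimately have "{j. j \<in> insert None (Some ` P) \<and> w' j = g} = {None, Some p0}"
      by simp
    then have "cmod (c p0 - 1) < 1/2"
      using coeff[OF g(1)] by (simp add: c'_def)
    then have p0_Y: "p0 \<in> Y"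
      using p0(1) P(2) by (auto simp: Y_def)
    have "word_mono T p * word_op S t = 0" if p: "p \<in> Y" "p \<noteq> p0" for p
    proof (rule ccontr)
      assume "word_mono T p * word_op S t \<noteq> 0"
      then have pP: "p \<in> P"
        using p(1) by (auto simp: P_def Y_def)
      then have "cmod (c p) < 1/2"
        using other[OF pP] inj_w[OF pP p0(1)] p0(2) p(2) by auto
      moreover have "cmod (c p - 1) < 1/2"
        using p(1) by (simp add: Y_def)
      moreover have "1 \<le> cmod (c p) + cmod (c p - 1)"
        using norm_triangle_ineq4[of "c p" "c p - 1"] by simp
      ultimately show False
        by linarith
    qed
    then have "(\<Sum>p\<in>Y. word_mono T p * word_op S t) = (\<Sum>p\<in>{p0}. word_mono T p * word_op S t)"
      using p0_Y J(1) by (intro sum.mono_neutral_right) (auto simp: Y_def)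
    then show ?thesis
      using w(2)[OF p0(1)] p0(2) g(2) by (simp add: sum_distrib_right)
  qed
  \<comment> \<open>Agreement after multiplication by all words of length \<open>K\<close> suffices,
    since their range projections sum to \<open>1\<close>.\<close>
  have expand: "a = (\<Sum>t\<in>words_of n K. (a * word_op S t) * star (word_op S t))" for a
  proof -
    have "a = a * (\<Sum>t\<in>words_of n K. word_op S t * star (word_op S t))"
      by (simp add: sum_word_op[OF S])
    then show ?thesis
      by (simp only: sum_distrib_left mult.assoc)
  qed
  have sum_Y: "(\<Sum>p\<in>Y. word_mono T p) = star u"
    using expand[of "\<Sum>p\<in>Y. word_mono T p"] expand[of "star u"] Y by (metis (no_types, lifting) sum.cong)
  have "Y \<subseteq> J"
    by (auto simp: Y_def)
  from f_sum[OF this, of "\<lambda>_. 1"] have "f (\<Sum>p\<in>Y. word_mono S p) = f v"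
    by (simp add: sum_Y v(2))
  moreover have "(\<Sum>p\<in>Y. word_mono S p) \<in> ?O"
    using JW \<open>Y \<subseteq> J\<close> by (intro star_subalgebra_sum[OF O] word_mono_in_cuntz_algebra[OF S]) auto
  ultimately have "v = (\<Sum>p\<in>Y. word_mono S p)"
    using inj v(1) by (metis inj_onD)
  moreover have "word_poly S {1} (monomials n UNIV) (\<Sum>p\<in>Y. word_mono S p)"
    using JW \<open>Y \<subseteq> J\<close> by (intro word_poly_pair_sum word_poly_pair_mono1) (auto simp: monomials_UNIV)
  ultimately show ?thesis
    by simp
qed

end

lemma word_poly_split:
  assumes "word_poly S C (monomials n UNIV) a"
  shows "\<exists>a0 a1. word_poly S C (monomials n {0}) a0 \<and> word_poly S C (monomials n (- {0})) a1 \<and> a = a0 + a1"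
  using assms
proof (induction rule: word_poly_induct)
  case zero
  show ?case
    by (intro exI[of _ 0]) (simp add: word_poly_pair.zero)
next
  case (mono c p)
  show ?case
  proof (cases "deg p = 0")
    case True
    then show ?thesis
      using mono by (intro exI[of _ "c *\<^sub>C word_mono S p"] exI[of _ 0])
        (auto simp: monomials_def intro: word_poly_pair.intros)
  next
    case False
    then show ?thesis
      using mono by (intro exI[of _ 0] exI[of _ "c *\<^sub>C word_mono S p"])
        (auto simp: monomials_def intro: word_poly_pair.intros)
  qed
next
  case (add a a')
  then obtain a0 a1 a0' a1' where
    "word_poly S C (monomials n {0}) a0" "word_poly S C (monomials n (- {0})) a1" "a = a0 + a1"
    "word_poly S C (monomials n {0}) a0'" "word_poly S C (monomials n (- {0})) a1'" "a' = a0' + a1'"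
    by blast
  then show ?case
    by (intro exI[of _ "a0 + a0'"] exI[of _ "a1 + a1'"]) (simp add: word_poly_pair.add add_ac)
qed

text \<open>Degrees are preserved, so \<open>f v0 - star u\<close> is balanced, \<open>f v1\<close>
  is unbalanced, and they add up to zero. By \<open>norm_balanced_le\<close> the balanced one
  vanishes; injectivity then gives \<open>v0 = v\<close>.\<close>

lemma balanced_preimage:
  assumes n: "n \<ge> 2" and S: "cuntz_isometries n S"
    and u: "word_poly S {1} (monomials n {0}) u"
    and f: "f \<in> star_endos (cuntz_algebra n S)" "\<And>i. i \<in> {1..n} \<Longrightarrow> f (S i) = u * S i"
    and inj: "inj_on f (cuntz_algebra n S)"
    and v: "word_poly S {1} (monomials n UNIV) v" "f v = star u"
  shows "word_poly S {1} (monomials n {0}) v"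
proof -
  obtain v0 v1 where v01: "word_poly S {1} (monomials n {0}) v0" "word_poly S {1} (monomials n (- {0})) v1" "v = v0 + v1"
    using word_poly_split[OF v(1)] by blast
  have poly_f: "word_poly S UNIV (monomials n D) (f a)" if "word_poly S {1} (monomials n D) a" for D a
    by (rule word_poly_pair_subset[OF lambda_word_poly[OF S u _ f(1) f(2) _ that]]) (auto simp: monomials_def)
  have "word_poly S UNIV (monomials n {0}) (f v0)"
    by (rule poly_f[OF v01(1)])
  moreover have "word_poly S UNIV (monomials n {0}) (star u)"
    by (rule word_poly_pair_subset[OF word_poly_pair_star_monomials[OF u]]) auto
  ultimately have 0: "word_poly S UNIV (monomials n {0}) (f v0 - star u)"
    by (rule word_poly_pair_diff)
  have 1: "word_poly S UNIV (monomials n (- {0})) (f v1)"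
    by (rule poly_f[OF v01(2)])
  have in_O: "v0 \<in> cuntz_algebra n S" "v1 \<in> cuntz_algebra n S"
    using v01 word_poly_in_cuntz_algebra[OF S] by blast+
  have "f v0 - star u + f v1 = 0"
    using star_endo_add[OF f(1) in_O] v(2) by (simp add: v01(3) algebra_simps)
  then have "f v0 = f v"
    using norm_balanced_le[OF n S 0 1] v(2) by simp
  then have "v0 = v"
    using inj in_O v01(3) by (auto dest!: inj_onD simp: cuntz_algebra_closure)
  then show ?thesis
    using v01(1) by simp
qed

section \<open>Automorphism groups\<close>

lemma star_endo_restrict_id:
  assumes "closed_star_subalgebra A" "1 \<in> A"
  shows "(\<lambda>x\<in>A. x) \<in> star_endos A"
  using assms by (auto simp: star_endos_def closed_star_subalgebra_def)

lemma star_endo_compose: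
  assumes g: "g \<in> star_endos A" and f: "f \<in> star_endos A" and A: "closed_star_subalgebra A" "1 \<in> A"
  shows "compose A g f \<in> star_endos A"
proof -
  have eq: "compose A g f x = g (f x)" if "x \<in> A" for x
    using that by (simp add: compose_def)
  show ?thesis
    unfolding star_endos_def
  proof (intro CollectI conjI ballI allI)
    show "compose A g f \<in> extensional A"
      by (simp add: compose_extensional)
    show "compose A g f ` A \<subseteq> A"
      using star_endo_in[OF f] star_endo_in[OF g] by (auto simp: eq)
    show "compose A g f 1 = 1"
      by (simp add: eq A star_endo_1[OF f] star_endo_1[OF g])
    fix x assume x: "x \<in> A"
    show "compose A g f (star x) = star (compose A g f x)"
      by (simp add: eq x star_subalgebra_star[OF A(1)] star_endo_star[OF f] star_endo_star[OF g] star_endo_in[OF f])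
    show "compose A g f (c *\<^sub>C x) = c *\<^sub>C compose A g f x" for c
      by (simp add: eq x star_subalgebra_scaleC[OF A(1)] star_endo_scaleC[OF f] star_endo_scaleC[OF g] star_endo_in[OF f])
    fix y assume y: "y \<in> A"
    show "compose A g f (x + y) = compose A g f x + compose A g f y"
      by (simp add: eq x y star_subalgebra_add[OF A(1)] star_endo_add[OF f] star_endo_add[OF g] star_endo_in[OF f])
    show "compose A g f (x * y) = compose A g f x * compose A g f y"
      by (simp add: eq x y star_subalgebra_mult[OF A(1)] star_endo_mult[OF f] star_endo_mult[OF g] star_endo_in[OF f])
  qed
qed

lemma star_endo_inverse:
  assumes f: "f \<in> star_endos A" and A: "closed_star_subalgebra A" "1 \<in> A" and bij: "bij_betw f A A"
  shows "(\<lambda>x\<in>A. inv_into A f x) \<in> star_endos A"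
proof -
  define g where "g = (\<lambda>x\<in>A. inv_into A f x)"
  have g_in: "g x \<in> A" and fg: "f (g x) = x" if "x \<in> A" for x
    using that bij by (auto simp: g_def bij_betw_def inv_into_into f_inv_into_f)
  have g_eq: "g x = y" if "y \<in> A" "f y = x" for x y
    using that bij star_endo_in[OF f] by (auto simp: g_def bij_betw_def)
  show ?thesis
    unfolding g_def[symmetric] star_endos_def
  proof (intro CollectI conjI ballI allI)
    show "g \<in> extensional A"
      by (simp add: g_def)
    show "g ` A \<subseteq> A"
      using g_in by auto
    show "g 1 = 1"
      by (rule g_eq) (simp_all add: A star_endo_1[OF f])
    fix x assume x: "x \<in> A"
    show "g (star x) = star (g x)"
      by (rule g_eq) (simp_all add: x g_in fg star_subalgebra_star[OF A(1)] star_endo_star[OF f])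
    show "g (c *\<^sub>C x) = c *\<^sub>C g x" for c
      by (rule g_eq) (simp_all add: x g_in fg star_subalgebra_scaleC[OF A(1)] star_endo_scaleC[OF f])
    fix y assume y: "y \<in> A"
    show "g (x + y) = g x + g y"
      by (rule g_eq) (simp_all add: x y g_in fg star_subalgebra_add[OF A(1)] star_endo_add[OF f])
    show "g (x * y) = g x * g y"
      by (rule g_eq) (simp_all add: x y g_in fg star_subalgebra_mult[OF A(1)] star_endo_mult[OF f])
  qed
qed

lemma subgroup_star_autos:
  assumes A: "closed_star_subalgebra A" "1 \<in> A"
  shows "subgroup (star_endos A \<inter> Bij A) (BijGroup A)"
proof (rule group.subgroupI[OF group_BijGroup])
  show "star_endos A \<inter> Bij A \<subseteq> carrier (BijGroup A)"
    by (simp add: BijGroup_def)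
  show "star_endos A \<inter> Bij A \<noteq> {}"
    using star_endo_restrict_id[OF A] id_Bij by blast
  fix f assume f: "f \<in> star_endos A \<inter> Bij A"
  then show "inv\<^bsub>BijGroup A\<^esub> f \<in> star_endos A \<inter> Bij A"
    using star_endo_inverse[OF _ A] restrict_inv_into_Bij[of f A] by (auto simp: inv_BijGroup Bij_def)
  fix g assume g: "g \<in> star_endos A \<inter> Bij A"
  show "f \<otimes>\<^bsub>BijGroup A\<^esub> g \<in> star_endos A \<inter> Bij A"
    using f g star_endo_compose[OF _ _ A] compose_Bij[of f A g] by (auto simp: BijGroup_def)
qed

lemma carrier_Aut: "carrier (Aut A) = star_endos A \<inter> Bij A"
  by (simp add: Aut_def)

lemma mult_Aut: "f \<in> carrier (Aut A) \<Longrightarrow> g \<in> carrier (Aut A) \<Longrightarrow> f \<otimes>\<^bsub>Aut A\<^esub> g = compose A f g"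
  by (simp add: Aut_def BijGroup_def)

lemma one_Aut: "\<one>\<^bsub>Aut A\<^esub> = (\<lambda>x\<in>A. x)"
  by (simp add: Aut_def BijGroup_def)

lemma group_Aut:
  assumes "closed_star_subalgebra A" "1 \<in> A"
  shows "group (Aut A)"
  unfolding Aut_def by (rule subgroup.subgroup_is_group[OF subgroup_star_autos[OF assms] group_BijGroup])

lemma inv_Aut:
  assumes "closed_star_subalgebra A" "1 \<in> A" "f \<in> carrier (Aut A)"
  shows "inv\<^bsub>Aut A\<^esub> f = (\<lambda>x\<in>A. inv_into A f x)"
  using group.m_inv_consistent[OF group_BijGroup subgroup_star_autos[OF assms(1,2)], of f] assms(3)
  by (simp add: carrier_Aut inv_BijGroup) (simp add: Aut_def)

section \<open>Inner automorphisms\<close>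

definition Ad :: "'a::cstar_algebra set \<Rightarrow> 'a \<Rightarrow> 'a \<Rightarrow> 'a" where
  "Ad A u = (\<lambda>x\<in>A. u * x * star u)"

lemma Inn_eq: "Inn A = Ad A ` {u \<in> A. unitary u}"
  by (auto simp: Inn_def Ad_def)

lemma unitary_cancel: "unitary u \<Longrightarrow> star u * (u * x) = x" "unitary u \<Longrightarrow> u * (star u * x) = x"
  by (simp_all add: unitary_def flip: mult.assoc)

lemma Ad_in_Aut:
  assumes A: "closed_star_subalgebra A" "1 \<in> A" and u: "u \<in> A" "unitary u"
  shows "Ad A u \<in> carrier (Aut A)"
proof -
  have in_A: "u * x * star u \<in> A" "star u * x * u \<in> A" if "x \<in> A" for x
    using that u by (auto intro: star_subalgebra_mult[OF A(1)] star_subalgebra_star[OF A(1)])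
  have *: "Ad A u \<in> star_endos A"
    unfolding star_endos_def
  proof (intro CollectI conjI ballI allI)
    show "Ad A u \<in> extensional A"
      by (simp add: Ad_def)
    show "Ad A u ` A \<subseteq> A"
      using in_A by (auto simp: Ad_def)
    show "Ad A u 1 = 1"
      using u A by (simp add: Ad_def unitary_def)
    fix x assume x: "x \<in> A"
    show "Ad A u (star x) = star (Ad A u x)"
      by (simp add: Ad_def x star_subalgebra_star[OF A(1)] star_mult star_star mult.assoc)
    show "Ad A u (c *\<^sub>C x) = c *\<^sub>C Ad A u x" for c
      by (simp add: Ad_def x star_subalgebra_scaleC[OF A(1)] mult_scaleC_left mult_scaleC_right)
    fix y assume y: "y \<in> A"
    show "Ad A u (x + y) = Ad A u x + Ad A u y"
      by (simp add: Ad_def x y star_subalgebra_add[OF A(1)] distrib_left distrib_right)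
    show "Ad A u (x * y) = Ad A u x * Ad A u y"
      using unitary_cancel[OF u(2)] by (simp add: Ad_def x y star_subalgebra_mult[OF A(1)] mult.assoc)
  qed
  have "bij_betw (Ad A u) A A"
  proof (rule bij_betw_byWitness[where f' = "\<lambda>x. star u * x * u"])
    have "star u * u = 1" "u * star u = 1"
      using u(2) by (simp_all add: unitary_def)
    then show "\<forall>x\<in>A. star u * Ad A u x * u = x" "\<forall>x\<in>A. Ad A u (star u * x * u) = x"
      using in_A unitary_cancel[OF u(2)] by (simp_all add: Ad_def mult.assoc)
  qed (use in_A in \<open>auto simp: Ad_def\<close>)
  then show "Ad A u \<in> carrier (Aut A)"
    using * by (simp add: carrier_Aut Bij_def star_endo_extensional)
qed

text \<open>Conjugating \<open>Ad A u\<close> by an automorphism \<open>f\<close> yields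
  \<open>Ad A (f u)\<close>.\<close>

lemma normal_Inn:
  assumes A: "closed_star_subalgebra A" "1 \<in> A"
  shows "Inn A \<lhd> Aut A"
proof -
  interpret Aut: group "Aut A"
    by (rule group_Aut[OF A])
  note Ad_in = Ad_in_Aut[OF A]
  have mult: "Ad A u \<otimes>\<^bsub>Aut A\<^esub> Ad A v = Ad A (u * v)" if "u \<in> A" "unitary u" "v \<in> A" "unitary v" for u v
  proof -
    have "v * x * star v \<in> A" if "x \<in> A" for x
      using that \<open>v \<in> A\<close> by (auto intro: star_subalgebra_mult[OF A(1)] star_subalgebra_star[OF A(1)])
    then show ?thesis
      unfolding mult_Aut[OF Ad_in[OF that(1,2)] Ad_in[OF that(3,4)]]
      by (auto simp: Ad_def compose_def star_mult mult.assoc)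
  qed
  have inv: "inv\<^bsub>Aut A\<^esub> Ad A u = Ad A (star u)" if u: "u \<in> A" "unitary u" for u
  proof (rule Aut.inv_equality)
    have su: "star u \<in> A" "unitary (star u)"
      using u by (auto intro: star_subalgebra_star[OF A(1)] unitary_star)
    show "Ad A (star u) \<otimes>\<^bsub>Aut A\<^esub> Ad A u = \<one>\<^bsub>Aut A\<^esub>"
      unfolding mult[OF su u] one_Aut using u by (auto simp: Ad_def unitary_def)
    show "Ad A u \<in> carrier (Aut A)" "Ad A (star u) \<in> carrier (Aut A)"
      by (rule Ad_in[OF u] Ad_in[OF su])+
  qed
  show ?thesis
  proof (rule Aut.normal_invI)
    show "subgroup (Inn A) (Aut A)"
    proof (rule Aut.subgroupI)
      show "Inn A \<subseteq> carrier (Aut A)"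
        using Ad_in by (auto simp: Inn_eq)
      show "Inn A \<noteq> {}"
        using A(2) unitary_1 by (auto simp: Inn_eq)
      show "inv\<^bsub>Aut A\<^esub> f \<in> Inn A" if "f \<in> Inn A" for f
        using that inv by (auto simp: Inn_eq intro!: imageI star_subalgebra_star[OF A(1)] unitary_star)
      show "f \<otimes>\<^bsub>Aut A\<^esub> g \<in> Inn A" if "f \<in> Inn A" "g \<in> Inn A" for f g
        using that mult by (auto simp: Inn_eq intro!: imageI star_subalgebra_mult[OF A(1)] unitary_mult)
    qed
    fix f h assume f: "f \<in> carrier (Aut A)" and "h \<in> Inn A"
    then obtain u where u: "u \<in> A" "unitary u" "h = Ad A u"
      by (auto simp: Inn_eq)
    have f': "f \<in> star_endos A"
      using f by (simp add: carrier_Aut)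
    have fu: "f u \<in> A" "unitary (f u)"
      using u star_subalgebra_star[OF A(1) u(1)] star_endo_1[OF f']
      by (auto simp: unitary_def star_endo_in[OF f'] simp flip: star_endo_star[OF f'] star_endo_mult[OF f'])
    have "f \<otimes>\<^bsub>Aut A\<^esub> h = Ad A (f u) \<otimes>\<^bsub>Aut A\<^esub> f"
    proof -
      have "f (u * x * star u) = f u * f x * star (f u)" if "x \<in> A" for x
        using that u(1) star_subalgebra_star[OF A(1) u(1)]
        by (simp add: star_endo_mult[OF f'] star_endo_star[OF f'] star_subalgebra_mult[OF A(1)])
      then show ?thesis
        unfolding u(3) mult_Aut[OF f Ad_in[OF u(1,2)]] mult_Aut[OF Ad_in[OF fu] f]
        by (auto simp: compose_def Ad_def star_endo_in[OF f'])
    qed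
    then have "f \<otimes>\<^bsub>Aut A\<^esub> h \<otimes>\<^bsub>Aut A\<^esub> inv\<^bsub>Aut A\<^esub> f = Ad A (f u)"
      using f Ad_in[OF fu] by (simp add: Aut.m_assoc)
    then show "f \<otimes>\<^bsub>Aut A\<^esub> h \<otimes>\<^bsub>Aut A\<^esub> inv\<^bsub>Aut A\<^esub> f \<in> Inn A"
      using fu by (auto simp: Inn_eq)
  qed
qed

section \<open>The two unitary groups in terms of polynomials, and the automorphisms they
  define\<close>

lemma S_unitaries_eq:
  assumes S: "cuntz_isometries n S"
  shows "S_unitaries n S = {u. unitary u \<and> word_poly S {1} (monomials n UNIV) u}"
proof -
  have "(\<exists>ps\<in>lists (words n \<times> words n). u = (\<Sum>(\<alpha>, \<beta>)\<leftarrow>ps. word_op S \<alpha> * star (word_op S \<beta>)))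
      \<longleftrightarrow> word_poly S {1} (monomials n UNIV) u" for u
    unfolding positive_poly_sum_list monomials_UNIV lists_eq_set
    by (auto simp: word_mono_def[abs_def] case_prod_beta')
  then show ?thesis
    using word_poly_in_cuntz_algebra[OF S] by (auto simp: S_unitaries_def)
qed

lemma core_UHF_eq: "core_UHF n S = closure {a. word_poly S UNIV (monomials n {0}) a}"
proof -
  have base: "{word_op S \<mu> * star (word_op S \<nu>) | \<mu> \<nu>. \<mu> \<in> words n \<and> \<nu> \<in> words n \<and> length \<mu> = length \<nu>}
      = word_mono S ` monomials n {0}" (is "?B = _")
    by (force simp: word_mono_def monomials_def deg_def image_iff)
  have "module.span scaleC ?B \<subseteq> {a. word_poly S UNIV (monomials n {0}) a}"
    unfolding base
  proof (rule cscale.span_minimal)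
    show "word_mono S ` monomials n {0} \<subseteq> {a. word_poly S UNIV (monomials n {0}) a}"
      by (auto intro: word_poly_pair_mono1)
    show "module.subspace scaleC {a. word_poly S UNIV (monomials n {0}) a}"
      by (rule cscale.subspaceI) (auto intro: word_poly_pair.zero word_poly_pair.add word_poly_pair_scale)
  qed
  moreover have "a \<in> module.span scaleC ?B" if "word_poly S UNIV (monomials n {0}) a" for a
    using that unfolding base
  proof (induction rule: word_poly_induct)
    case zero
    show ?case by (rule cscale.span_zero)
  next
    case (mono c p)
    then show ?case by (intro cscale.span_scale cscale.span_base) auto
  next
    case (add a a')
    then show ?case by (intro cscale.span_add)
  qed
  ultimately have "module.span scaleC ?B = {a. word_poly S UNIV (monomials n {0}) a}"
    by blast
  then show ?thesis
    by (simp add: core_UHF_def)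
qed

text \<open>Membership in the core is analytic, whereas the conclusion provides a balanced sum of
  words. If a balanced \<open>a\<close> is close to \<open>u\<close>, then
  \<open>norm_balanced_le\<close> makes it as close to the balanced part \<open>u0\<close>, so the
  unbalanced part \<open>u1\<close> has norm zero.\<close>

lemma P_unitaries_eq:
  assumes n: "n \<ge> 2" and S: "cuntz_isometries n S"
  shows "P_unitaries n S = {u. unitary u \<and> word_poly S {1} (monomials n {0}) u}"
proof (intro equalityI subsetI)
  fix u assume "u \<in> P_unitaries n S"
  then have u: "unitary u" "word_poly S {1} (monomials n UNIV) u" and core: "u \<in> core_UHF n S"
    by (auto simp: P_unitaries_def S_unitaries_eq[OF S])
  obtain u0 u1 where u01: "word_poly S {1} (monomials n {0}) u0" "word_poly S {1} (monomials n (- {0})) u1" "u = u0 + u1"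
    using word_poly_split[OF u(2)] by blast
  have "norm u1 \<le> 0"
  proof (rule field_le_epsilon)
    fix e :: real assume "e > 0"
    then obtain a where a: "word_poly S UNIV (monomials n {0}) a" "norm (a - u) < e / 2"
      using core unfolding core_UHF_eq closure_approachable dist_norm by (metis half_gt_zero mem_Collect_eq)
    have "word_poly S UNIV (monomials n {0}) (u0 - a)"
      by (rule word_poly_pair_diff[OF word_poly_pair_subset[OF u01(1)] a(1)]) auto
    moreover have "word_poly S UNIV (monomials n (- {0})) u1"
      by (rule word_poly_pair_subset[OF u01(2)]) auto
    ultimately have "norm (u0 - a) \<le> norm (u0 - a + u1)"
      by (rule norm_balanced_le[OF n S])
    also have "u0 - a + u1 = - (a - u)"
      by (simp add: u01(3))
    finally have "norm (u0 - a) \<le> norm (a - u)"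
      by (simp only: norm_minus_cancel)
    moreover have "u1 = - (a - u) - (u0 - a)"
      by (simp add: u01(3))
    then have "norm u1 \<le> norm (a - u) + norm (u0 - a)"
      by (metis norm_minus_cancel norm_triangle_ineq4)
    ultimately show "norm u1 \<le> 0 + e"
      using a(2) by simp
  qed
  then show "u \<in> {u. unitary u \<and> word_poly S {1} (monomials n {0}) u}"
    using u u01 by simp
next
  fix u assume u: "u \<in> {u. unitary u \<and> word_poly S {1} (monomials n {0}) u}"
  then have "word_poly S {1} (monomials n UNIV) u" "word_poly S UNIV (monomials n {0}) u"
    by (auto elim!: word_poly_pair_subset simp: monomials_def)
  then show "u \<in> P_unitaries n S"
    using u closure_subset by (fastforce simp: P_unitaries_def S_unitaries_eq[OF S] core_UHF_eq)
qed

lemma unitary_star_endo: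
  assumes f: "f \<in> star_endos A" and A: "closed_star_subalgebra A" "1 \<in> A" and u: "u \<in> A" "unitary u"
  shows "unitary (f u)"
  using u star_subalgebra_star[OF A(1) u(1)] star_endo_1[OF f]
  by (auto simp: unitary_def simp flip: star_endo_star[OF f] star_endo_mult[OF f])

text \<open>If \<open>f\<close> and \<open>g\<close> belong to \<open>u\<close> and
  \<open>v\<close>, their composite belongs to \<open>f v * u\<close>, and the inverse of
  \<open>f\<close> belongs to the preimage of \<open>star u\<close>. The delicate point is that this
  preimage is again a sum of words, balanced if \<open>u\<close> is.\<close>

lemma subgroup_lambda_auts:
  assumes n: "n \<ge> 2" and S: "cuntz_isometries n S" and E: "E = UNIV \<or> E = {0}"
  defines "U \<equiv> {u. unitary u \<and> word_poly S {1} (monomials n E) u}"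
  shows "subgroup (lambda_auts n S U) (Aut (cuntz_algebra n S))"
proof -
  let ?O = "cuntz_algebra n S"
  note A = closed_star_subalgebra_cuntz_algebra[of n S] one_in_cuntz_algebra[OF S]
  interpret Aut: group "Aut ?O"
    by (rule group_Aut[OF A])
  have U_in: "u \<in> ?O" if "u \<in> U" for u
    using that word_poly_in_cuntz_algebra[OF S] by (auto simp: U_def)
  have lambda_iff: "f \<in> lambda_auts n S U \<longleftrightarrow> f \<in> carrier (Aut ?O) \<and> (\<exists>u\<in>U. \<forall>i\<in>{1..n}. f (S i) = u * S i)" for f
    by (auto simp: lambda_auts_def is_lambda_def carrier_Aut)
  show ?thesis
  proof (rule Aut.subgroupI)
    show "lambda_auts n S U \<subseteq> carrier (Aut ?O)"
      by (auto simp: lambda_auts_def)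
    have "word_poly S {1} (monomials n E) 1"
      using word_poly_pair_mono1[of "{1}" "([], [])" "monomials n E" S S] E by (auto simp: monomials_def deg_def)
    then have "1 \<in> U"
      by (simp add: U_def unitary_1)
    moreover have "\<one>\<^bsub>Aut ?O\<^esub> (S i) = 1 * S i" if "i \<in> {1..n}" for i
      using generator_in_cuntz_algebra[OF that, of S] by (simp add: one_Aut)
    ultimately have "\<one>\<^bsub>Aut ?O\<^esub> \<in> lambda_auts n S U"
      unfolding lambda_iff by blast
    then show "lambda_auts n S U \<noteq> {}"
      by blast
  next
    fix f assume "f \<in> lambda_auts n S U"
    then obtain u where f: "f \<in> carrier (Aut ?O)" and u: "u \<in> U" and fS: "\<And>i. i \<in> {1..n} \<Longrightarrow> f (S i) = u * S i"
      unfolding lambda_iff by blast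
    have f': "f \<in> star_endos ?O" and bij: "bij_betw f ?O ?O"
      using f by (auto simp: carrier_Aut Bij_def)
    have u': "unitary u" "word_poly S {1} (monomials n E) u"
      using u by (auto simp: U_def)
    have u_UNIV: "word_poly S {1} (monomials n UNIV) u"
      by (rule word_poly_pair_subset[OF u'(2)]) (auto simp: monomials_def)
    show "f \<otimes>\<^bsub>Aut ?O\<^esub> g \<in> lambda_auts n S U" if "g \<in> lambda_auts n S U" for g
    proof -
      from that obtain v where g: "g \<in> carrier (Aut ?O)" and v: "v \<in> U" and gS: "\<And>i. i \<in> {1..n} \<Longrightarrow> g (S i) = v * S i"
        unfolding lambda_iff by blast
      have v': "unitary v" "word_poly S {1} (monomials n E) v"
        using v by (auto simp: U_def)
      have "word_poly S {1} (monomials n {j. \<exists>d\<in>E. j - d \<in> E}) (f v)"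
        by (rule lambda_word_poly[OF S u'(2) E f' fS _ v'(2)]) auto
      then have "word_poly S {1} (monomials n E) (f v * u)"
        by (rule word_poly_pair_mult_monomials[OF S S _ u'(2)]) (use E in auto)
      then have "f v * u \<in> U"
        using unitary_mult[OF unitary_star_endo[OF f' A U_in[OF v] v'(1)] u'(1)] by (simp add: U_def)
      moreover have "(f \<otimes>\<^bsub>Aut ?O\<^esub> g) (S i) = f v * u * S i" if i: "i \<in> {1..n}" for i
        using generator_in_cuntz_algebra[OF i, of S] U_in[OF v]
        by (simp add: mult_Aut[OF f g] compose_def gS[OF i] star_endo_mult[OF f'] fS[OF i] mult.assoc)
      ultimately show ?thesis
        unfolding lambda_iff using f g by blast
    qed
    define v where "v = inv_into ?O f (star u)"
    have su: "star u \<in> ?O"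
      using U_in[OF u] by (rule cuntz_algebra_closure)
    have v: "v \<in> ?O" "f v = star u"
      using bij su by (auto simp: v_def bij_betw_def inv_into_into f_inv_into_f)
    have inj: "inj_on f ?O" and surj: "?O \<subseteq> f ` ?O"
      using bij by (auto simp: bij_betw_def)
    have v_UNIV: "word_poly S {1} (monomials n UNIV) v"
      by (rule preimage_positive[OF n S u_UNIV u'(1) f' fS surj inj v])
    have v_E: "word_poly S {1} (monomials n E) v"
      using E
    proof
      assume "E = {0}"
      then show ?thesis
        using balanced_preimage[OF n S _ f' fS inj v_UNIV v(2)] u'(2) by simp
    qed (simp add: v_UNIV)
    let ?g = "inv\<^bsub>Aut ?O\<^esub> f"
    have g_eq: "?g = (\<lambda>x\<in>?O. inv_into ?O f x)"
      by (rule inv_Aut[OF A f])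
    have g: "?g \<in> carrier (Aut ?O)"
      by (rule Aut.inv_closed[OF f])
    have "v = ?g (star u)"
      using su by (simp add: g_eq v_def)
    then have "unitary v"
      using unitary_star_endo[OF _ A su unitary_star[OF u'(1)]] g by (simp add: carrier_Aut)
    moreover have "?g (S i) = v * S i" if i: "i \<in> {1..n}" for i
    proof -
      have Si: "S i \<in> ?O" "v * S i \<in> ?O"
        using generator_in_cuntz_algebra[OF i, of S] v(1) by (auto intro: cuntz_algebra_closure)
      have "f (v * S i) = S i"
        using unitary_cancel(1)[OF u'(1)] Si(1) v by (simp add: star_endo_mult[OF f'] fS[OF i])
      then show ?thesis
        using Si inj by (metis (no_types, lifting) g_eq inv_into_f_eq restrict_apply')
    qed
    ultimately show "?g \<in> lambda_auts n S U"
      unfolding lambda_iff using g v_E by (auto simp: U_def)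
  qed
qed

lemma subgroup_out_class_image:
  assumes A: "closed_star_subalgebra A" "1 \<in> A" and H: "subgroup H (Aut A)"
  shows "subgroup (out_class A ` H) (Out A)"
proof -
  interpret N: normal "Inn A" "Aut A"
    by (rule normal_Inn[OF A])
  have "group_hom (Aut A) (Out A) (out_class A)"
    unfolding Out_def out_class_def[abs_def]
    by (intro group_hom.intro group_hom_axioms.intro group_Aut A N.factorgroup_is_group N.r_coset_hom_Mod)
  then show ?thesis
    by (rule group_hom.subgroup_img_is_subgroup[OF _ H])
qed

section \<open>An automorphism outside the restricted group\<close>

lemma star_endo_eq_id:
  assumes n: "n \<ge> 2" and S: "cuntz_isometries n S" and g: "g \<in> star_endos (cuntz_algebra n S)"
    and gS: "\<And>i. i \<in> {1..n} \<Longrightarrow> g (S i) = S i" and x: "x \<in> cuntz_algebra n S"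
  shows "g x = x"
proof -
  note A = closed_star_subalgebra_cuntz_algebra[of n S] one_in_cuntz_algebra[OF S]
  have eq: "a = b" if "word_poly_pair S S UNIV I a b" for a b I
    using that by induction auto
  have "norm (g x - x) \<le> 0"
  proof (rule field_le_epsilon)
    fix e :: real assume "e > 0"
    then obtain a where a: "word_poly S UNIV (monomials n UNIV) a" "norm (a - x) < e / 2"
      using cuntz_algebra_approx[OF S x, of "e / 2"] by auto
    have a_in: "a \<in> cuntz_algebra n S"
      by (rule word_poly_in_cuntz_algebra[OF S a(1)])
    have ga: "a = g a"
      by (rule eq[OF star_endo_word_poly[OF g S gS a(1)]])
    have "norm (g a - g x) \<le> norm (a - x)"
      using star_endo_norm_le[OF g A star_subalgebra_diff[OF A(1) a_in x]]
      by (simp add: star_endo_diff[OF g A(1) a_in x])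
    moreover have "g x - x = (a - x) - (g a - g x)"
      using ga by simp
    then have "norm (g x - x) \<le> norm (a - x) + norm (g a - g x)"
      by (metis norm_triangle_ineq4)
    ultimately show "norm (g x - x) \<le> 0 + e"
      using a(2) by simp
  qed
  then show ?thesis
    by simp
qed

text \<open>Since \<open>G ^ k * y = y * B ^ k\<close>, one has \<open>1 = star y * star (G ^ k) * y * B ^ k\<close>. Approximating
  \<open>y\<close> by a polynomial makes the right-hand side unbalanced for large \<open>k\<close>.\<close>

lemma degree_obstruction:
  assumes n: "n \<ge> 2" and S: "cuntz_isometries n S" and y: "y \<in> cuntz_algebra n S" "isometry y"
    and G: "isometry G" "word_poly S UNIV (monomials n {1}) G"
    and B: "isometry B" "word_poly S UNIV (monomials n {2}) B"
  shows "G * y \<noteq> y * B"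
proof
  assume Gy: "G * y = y * B"
  have Gyk: "G ^ k * y = y * B ^ k" for k
  proof (induction k)
    case (Suc k)
    have "G ^ Suc k * y = G * (G ^ k * y)"
      by (simp add: mult.assoc)
    also have "\<dots> = (G * y) * B ^ k"
      by (simp add: Suc mult.assoc)
    finally show ?case
      by (simp add: Gy mult.assoc)
  qed simp
  \<comment> \<open>With error below 1/4 and \<open>norm q \<le> 5/4\<close>, replacing
    \<open>y\<close> by \<open>q\<close> changes the product by less than \<open>1/4 + 5/16\<close>,
    which is below 1.\<close>
  obtain q where q: "word_poly S UNIV (monomials n UNIV) q" "norm (q - y) < 1/4"
    using cuntz_algebra_approx[OF S y(1), of "1/4"] by auto
  obtain d where d: "word_poly S UNIV (monomials n (degs d)) q"
    using word_poly_pair_degs[OF q(1)] by blast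
  \<comment> \<open>The two copies of \<open>q\<close> shift degrees by at most
    \<open>2 * d\<close>, while \<open>star X\<close> and \<open>Y\<close> contribute
    \<open>- k\<close> and \<open>2 * k\<close>. So all degrees are at least
    \<open>k - 2 * d = 1\<close>.\<close>
  define k where "k = 2 * d + 1"
  define X where "X = G ^ k"
  define Y where "Y = B ^ k"
  have X: "isometry X" "word_poly S UNIV (monomials n {int k}) X"
    using isometry_power[OF G(1)] word_poly_pair_power_monomials[OF S S G(2), of k] by (simp_all add: X_def)
  have Y: "isometry Y" "word_poly S UNIV (monomials n {int k * 2}) Y"
    using isometry_power[OF B(1)] word_poly_pair_power_monomials[OF S S B(2), of k] by (simp_all add: Y_def)
  have uminus_degs: "uminus ` degs d = degs d"
    by (auto simp: degs_def)
  have "word_poly S UNIV (monomials n {- int d - int k..int d - int k}) (star q * star X)"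
    by (rule word_poly_pair_mult_monomials[OF S S word_poly_pair_star_monomials[OF d] word_poly_pair_star_monomials[OF X(2)]])
      (auto simp: uminus_degs degs_def)
  then have "word_poly S UNIV (monomials n {- int k - 2 * int d..2 * int d - int k}) (star q * star X * q)"
    by (rule word_poly_pair_mult_monomials[OF S S _ d]) (auto simp: degs_def)
  then have "word_poly S UNIV (monomials n (- {0})) (star q * star X * q * Y)"
    by (rule word_poly_pair_mult_monomials[OF S S _ Y(2)]) (auto simp: k_def)
  then have 1: "word_poly S UNIV (monomials n (- {0})) (- (star q * star X * q * Y))"
    by (rule word_poly_pair_minus)
  have 0: "word_poly S UNIV (monomials n {0}) 1"
    using word_poly_pair_mono1[of UNIV "([], [])" "monomials n {0}" S S] by (simp add: monomials_def deg_def)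
  have "1 \<le> norm (1 - star q * star X * q * Y)"
    using norm_balanced_le[OF n S 0 1] by simp
  moreover have "star y * star X * y * Y = 1"
    using Gyk[of k] isometry_cancel[OF X(1)] y(2) by (simp add: X_def Y_def mult.assoc isometry_def flip: Gyk)
  then have "1 - star q * star X * q * Y = star y * (star X * ((y - q) * Y)) + star (y - q) * (star X * (q * Y))"
    by (simp add: star_diff left_diff_distrib right_diff_distrib mult.assoc)
  then have "norm (1 - star q * star X * q * Y)
      \<le> norm (star y * (star X * ((y - q) * Y))) + norm (star (y - q) * (star X * (q * Y)))"
    by (metis norm_triangle_ineq)
  moreover have "norm (star y * (star X * ((y - q) * Y))) \<le> norm (y - q)"
    by (intro order_trans[OF norm_star_isometry_mult_le] y(2) X(1) order_refl norm_mult_isometry_le Y(1))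
  moreover have "norm (star (y - q) * (star X * (q * Y))) \<le> norm (y - q) * norm q"
  proof -
    have "norm (star X * (q * Y)) \<le> norm q"
      by (intro order_trans[OF norm_star_isometry_mult_le] X(1) norm_mult_isometry_le Y(1))
    then show ?thesis
      using norm_mult_ineq[of "star (y - q)"] mult_left_mono[of _ _ "norm (y - q)"]
      by (metis norm_ge_zero norm_star order_trans)
  qed
  moreover have "norm q \<le> 5/4"
    using norm_triangle_ineq[of "q - y" y] q(2) norm_isometry[OF y(2)] by simp
  moreover have "norm (y - q) < 1/4"
    using q(2) by (simp add: norm_minus_commute)
  moreover have "norm (y - q) * norm q \<le> 1/4 * (5/4)"
    using calculation by (intro mult_mono) auto
  ultimately show False
    by linarith
qed

text \<open>The unitary \<open>S\<^sub>1\<^sub>1 S\<^sub>1\<^sub>2\<^sub>1\<^sup>* + S\<^sub>1\<^sub>2\<^sub>1 S\<^sub>1\<^sub>1\<^sup>* + (1 - P\<^sub>1\<^sub>1 - P\<^sub>1\<^sub>2\<^sub>1)\<close> exchanging the cylinders of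
  \<open>11\<close> and \<open>121\<close>. It is fixed by its own endomorphism, which is therefore an involution.\<close>

definition swap_root :: "(nat \<Rightarrow> 'a::cstar_algebra) \<Rightarrow> 'a" where
  "swap_root S = S 1 * star (S 2 * S 1) + S 2 * S 1 * star (S 1) + 1 - S 1 * star (S 1) - S 2 * S 1 * star (S 2 * S 1)"

definition swap_unitary :: "(nat \<Rightarrow> 'a::cstar_algebra) \<Rightarrow> 'a" where
  "swap_unitary S = S 1 * swap_root S * star (S 1) + 1 - S 1 * star (S 1)"

context
  notes One_nat_def [simp del]
  fixes n :: nat and S :: "nat \<Rightarrow> 'a::cstar_algebra"
  assumes n: "n \<ge> 2" and S: "cuntz_isometries n S"
begin

lemma gens: "1 \<in> {1..n}" "2 \<in> {1..n}"
  using n by auto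

lemma cuntz_12:
  "star (S 1) * (S 1 * x) = x" "star (S 2) * (S 2 * x) = x" "star (S 1) * (S 2 * x) = 0" "star (S 2) * (S 1 * x) = 0"
  "star (S 1) * S 1 = 1" "star (S 2) * S 2 = 1" "star (S 1) * S 2 = 0" "star (S 2) * S 1 = 0"
  using cuntz_star_mult[OF S] cuntz_star_mult[OF S, where x = 1] gens by simp_all

lemma swap_root_mult:
  "swap_root S * S 1 = S 2 * S 1" "swap_root S * (S 2 * S 1) = S 1"
  by (simp_all add: swap_root_def distrib_right left_diff_distrib mult.assoc star_mult cuntz_12)

lemma star_swap_root: "star (swap_root S) = swap_root S"
  by (simp add: swap_root_def star_add star_diff star_mult star_star mult.assoc add.commute)

lemma swap_root_sq: "swap_root S * swap_root S = 1"
proof -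
  have "swap_root S * swap_root S = swap_root S * S 1 * star (S 2 * S 1) + swap_root S * (S 2 * S 1) * star (S 1)
     + swap_root S - swap_root S * S 1 * star (S 1) - swap_root S * (S 2 * S 1) * star (S 2 * S 1)"
    by (subst (2) swap_root_def) (simp add: distrib_left right_diff_distrib mult.assoc)
  then show ?thesis
    unfolding swap_root_mult by (simp add: swap_root_def)
qed

lemma swap_root_cancel: "swap_root S * (swap_root S * x) = x"
  using swap_root_sq by (simp flip: mult.assoc)

lemma star_swap_unitary: "star (swap_unitary S) = swap_unitary S"
  by (simp add: swap_unitary_def star_add star_diff star_mult star_star star_swap_root mult.assoc)

lemma swap_unitary_mult:
  "swap_unitary S * S 1 = S 1 * swap_root S"
  "i \<in> {1..n} \<Longrightarrow> i \<noteq> 1 \<Longrightarrow> swap_unitary S * S i = S i"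
  using cuntz_orthogonal[OF S gens(1), of i]
  by (simp_all add: swap_unitary_def distrib_right left_diff_distrib mult.assoc cuntz_12)

lemma swap_unitary_sq: "swap_unitary S * swap_unitary S = 1"
proof -
  have "swap_unitary S * swap_unitary S
      = swap_unitary S * S 1 * (swap_root S * star (S 1)) + swap_unitary S - swap_unitary S * S 1 * star (S 1)"
    by (subst (2) swap_unitary_def) (simp add: distrib_left right_diff_distrib mult.assoc)
  then show ?thesis
    unfolding swap_unitary_mult by (simp add: swap_unitary_def mult.assoc swap_root_cancel)
qed

lemma unitary_swap: "unitary (swap_unitary S)"
  by (simp add: unitary_def star_swap_unitary swap_unitary_sq)

text \<open>The definitions contain minus signs, which sums of words do not allow. The complement of
  the cylinders 1 and 21 is rewritten as the cylinders \<open>j\<close> with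
  \<open>j \<ge> 3\<close>, an empty family for \<open>n = 2\<close>, together with the
  \<open>2j\<close> with \<open>j \<ge> 2\<close>.\<close>

lemma swap_unitary_poly: "word_poly S {1} (monomials n UNIV) (swap_unitary S)"
proof -
  let ?P = "word_poly S {1} (monomials n UNIV)"
  have mult: "?P (a * b)" if "?P a" "?P b" for a b
    by (rule word_poly_pair_mult_monomials[OF S S that]) auto
  have star: "?P (star a)" if "?P a" for a
    using word_poly_pair_star_monomials[OF that] by simp
  have gen: "?P (S i)" if "i \<in> {1..n}" for i
    by (rule word_poly_pair_subset[OF generator_poly[OF that, where C = "{1}"]]) (auto simp: monomials_def)
  have tail: "1 - S 1 * star (S 1) = (\<Sum>j=2..n. S j * star (S j))"
    using sum_cuntz[OF S] n by (simp add: sum.atLeast_Suc_atMost[of 1] numeral_2_eq_2 algebra_simps)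
  have "(\<Sum>j=2..n. S j * star (S j)) = S 2 * star (S 2) + (\<Sum>j=3..n. S j * star (S j))"
    using sum.atLeast_Suc_atMost[OF n] by simp
  then have tail3: "(\<Sum>j=3..n. S j * star (S j)) = 1 - S 1 * star (S 1) - S 2 * star (S 2)"
    by (simp add: tail)
  have "swap_root S = S 1 * star (S 2 * S 1) + S 2 * S 1 * star (S 1) + (1 - S 1 * star (S 1)) - S 2 * S 1 * star (S 2 * S 1)"
    by (simp add: swap_root_def)
  also have "\<dots> = S 1 * star (S 2 * S 1) + S 2 * S 1 * star (S 1) + (\<Sum>j=3..n. S j * star (S j))
      + S 2 * (1 - S 1 * star (S 1)) * star (S 2)"
    unfolding tail3 by (simp add: algebra_simps star_mult)
  finally have root: "swap_root S = S 1 * star (S 2 * S 1) + S 2 * S 1 * star (S 1) + (\<Sum>j=3..n. S j * star (S j))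
      + S 2 * (\<Sum>j=2..n. S j * star (S j)) * star (S 2)"
    unfolding tail .
  have "?P (swap_root S)"
    unfolding root by (intro word_poly_pair.add mult star gen gens word_poly_pair_sum) auto
  moreover have "swap_unitary S = S 1 * swap_root S * star (S 1) + (\<Sum>j=2..n. S j * star (S j))"
    by (simp add: swap_unitary_def flip: tail)
  ultimately show ?thesis
    by (auto intro!: word_poly_pair.add mult star gen gens word_poly_pair_sum)
qed

text \<open>Here \<open>T 1 = S 1 * R\<close> and \<open>T 2 = S 2\<close> with
  \<open>R = swap_root S\<close>. Apart from the unit, each term of \<open>swap_root T\<close> has
  \<open>T 1\<close> on one side and its adjoint on the other, so two factors \<open>R\<close> meet
  and cancel. Hence \<open>R\<close>, and then the swap itself, is unchanged.\<close>

lemma swap_unitary_fixed: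
  defines "T \<equiv> \<lambda>i. swap_unitary S * S i"
  shows "word_poly_pair S T UNIV (monomials n UNIV) (swap_unitary S) (swap_unitary S)"
proof -
  have T: "cuntz_isometries n T"
    unfolding T_def by (rule unitary_mult_cuntz[OF S unitary_swap])
  let ?P = "word_poly_pair S T UNIV (monomials n UNIV)"
  have mult: "?P (a * b) (a' * b')" if "?P a a'" "?P b b'" for a b a' b'
    by (rule word_poly_pair_mult_monomials[OF S T that]) auto
  have star: "?P (star a) (star a')" if "?P a a'" for a a'
    using word_poly_pair_star_monomials[OF that] by simp
  have gen: "?P (S i) (T i)" if "i \<in> {1..n}" for i
    by (rule word_poly_pair_subset[OF generator_poly[OF that, where C = UNIV]]) (auto simp: monomials_def)
  have one: "?P 1 1"
    using word_poly_pair_mono1[of UNIV "([], [])" "monomials n UNIV" S T] by (simp add: monomials_UNIV)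
  have T12: "T 1 = S 1 * swap_root S" "T 2 = S 2"
    using swap_unitary_mult gens by (simp_all add: T_def)
  have root: "swap_root T = swap_root S"
    unfolding swap_root_def[of T] T12
    by (simp add: star_mult star_swap_root mult.assoc swap_root_cancel) (simp add: swap_root_def star_mult mult.assoc)
  have "swap_unitary T = swap_unitary S"
    unfolding swap_unitary_def[of T] root T12
    by (simp add: star_mult star_swap_root mult.assoc swap_root_cancel) (simp add: swap_unitary_def mult.assoc)
  moreover have "?P (swap_unitary S) (swap_unitary T)"
    unfolding swap_unitary_def swap_root_def
    by (intro word_poly_pair_diff word_poly_pair.add mult star gen gens one)
  ultimately show ?thesis
    by simp
qed

lemma swap_automorphism:
  obtains f where "f \<in> carrier (Aut (cuntz_algebra n S))" "\<And>i. i \<in> {1..n} \<Longrightarrow> f (S i) = swap_unitary S * S i"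
proof -
  let ?O = "cuntz_algebra n S"
  let ?u = "swap_unitary S"
  note A = closed_star_subalgebra_cuntz_algebra[of n S] one_in_cuntz_algebra[OF S]
  define T where "T = (\<lambda>i. ?u * S i)"
  have T: "cuntz_isometries n T"
    unfolding T_def by (rule unitary_mult_cuntz[OF S unitary_swap])
  have u: "?u \<in> ?O"
    by (rule word_poly_in_cuntz_algebra[OF S swap_unitary_poly])
  have "T i \<in> ?O" if "i \<in> {1..n}" for i
    unfolding T_def by (intro cuntz_algebra_closure u generator_in_cuntz_algebra that)
  from cuntz_extension[OF n S T this] obtain f where f: "f \<in> star_endos ?O"
    and f_poly: "\<And>a b. word_poly_pair S T UNIV (monomials n UNIV) a b \<Longrightarrow> f a = b"
    by blast
  have fS: "f (S i) = ?u * S i" if i: "i \<in> {1..n}" for i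
    using f_poly[OF word_poly_pair_subset[OF generator_poly[OF i, where C = UNIV]]] by (auto simp: T_def monomials_def)
  have fu: "f ?u = ?u"
    by (rule f_poly) (use swap_unitary_fixed in \<open>simp add: T_def\<close>)
  have ff: "compose ?O f f \<in> star_endos ?O"
    by (rule star_endo_compose[OF f f A])
  have "compose ?O f f (S i) = S i" if i: "i \<in> {1..n}" for i
  proof -
    have "f (?u * S i) = ?u * (?u * S i)"
      using u generator_in_cuntz_algebra[OF i, of S] by (simp add: star_endo_mult[OF f] fu fS[OF i])
    also have "\<dots> = S i"
      using swap_unitary_sq by (simp flip: mult.assoc)
    finally show ?thesis
      using generator_in_cuntz_algebra[OF i, of S] by (simp add: compose_def fS[OF i])
  qed
  then have "f (f x) = x" if "x \<in> ?O" for x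
    using star_endo_eq_id[OF n S ff _ that] that by (simp add: compose_def)
  then have "bij_betw f ?O ?O"
    using star_endo_in[OF f] by (intro bij_betw_byWitness[where f' = f]) auto
  then have "f \<in> carrier (Aut ?O)"
    using f star_endo_extensional[OF f] by (simp add: carrier_Aut Bij_def)
  then show ?thesis
    using that fS by blast
qed

text \<open>The automorphism of the swap maps \<open>S 1\<close> to an isometry acting on \<open>S 1\<close> as
  \<open>S 1 * (S 2 * S 1)\<close>: a fixed point of degree one goes to one of degree two.\<close>

lemma swap_not_restricted:
  assumes f: "f \<in> carrier (Aut (cuntz_algebra n S))" "\<And>i. i \<in> {1..n} \<Longrightarrow> f (S i) = swap_unitary S * S i"
    and g: "g \<in> lambda_auts n S (P_unitaries n S)"
  shows "out_class (cuntz_algebra n S) f \<noteq> out_class (cuntz_algebra n S) g"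
proof
  let ?O = "cuntz_algebra n S"
  note A = closed_star_subalgebra_cuntz_algebra[of n S] one_in_cuntz_algebra[OF S]
  interpret N: normal "Inn ?O" "Aut ?O"
    by (rule normal_Inn[OF A])
  assume "out_class ?O f = out_class ?O g"
  moreover have "f \<in> out_class ?O f"
    unfolding out_class_def by (rule N.rcos_self[OF f(1) N.subgroup_axioms])
  ultimately obtain h where h: "h \<in> Inn ?O" "f = h \<otimes>\<^bsub>Aut ?O\<^esub> g"
    by (auto simp: out_class_def r_coset_def)
  then obtain w where w: "w \<in> ?O" "unitary w" "h = Ad ?O w"
    by (auto simp: Inn_eq)
  obtain p where gA: "g \<in> carrier (Aut ?O)" and p: "p \<in> P_unitaries n S" and gS: "\<And>i. i \<in> {1..n} \<Longrightarrow> g (S i) = p * S i"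
    using g by (auto simp: lambda_auts_def is_lambda_def)
  have p': "unitary p" "word_poly S {1} (monomials n {0}) p"
    using p by (auto simp: P_unitaries_eq[OF n S])
  have S1: "S 1 \<in> ?O" "isometry (S 1)"
    using generator_in_cuntz_algebra[OF gens(1)] cuntz_isometry[OF S gens(1)] by auto
  \<comment> \<open>\<open>G\<close> is the value of \<open>g\<close> at \<open>S 1\<close>. Moving
    the unitary \<open>w\<close> of the inner automorphism to the other side turns
    \<open>f (S 1) * S 1 = S 1 * B\<close> into an equation between homogeneous \<open>G\<close> and
    \<open>B\<close>, with all trace of \<open>w\<close> absorbed into \<open>y\<close>.\<close>
  define G where "G = p * S 1"
  define B where "B = S 2 * S 1"
  define y where "y = star w * S 1"
  have "G \<in> ?O"
    using gA S1(1) gS[OF gens(1)] star_endo_in by (fastforce simp: G_def carrier_Aut)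
  then have "f (S 1) = w * G * star w"
    unfolding h(2) w(3) mult_Aut[OF Ad_in_Aut[OF A w(1,2)] gA]
    using S1(1) gS[OF gens(1)] by (simp add: compose_def Ad_def G_def)
  moreover have "f (S 1) * S 1 = S 1 * B"
    using f(2)[OF gens(1)] by (simp add: swap_unitary_mult swap_root_mult mult.assoc B_def)
  ultimately have "w * (G * y) = S 1 * B"
    by (simp add: y_def mult.assoc)
  then have "star w * (w * (G * y)) = y * B"
    by (simp add: y_def mult.assoc)
  then have "G * y = y * B"
    by (simp add: unitary_cancel[OF w(2)])
  moreover have "G * y \<noteq> y * B"
  proof (rule degree_obstruction[OF n S])
    show "y \<in> ?O" "isometry y"
      unfolding y_def using w S1 by (auto intro: cuntz_algebra_closure isometry_mult unitary_isometry unitary_star)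
    show "isometry G" "isometry B"
      unfolding G_def B_def using p'(1) S1(2) cuntz_isometry[OF S gens(2)] by (auto intro: isometry_mult unitary_isometry)
    have "word_poly S {1} (monomials n {1}) G"
      unfolding G_def by (rule word_poly_pair_mult_monomials[OF S S p'(2) generator_poly[OF gens(1)]]) auto
    then show "word_poly S UNIV (monomials n {1}) G"
      by (rule word_poly_pair_subset) auto
    show "word_poly S UNIV (monomials n {2}) B"
      unfolding B_def by (rule word_poly_pair_mult_monomials[OF S S generator_poly[OF gens(2)] generator_poly[OF gens(1)]]) auto
  qed
  ultimately show False
    by simp
qed

end

theorem corollary5p3:
  fixes n :: nat and S :: "nat \<Rightarrow> 'a::cstar_algebra"
  assumes "n \<ge> 2" and "cuntz_isometries n S"
  shows "subgroup (outer_Weyl_group n S) (Out (cuntz_algebra n S))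
    \<and> subgroup (restricted_outer_Weyl_group n S)
        (Out (cuntz_algebra n S) \<lparr>carrier := outer_Weyl_group n S\<rparr>)
    \<and> restricted_outer_Weyl_group n S \<noteq> outer_Weyl_group n S"
proof -
  let ?O = "cuntz_algebra n S"
  note A = closed_star_subalgebra_cuntz_algebra[of n S] one_in_cuntz_algebra[OF assms(2)]
  have outer: "subgroup (outer_Weyl_group n S) (Out ?O)"
    unfolding outer_Weyl_group_def S_unitaries_eq[OF assms(2)]
    by (intro subgroup_out_class_image A subgroup_lambda_auts assms) simp
  have restricted: "subgroup (restricted_outer_Weyl_group n S) (Out ?O)"
    unfolding restricted_outer_Weyl_group_def P_unitaries_eq[OF assms]
    by (intro subgroup_out_class_image A subgroup_lambda_auts assms) simp
  have "restricted_outer_Weyl_group n S \<subseteq> outer_Weyl_group n S"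
    by (auto simp: restricted_outer_Weyl_group_def outer_Weyl_group_def lambda_auts_def P_unitaries_def)
  moreover have "group (Out ?O)"
    unfolding Out_def by (rule normal.factorgroup_is_group[OF normal_Inn[OF A]])
  ultimately have sub: "subgroup (restricted_outer_Weyl_group n S) (Out ?O \<lparr>carrier := outer_Weyl_group n S\<rparr>)"
    using group.subgroup_incl[OF _ restricted outer] by blast
  obtain f where f: "f \<in> carrier (Aut ?O)" "\<And>i. i \<in> {1..n} \<Longrightarrow> f (S i) = swap_unitary S * S i"
    using swap_automorphism[OF assms] by blast
  have "swap_unitary S \<in> S_unitaries n S"
    using unitary_swap[OF assms] swap_unitary_poly[OF assms] by (simp add: S_unitaries_eq[OF assms(2)])
  then have "f \<in> lambda_auts n S (S_unitaries n S)"
    using f by (auto simp: lambda_auts_def is_lambda_def carrier_Aut)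
  then have "out_class ?O f \<in> outer_Weyl_group n S"
    by (auto simp: outer_Weyl_group_def)
  moreover have "out_class ?O f \<notin> restricted_outer_Weyl_group n S"
    using swap_not_restricted[OF assms f] by (auto simp: restricted_outer_Weyl_group_def)
  ultimately show ?thesis
    using outer sub by blast
qed

end
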